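(* Let $(M,g)$ be a semi-Riemannian manifold, let $\gamma:[a,b]\to M$ be a geodesic, and let $\mathcal P\subset M$ be a smooth connected submanifold with $\gamma(a)\in\mathcal P$, $\dot\gamma(a)\in T_{\gamma(a)}\mathcal P^\perp$, and such that $g$ restricted to $T_{\gamma(a)}\mathcal P$ is nondegenerate. Assume that either $g$ is Riemannian, or $g$ is Lorentzian (index $1$) and $\gamma$ is timelike (in which case $\mathcal P$ is necessarily spacelike at $\gamma(a)$). Set $$t_0=\sup\big\{t\in\left]a,b\right]:\text{there are no conjugate instants in }\left]a,t\right]\big\},$$ $$t_{\mathcal P}=\sup\big\{t\in\left]a,b\right]:\text{there are no }\mathcal P\text{-focal instants in }\left]a,t\right]\big\}.$$ Then $t_{\mathcal P}\le t_0$, and if $t_{\mathcal P}=t_0$ then the multiplicity of $t_{\mathcal P}$ as a $\mathcal P$-focal point is greater than or equal to its multiplicity as a conjugate point.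
   Context: $\perp$ denotes $g$-orthogonality. Jacobi fields along $\gamma$ are solutions of $\frac{\mathrm D^2}{\mathrm dt^2}J-R(\dot\gamma,J)\dot\gamma=0$, with $R(X,Y)=[\nabla_X,\nabla_Y]-\nabla_{[X,Y]}$. Let $V=T_{\gamma(a)}M\oplus T_{\gamma(a)}M$; for $(v,w)\in V$ let $J_{v,w}$ be the Jacobi field along $\gamma$ with $J(a)=v$, $\frac{\mathrm D}{\mathrm dt}J(a)=w$, and set $\ell(t)=\{(v,w)\in V: J_{v,w}(t)=0\}$ for $t\in[a,b]$, $L_0=\{0\}\oplus T_{\gamma(a)}M=\ell(a)$. Let $S:T_{\gamma(a)}\mathcal P\to T_{\gamma(a)}\mathcal P$ be the $g$-symmetric operator representing the second fundamental form of $\mathcal P$ at $\gamma(a)$ in the normal direction $\dot\gamma(a)$, i.e. $g(S(v),v')=g(\nabla_vV',\dot\gamma(a))$ for any local extension $V'$ of $v'$ to a field tangent to $\mathcal P$, and let $L_{\mathcal P}=\{(v,w)\in V: v\in T_{\gamma(a)}\mathcal P,\ w+S(v)\in T_{\gamma(a)}\mathcal P^\perp\}$. An instant $t\in\left]a,b\right]$ is $\mathcal P$-focal if $\ell(t)\cap L_{\mathcal P}\ne\{0\}$, its multiplicity as a $\mathcal P$-focal point being $\dim(\ell(t)\cap L_{\mathcal P})$; it is conjugate if $\ell(t)\cap L_0\neq\{0\}$, its multiplicity as a conjugate point being $\dim(\ell(t)\cap L_0)$. The multiplicity is understood to be $0$ if the instant is not $\mathcal P$-focal (resp. not conjugate).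 *)

theory Defs
  imports "HOL-Analysis.Analysis"
begin

subsection \<open>Smooth maps between open subsets of Euclidean spaces\<close>

primrec Ck_on :: "nat \<Rightarrow> 'a::euclidean_space set \<Rightarrow> ('a \<Rightarrow> 'b::real_normed_vector) \<Rightarrow> bool" where
  "Ck_on 0 S f \<longleftrightarrow> continuous_on S f"
| "Ck_on (Suc k) S f \<longleftrightarrow>
     (\<forall>x\<in>S. f differentiable (at x)) \<and> (\<forall>v. Ck_on k S (\<lambda>x. frechet_derivative f (at x) v))"

text \<open>Only meaningful for open \<open>S\<close>, the only case used below.\<close>
definition C_infinity_on :: "'a::euclidean_space set \<Rightarrow> ('a \<Rightarrow> 'b::real_normed_vector) \<Rightarrow> bool" where
  "C_infinity_on S f \<longleftrightarrow> (\<forall>k. Ck_on k S f)"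

subsection \<open>Charts and atlases\<close>

text \<open>The manifold is the whole type \<open>'m\<close> with its type-class topology; the model space is \<open>'e\<close>.
  A chart is a pair of its domain and its coordinate map.\<close>

type_synonym ('m, 'e) chart = "'m set \<times> ('m \<Rightarrow> 'e)"

abbreviation dom_of :: "('m, 'e) chart \<Rightarrow> 'm set" where "dom_of c \<equiv> fst c"
abbreviation coord :: "('m, 'e) chart \<Rightarrow> 'm \<Rightarrow> 'e" where "coord c \<equiv> snd c"

definition chart_inv :: "('m, 'e) chart \<Rightarrow> 'e \<Rightarrow> 'm" where
  "chart_inv c = inv_into (dom_of c) (coord c)"

definition is_chart :: "('m::topological_space, 'e::euclidean_space) chart \<Rightarrow> bool" where
  "is_chart c \<longleftrightarrow> open (dom_of c) \<and> open (coord c ` dom_of c) \<and>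
     homeomorphism (dom_of c) (coord c ` dom_of c) (coord c) (chart_inv c)"

definition transition :: "('m, 'e) chart \<Rightarrow> ('m, 'e) chart \<Rightarrow> 'e \<Rightarrow> 'e" where
  "transition c d = coord d \<circ> chart_inv c"

definition compatible ::
    "('m::topological_space, 'e::euclidean_space) chart \<Rightarrow> ('m, 'e) chart \<Rightarrow> bool" where
  "compatible c d \<longleftrightarrow>
     C_infinity_on (coord c ` (dom_of c \<inter> dom_of d)) (transition c d) \<and>
     C_infinity_on (coord d ` (dom_of c \<inter> dom_of d)) (transition d c)"

definition smooth_atlas ::
    "('m::{t2_space, second_countable_topology}, 'e::euclidean_space) chart set \<Rightarrow> bool" where
  "smooth_atlas A \<longleftrightarrow> (\<Union>c\<in>A. dom_of c) = UNIV \<and> (\<forall>c\<in>A. is_chart c) \<and>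
     (\<forall>c\<in>A. \<forall>d\<in>A. compatible c d)"

definition maximal_atlas ::
    "('m::topological_space, 'e::euclidean_space) chart set \<Rightarrow> ('m, 'e) chart set" where
  "maximal_atlas A = {c. is_chart c \<and> (\<forall>d\<in>A. compatible c d)}"

subsection \<open>Tangent vectors\<close>

text \<open>The tangent space at \<open>p\<close> is the model space \<open>'e\<close>: a tangent vector at \<open>p\<close> is given by its
  components in the chart \<open>chart_at A p\<close>, chosen once and for all from the atlas. Components in
  another chart \<open>c\<close> are obtained by applying the differential of the transition map.\<close>

definition chart_at :: "('m, 'e) chart set \<Rightarrow> 'm \<Rightarrow> ('m, 'e) chart" where
  "chart_at A p = (SOME c. c \<in> A \<and> p \<in> dom_of c)"

definition to_chart ::
    "('m, 'e::euclidean_space) chart set \<Rightarrow> ('m, 'e) chart \<Rightarrow> 'm \<Rightarrow> 'e \<Rightarrow> 'e" where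
  "to_chart A c p =
     frechet_derivative (transition (chart_at A p) c) (at (coord (chart_at A p) p))"

definition from_chart ::
    "('m, 'e::euclidean_space) chart set \<Rightarrow> ('m, 'e) chart \<Rightarrow> 'm \<Rightarrow> 'e \<Rightarrow> 'e" where
  "from_chart A c p =
     frechet_derivative (transition c (chart_at A p)) (at (coord c p))"

text \<open>A vector field assigns to each \<open>p\<close> an element of the tangent space at \<open>p\<close>;
  \<open>field_in_chart A c V\<close> is its coordinate expression, a map on \<open>coord c ` dom_of c\<close>.\<close>

definition field_in_chart ::
    "('m, 'e::euclidean_space) chart set \<Rightarrow> ('m, 'e) chart \<Rightarrow> ('m \<Rightarrow> 'e) \<Rightarrow> 'e \<Rightarrow> 'e" where
  "field_in_chart A c V x = to_chart A c (chart_inv c x) (V (chart_inv c x))"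

definition smooth_field_on ::
    "('m, 'e::euclidean_space) chart set \<Rightarrow> 'm set \<Rightarrow> ('m \<Rightarrow> 'e) \<Rightarrow> bool" where
  "smooth_field_on A U V \<longleftrightarrow>
     (\<forall>c\<in>A. C_infinity_on (coord c ` (dom_of c \<inter> U)) (field_in_chart A c V))"

subsection \<open>Semi-Riemannian metrics\<close>

text \<open>A metric is a family \<open>g p\<close> of bilinear forms on the tangent spaces;
  \<open>metric_in_chart A g c x\<close> is its coordinate expression at the point with coordinates \<open>x\<close>.\<close>

definition metric_in_chart ::
    "('m, 'e::euclidean_space) chart set \<Rightarrow> ('m \<Rightarrow> 'e \<Rightarrow> 'e \<Rightarrow> real) \<Rightarrow> ('m, 'e) chart
      \<Rightarrow> 'e \<Rightarrow> 'e \<Rightarrow> 'e \<Rightarrow> real" where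
  "metric_in_chart A g c x u v =
     g (chart_inv c x) (from_chart A c (chart_inv c x) u) (from_chart A c (chart_inv c x) v)"

definition form_index :: "('e::euclidean_space \<Rightarrow> 'e \<Rightarrow> real) \<Rightarrow> nat" where
  "form_index B = Max {dim W |W. subspace W \<and> (\<forall>w\<in>W. w \<noteq> 0 \<longrightarrow> B w w < 0)}"

definition nondegenerate_on :: "('e::real_vector \<Rightarrow> 'e \<Rightarrow> real) \<Rightarrow> 'e set \<Rightarrow> bool" where
  "nondegenerate_on B W \<longleftrightarrow> (\<forall>u\<in>W. (\<forall>v\<in>W. B u v = 0) \<longrightarrow> u = 0)"

definition semi_riemannian ::
    "('m::{t2_space, second_countable_topology}, 'e::euclidean_space) chart set
      \<Rightarrow> ('m \<Rightarrow> 'e \<Rightarrow> 'e \<Rightarrow> real) \<Rightarrow> bool" where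
  "semi_riemannian A g \<longleftrightarrow> smooth_atlas A \<and>
     (\<forall>p. bilinear (g p) \<and> (\<forall>u v. g p u v = g p v u) \<and> nondegenerate_on (g p) UNIV) \<and>
     (\<forall>c\<in>A. \<forall>u v. C_infinity_on (coord c ` dom_of c) (\<lambda>x. metric_in_chart A g c x u v)) \<and>
     (\<exists>\<nu>. \<forall>p. form_index (g p) = \<nu>)"

definition riemannian :: "('m \<Rightarrow> 'e::euclidean_space \<Rightarrow> 'e \<Rightarrow> real) \<Rightarrow> bool" where
  "riemannian g \<longleftrightarrow> (\<forall>p u. u \<noteq> 0 \<longrightarrow> g p u u > 0)"

definition lorentzian :: "('m \<Rightarrow> 'e::euclidean_space \<Rightarrow> 'e \<Rightarrow> real) \<Rightarrow> bool" where
  "lorentzian g \<longleftrightarrow> (\<forall>p. form_index (g p) = 1)"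

subsection \<open>Levi-Civita connection and curvature\<close>

text \<open>The bilinear map whose components are the Christoffel symbols
  \<open>\<Gamma>\<^sup>k\<^sub>i\<^sub>j = g\<^sup>k\<^sup>l (\<partial>\<^sub>i g\<^sub>j\<^sub>l + \<partial>\<^sub>j g\<^sub>i\<^sub>l - \<partial>\<^sub>l g\<^sub>i\<^sub>j) / 2\<close>
  of the chart \<open>c\<close>, the inverse metric being avoided by pairing with an arbitrary vector \<open>w\<close>
  (the Koszul formula for fields with constant components).\<close>

definition christoffel ::
    "('m, 'e::euclidean_space) chart set \<Rightarrow> ('m \<Rightarrow> 'e \<Rightarrow> 'e \<Rightarrow> real) \<Rightarrow> ('m, 'e) chart
      \<Rightarrow> 'e \<Rightarrow> 'e \<Rightarrow> 'e \<Rightarrow> 'e" where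
  "christoffel A g c x u v = (THE z. \<forall>w. metric_in_chart A g c x z w =
     (frechet_derivative (\<lambda>y. metric_in_chart A g c y v w) (at x) u
      + frechet_derivative (\<lambda>y. metric_in_chart A g c y u w) (at x) v
      - frechet_derivative (\<lambda>y. metric_in_chart A g c y u v) (at x) w) / 2)"

text \<open>In the next three definitions \<open>X\<close>, \<open>Y\<close>, \<open>Z\<close> are coordinate expressions of vector fields
  in the chart \<open>c\<close>.\<close>

definition nabla_in_chart ::
    "('m, 'e::euclidean_space) chart set \<Rightarrow> ('m \<Rightarrow> 'e \<Rightarrow> 'e \<Rightarrow> real) \<Rightarrow> ('m, 'e) chart
      \<Rightarrow> ('e \<Rightarrow> 'e) \<Rightarrow> ('e \<Rightarrow> 'e) \<Rightarrow> 'e \<Rightarrow> 'e" where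
  "nabla_in_chart A g c X Z =
     (\<lambda>x. frechet_derivative Z (at x) (X x) + christoffel A g c x (X x) (Z x))"

definition bracket_in_chart :: "('e \<Rightarrow> 'e) \<Rightarrow> ('e \<Rightarrow> 'e) \<Rightarrow> 'e::euclidean_space \<Rightarrow> 'e" where
  "bracket_in_chart X Y =
     (\<lambda>x. frechet_derivative Y (at x) (X x) - frechet_derivative X (at x) (Y x))"

definition curvature_in_chart ::
    "('m, 'e::euclidean_space) chart set \<Rightarrow> ('m \<Rightarrow> 'e \<Rightarrow> 'e \<Rightarrow> real) \<Rightarrow> ('m, 'e) chart
      \<Rightarrow> ('e \<Rightarrow> 'e) \<Rightarrow> ('e \<Rightarrow> 'e) \<Rightarrow> ('e \<Rightarrow> 'e) \<Rightarrow> 'e \<Rightarrow> 'e" where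
  "curvature_in_chart A g c X Y Z =
     (\<lambda>x. nabla_in_chart A g c X (nabla_in_chart A g c Y Z) x
        - nabla_in_chart A g c Y (nabla_in_chart A g c X Z) x
        - nabla_in_chart A g c (bracket_in_chart X Y) Z x)"

text \<open>\<open>R(u,v)w\<close> at \<open>p\<close> and \<open>\<nabla>\<^sub>v V\<close> at \<open>p\<close>. By tensoriality the former may be computed with any
  extension of \<open>u\<close>, \<open>v\<close>, \<open>w\<close>; we take the one with constant components in \<open>chart_at A p\<close>.
  Components at \<open>p\<close> in \<open>chart_at A p\<close> are the tangent vector itself, so no conversion is needed.\<close>

definition curvature ::
    "('m, 'e::euclidean_space) chart set \<Rightarrow> ('m \<Rightarrow> 'e \<Rightarrow> 'e \<Rightarrow> real) \<Rightarrow> 'm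
      \<Rightarrow> 'e \<Rightarrow> 'e \<Rightarrow> 'e \<Rightarrow> 'e" where
  "curvature A g p u v w = curvature_in_chart A g (chart_at A p)
     (\<lambda>_. u) (\<lambda>_. v) (\<lambda>_. w) (coord (chart_at A p) p)"

definition nabla ::
    "('m, 'e::euclidean_space) chart set \<Rightarrow> ('m \<Rightarrow> 'e \<Rightarrow> 'e \<Rightarrow> real) \<Rightarrow> 'm
      \<Rightarrow> 'e \<Rightarrow> ('m \<Rightarrow> 'e) \<Rightarrow> 'e" where
  "nabla A g p v V = nabla_in_chart A g (chart_at A p)
     (\<lambda>_. v) (field_in_chart A (chart_at A p) V) (coord (chart_at A p) p)"

subsection \<open>Geodesics and Jacobi fields\<close>

definition velocity ::
    "('m, 'e::euclidean_space) chart set \<Rightarrow> real \<Rightarrow> real \<Rightarrow> (real \<Rightarrow> 'm) \<Rightarrow> real \<Rightarrow> 'e" where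
  "velocity A a b \<gamma> t =
     vector_derivative (coord (chart_at A (\<gamma> t)) \<circ> \<gamma>) (at t within {a..b})"

text \<open>\<open>V s\<close> is a tangent vector at \<open>\<gamma> s\<close> for every \<open>s\<close>. The predicate says that \<open>V\<close> is
  differentiable at \<open>t\<close> with \<open>DV/dt = w\<close> there, i.e. that in every chart around \<open>\<gamma> t\<close> the
  components of \<open>w\<close> are \<open>d/dt V\<^sup>k + \<Gamma>\<^sup>k\<^sub>i\<^sub>j (d/dt \<gamma>\<^sup>i) V\<^sup>j\<close>.\<close>

definition has_cov_deriv ::
    "('m, 'e::euclidean_space) chart set \<Rightarrow> ('m \<Rightarrow> 'e \<Rightarrow> 'e \<Rightarrow> real) \<Rightarrow> real \<Rightarrow> real
      \<Rightarrow> (real \<Rightarrow> 'm) \<Rightarrow> (real \<Rightarrow> 'e) \<Rightarrow> 'e \<Rightarrow> real \<Rightarrow> bool" where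
  "has_cov_deriv A g a b \<gamma> V w t \<longleftrightarrow> (\<forall>c\<in>A. \<gamma> t \<in> dom_of c \<longrightarrow>
     ((\<lambda>s. to_chart A c (\<gamma> s) (V s)) has_vector_derivative
       (to_chart A c (\<gamma> t) w
        - christoffel A g c (coord c (\<gamma> t))
            (to_chart A c (\<gamma> t) (velocity A a b \<gamma> t)) (to_chart A c (\<gamma> t) (V t))))
     (at t within {a..b}))"

text \<open>Twice differentiable solutions of the geodesic (and of the Jacobi) equation are
  automatically smooth.\<close>

definition geodesic ::
    "('m::topological_space, 'e::euclidean_space) chart set \<Rightarrow> ('m \<Rightarrow> 'e \<Rightarrow> 'e \<Rightarrow> real)
      \<Rightarrow> real \<Rightarrow> real \<Rightarrow> (real \<Rightarrow> 'm) \<Rightarrow> bool" where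
  "geodesic A g a b \<gamma> \<longleftrightarrow> continuous_on {a..b} \<gamma> \<and>
     (\<forall>t\<in>{a..b}. (coord (chart_at A (\<gamma> t)) \<circ> \<gamma>) differentiable (at t within {a..b})) \<and>
     (\<forall>t\<in>{a..b}. has_cov_deriv A g a b \<gamma> (velocity A a b \<gamma>) 0 t)"

text \<open>\<open>J\<close> is a Jacobi field along \<open>\<gamma>\<close> and \<open>J'\<close> is its covariant derivative.\<close>

definition jacobi_field ::
    "('m, 'e::euclidean_space) chart set \<Rightarrow> ('m \<Rightarrow> 'e \<Rightarrow> 'e \<Rightarrow> real) \<Rightarrow> real \<Rightarrow> real
      \<Rightarrow> (real \<Rightarrow> 'm) \<Rightarrow> (real \<Rightarrow> 'e) \<Rightarrow> (real \<Rightarrow> 'e) \<Rightarrow> bool" where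
  "jacobi_field A g a b \<gamma> J J' \<longleftrightarrow> (\<forall>t\<in>{a..b}.
     has_cov_deriv A g a b \<gamma> J (J' t) t \<and>
     has_cov_deriv A g a b \<gamma> J'
       (curvature A g (\<gamma> t) (velocity A a b \<gamma> t) (J t) (velocity A a b \<gamma> t)) t)"

text \<open>Values outside \<open>{a..b}\<close> are not determined, whence \<open>SOME\<close>; on \<open>{a..b}\<close> the Jacobi field
  with given initial data exists and is unique.\<close>

definition jacobi_from ::
    "('m, 'e::euclidean_space) chart set \<Rightarrow> ('m \<Rightarrow> 'e \<Rightarrow> 'e \<Rightarrow> real) \<Rightarrow> real \<Rightarrow> real
      \<Rightarrow> (real \<Rightarrow> 'm) \<Rightarrow> 'e \<Rightarrow> 'e \<Rightarrow> real \<Rightarrow> 'e" where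
  "jacobi_from A g a b \<gamma> v w =
     (SOME J. \<exists>J'. jacobi_field A g a b \<gamma> J J' \<and> J a = v \<and> J' a = w)"

definition ell ::
    "('m, 'e::euclidean_space) chart set \<Rightarrow> ('m \<Rightarrow> 'e \<Rightarrow> 'e \<Rightarrow> real) \<Rightarrow> real \<Rightarrow> real
      \<Rightarrow> (real \<Rightarrow> 'm) \<Rightarrow> real \<Rightarrow> ('e \<times> 'e) set" where
  "ell A g a b \<gamma> t = {(v, w). jacobi_from A g a b \<gamma> v w t = 0}"

subsection \<open>Submanifolds\<close>

text \<open>Embedded submanifolds, by slice charts.\<close>

definition submanifold ::
    "('m::topological_space, 'e::euclidean_space) chart set \<Rightarrow> 'm set \<Rightarrow> bool" where
  "submanifold A P \<longleftrightarrow> (\<exists>k. \<forall>p\<in>P. \<exists>c\<in>maximal_atlas A. \<exists>W. p \<in> dom_of c \<and>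
     subspace W \<and> dim W = k \<and> coord c ` (dom_of c \<inter> P) = coord c ` dom_of c \<inter> W)"

definition smooth_curve_on ::
    "('m::topological_space, 'e::euclidean_space) chart set \<Rightarrow> real set \<Rightarrow> (real \<Rightarrow> 'm) \<Rightarrow> bool" where
  "smooth_curve_on A T \<sigma> \<longleftrightarrow> continuous_on T \<sigma> \<and>
     (\<forall>c\<in>A. C_infinity_on {t\<in>T. \<sigma> t \<in> dom_of c} (coord c \<circ> \<sigma>))"

definition tangent_space ::
    "('m::topological_space, 'e::euclidean_space) chart set \<Rightarrow> 'm set \<Rightarrow> 'm \<Rightarrow> 'e set" where
  "tangent_space A P p = {v. \<exists>\<sigma> \<epsilon>. \<epsilon> > 0 \<and> smooth_curve_on A {-\<epsilon><..<\<epsilon>} \<sigma> \<and>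
     \<sigma> ` {-\<epsilon><..<\<epsilon>} \<subseteq> P \<and> \<sigma> 0 = p \<and>
     ((coord (chart_at A p) \<circ> \<sigma>) has_vector_derivative v) (at 0)}"

definition orth :: "('e \<Rightarrow> 'e \<Rightarrow> real) \<Rightarrow> 'e set \<Rightarrow> 'e set" where
  "orth B W = {z. \<forall>u\<in>W. B z u = 0}"

definition tangent_extension ::
    "('m::topological_space, 'e::euclidean_space) chart set \<Rightarrow> 'm set \<Rightarrow> 'm \<Rightarrow> 'e
      \<Rightarrow> ('m \<Rightarrow> 'e) \<Rightarrow> bool" where
  "tangent_extension A P p v V \<longleftrightarrow> (\<exists>U. open U \<and> p \<in> U \<and> smooth_field_on A U V \<and>
     V p = v \<and> (\<forall>q\<in>U \<inter> P. V q \<in> tangent_space A P q))"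

text \<open>\<open>S\<close>, of which only the restriction to the tangent space of \<open>P\<close> matters, is the
  \<open>g\<close>-symmetric operator representing the second fundamental form of \<open>P\<close> at \<open>p\<close> in the normal
  direction \<open>n\<close>.\<close>

definition second_fundamental_operator ::
    "('m::topological_space, 'e::euclidean_space) chart set \<Rightarrow> ('m \<Rightarrow> 'e \<Rightarrow> 'e \<Rightarrow> real)
      \<Rightarrow> 'm set \<Rightarrow> 'm \<Rightarrow> 'e \<Rightarrow> ('e \<Rightarrow> 'e) \<Rightarrow> bool" where
  "second_fundamental_operator A g P p n S \<longleftrightarrow> (let T = tangent_space A P p in
     S ` T \<subseteq> T \<and>
     (\<forall>u\<in>T. \<forall>v\<in>T. S (u + v) = S u + S v) \<and> (\<forall>r. \<forall>v\<in>T. S (r *\<^sub>R v) = r *\<^sub>R S v) \<and>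
     (\<forall>u\<in>T. \<forall>v\<in>T. g p (S u) v = g p u (S v)) \<and>
     (\<forall>v\<in>T. \<forall>v'\<in>T. \<forall>V. tangent_extension A P p v' V \<longrightarrow>
        g p (S v) v' = g p (nabla A g p v V) n))"

subsection \<open>Conjugate and focal instants\<close>

definition L0 :: "('e::real_vector \<times> 'e) set" where
  "L0 = {0} \<times> UNIV"

definition LP ::
    "('m::topological_space, 'e::euclidean_space) chart set \<Rightarrow> ('m \<Rightarrow> 'e \<Rightarrow> 'e \<Rightarrow> real)
      \<Rightarrow> 'm set \<Rightarrow> 'm \<Rightarrow> ('e \<Rightarrow> 'e) \<Rightarrow> ('e \<times> 'e) set" where
  "LP A g P p S = {(v, w). v \<in> tangent_space A P p \<and> w + S v \<in> orth (g p) (tangent_space A P p)}"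

definition conjugate_instant ::
    "('m, 'e::euclidean_space) chart set \<Rightarrow> ('m \<Rightarrow> 'e \<Rightarrow> 'e \<Rightarrow> real) \<Rightarrow> real \<Rightarrow> real
      \<Rightarrow> (real \<Rightarrow> 'm) \<Rightarrow> real \<Rightarrow> bool" where
  "conjugate_instant A g a b \<gamma> t \<longleftrightarrow> t \<in> {a<..b} \<and> ell A g a b \<gamma> t \<inter> L0 \<noteq> {0}"

definition conjugate_multiplicity ::
    "('m, 'e::euclidean_space) chart set \<Rightarrow> ('m \<Rightarrow> 'e \<Rightarrow> 'e \<Rightarrow> real) \<Rightarrow> real \<Rightarrow> real
      \<Rightarrow> (real \<Rightarrow> 'm) \<Rightarrow> real \<Rightarrow> nat" where
  "conjugate_multiplicity A g a b \<gamma> t =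
     (if conjugate_instant A g a b \<gamma> t then dim (ell A g a b \<gamma> t \<inter> L0) else 0)"

definition focal_instant ::
    "('m::topological_space, 'e::euclidean_space) chart set \<Rightarrow> ('m \<Rightarrow> 'e \<Rightarrow> 'e \<Rightarrow> real)
      \<Rightarrow> real \<Rightarrow> real \<Rightarrow> (real \<Rightarrow> 'm) \<Rightarrow> 'm set \<Rightarrow> ('e \<Rightarrow> 'e) \<Rightarrow> real \<Rightarrow> bool" where
  "focal_instant A g a b \<gamma> P S t \<longleftrightarrow>
     t \<in> {a<..b} \<and> ell A g a b \<gamma> t \<inter> LP A g P (\<gamma> a) S \<noteq> {0}"

definition focal_multiplicity ::
    "('m::topological_space, 'e::euclidean_space) chart set \<Rightarrow> ('m \<Rightarrow> 'e \<Rightarrow> 'e \<Rightarrow> real)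
      \<Rightarrow> real \<Rightarrow> real \<Rightarrow> (real \<Rightarrow> 'm) \<Rightarrow> 'm set \<Rightarrow> ('e \<Rightarrow> 'e) \<Rightarrow> real \<Rightarrow> nat" where
  "focal_multiplicity A g a b \<gamma> P S t =
     (if focal_instant A g a b \<gamma> P S t
      then dim (ell A g a b \<gamma> t \<inter> LP A g P (\<gamma> a) S) else 0)"

definition first_conjugate ::
    "('m, 'e::euclidean_space) chart set \<Rightarrow> ('m \<Rightarrow> 'e \<Rightarrow> 'e \<Rightarrow> real) \<Rightarrow> real \<Rightarrow> real
      \<Rightarrow> (real \<Rightarrow> 'm) \<Rightarrow> real" where
  "first_conjugate A g a b \<gamma> =
     Sup {t \<in> {a<..b}. \<forall>s\<in>{a<..t}. \<not> conjugate_instant A g a b \<gamma> s}"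

definition first_focal ::
    "('m::topological_space, 'e::euclidean_space) chart set \<Rightarrow> ('m \<Rightarrow> 'e \<Rightarrow> 'e \<Rightarrow> real)
      \<Rightarrow> real \<Rightarrow> real \<Rightarrow> (real \<Rightarrow> 'm) \<Rightarrow> 'm set \<Rightarrow> ('e \<Rightarrow> 'e) \<Rightarrow> real" where
  "first_focal A g a b \<gamma> P S =
     Sup {t \<in> {a<..b}. \<forall>s\<in>{a<..t}. \<not> focal_instant A g a b \<gamma> P S s}"

end

theory Submission
  imports Defs
begin

text \<open>
  Parallel transport along \<open>\<gamma>\<close> turns the Jacobi equation into \<open>y'' = K y\<close> in a fixed vector
  space with a constant form \<open>B = g (\<gamma> a)\<close> for which \<open>K t\<close> is symmetric. The core of the argument is
  that if there is no focal instant in \<open>]a,\<tau>[\<close> and a Jacobi field \<open>J\<close> vanishes at \<open>a\<close> and at \<open>\<tau>\<close>,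
  then \<open>J' a\<close> is orthogonal to the tangent space of \<open>P\<close>; hence \<open>\<ell>(\<tau>) \<inter> L\<^sub>0 \<subseteq> \<ell>(\<tau>) \<inter> L\<^sub>P\<close>,
  which gives both claims.

  Suppose that the projection \<open>p w\<close> of \<open>w = J' a\<close> to the tangent space is not zero. Let
  \<open>U\<close> be the matrix solution spanning the focal fields, and compare \<open>J\<close> with the focal field
  \<open>Y = U c\<close> through \<open>J d\<close>, for \<open>d\<close> close to \<open>a\<close>: by conservation of the Wronskian
  \<open>B (J' d - Y' d) (J d) = B (Y a) w\<close>, which is approximately \<open>(d - a) B (p w) (p w) > 0\<close>. On the other hand, for
  \<open>V = U c\<close> on \<open>[d,\<tau>[\<close> one has \<open>(B V' V - B (U' c) V)' = B (V'' - K V) V + B (U c') (U c')\<close>, and the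
  last term is nonnegative because the fields stay orthogonal to \<open>\<gamma>'\<close> if \<open>g\<close> is Lorentzian. For
  \<open>V\<close> equal to \<open>J\<close> up to a linear correction that makes it vanish at \<open>\<tau>' < \<tau>\<close>, and \<open>\<tau>'\<close> tending
  to \<open>\<tau>\<close>, this gives \<open>B (J' d - Y' d) (J d) \<le> 0\<close>, a contradiction.
\<close>

text \<open>The matrix \<open>U\<close> can be trusted to be invertible only strictly between
  \<open>a\<close> and \<open>\<tau>\<close>: \<open>U a\<close> is the projection, with the tangent
  space of the submanifold as its range, and \<open>U \<tau>\<close> may be singular, since
  \<open>\<tau>\<close> is allowed to be focal. This forces the two cut-offs, and their order
  matters. The left one, \<open>d\<close>, is fixed first and yields a positive constant
  \<open>\<kappa>\<close>; only then does the right one tend to \<open>\<tau>\<close>, so that the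
  error of the linear correction, controlled by the norm of \<open>J\<close> at the cut-off,
  disappears while \<open>\<kappa>\<close> stays.

  Rescaling the normal directions by \<open>1 / (s - a)\<close> cures the degeneracy at
  \<open>a\<close>. It gives the asymptotics of \<open>c\<close> there, and also the absence of
  focal instants just after \<open>a\<close>, without which the first focal instant would be the
  supremum of an empty set.

  The Riemannian and the Lorentzian case are treated at once by a vector \<open>n\<close>, zero if
  \<open>g\<close> is Riemannian and the initial velocity otherwise: the form is nonnegative on the
  orthogonal complement of \<open>n\<close>, and \<open>n\<close> lies in the kernel of every
  \<open>K t\<close>.\<close>

section \<open>Linear equations depending on a parameter\<close>

lemma linear_norm_le_sum_Basis:
  fixes L :: "'e::euclidean_space \<Rightarrow> 'f::real_normed_vector"
  assumes "linear L"
  shows "norm (L x) \<le> (\<Sum>b\<in>Basis. norm (L b)) * norm x"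
proof -
  have "L x = (\<Sum>b\<in>Basis. (x \<bullet> b) *\<^sub>R L b)"
    by (subst euclidean_representation[symmetric, of x])
      (simp add: linear_sum[OF assms] linear_cmul[OF assms])
  also have "norm \<dots> \<le> (\<Sum>b\<in>Basis. norm x * norm (L b))"
    by (rule order_trans[OF norm_sum], rule sum_mono) (auto intro!: mult_right_mono Basis_le_norm)
  finally show ?thesis by (simp add: sum_distrib_left mult.commute)
qed

lemma linear_expand:
  fixes L :: "'e::euclidean_space \<Rightarrow> 'f::real_vector"
  assumes "linear L"
  shows "L x = (\<Sum>b\<in>Basis. (x \<bullet> b) *\<^sub>R L b)"
  by (subst euclidean_representation[symmetric, of x])
     (simp add: linear_sum[OF assms] linear_cmul[OF assms])

text \<open>Convergence on the basis vectors is already convergence in operator norm, so half of the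
  lower bound of \<open>A0\<close> survives for nearby parameters.\<close>

lemma eventually_linear_bounded_below:
  fixes A :: "'s \<Rightarrow> 'e::euclidean_space \<Rightarrow> 'f::euclidean_space"
  assumes lin: "\<forall>\<^sub>F s in F. linear (A s)" and lin0: "linear A0" and inj: "inj A0"
    and lim: "\<And>x. ((\<lambda>s. A s x) \<longlongrightarrow> A0 x) F"
  obtains m where "m > 0" "\<forall>\<^sub>F s in F. \<forall>x. m * norm x \<le> norm (A s x)"
proof -
  obtain m where m: "m > 0" "\<And>x. m * norm x \<le> norm (A0 x)"
    using linear_inj_bounded_below_pos[OF lin0 inj] by blast
  have "((\<lambda>s. \<Sum>b\<in>Basis. norm (A s b - A0 b)) \<longlongrightarrow> (\<Sum>b\<in>(Basis::'e set). norm (A0 b - A0 b))) F"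
    by (intro tendsto_intros lim)
  then have ev: "\<forall>\<^sub>F s in F. (\<Sum>b\<in>Basis. norm (A s b - A0 b)) < m / 2"
    using m(1) by (intro order_tendstoD(2)[where y="_::real"]) auto
  have "\<forall>\<^sub>F s in F. \<forall>x. m / 2 * norm x \<le> norm (A s x)"
    using ev lin
  proof eventually_elim
    case (elim s)
    have "linear (\<lambda>x. A s x - A0 x)" using elim lin0 by (simp add: linear_compose_sub)
    then have *: "norm (A s x - A0 x) \<le> m / 2 * norm x" for x
      using linear_norm_le_sum_Basis[of "\<lambda>x. A s x - A0 x" x] elim(1)
      by (smt (verit) mult_right_mono norm_ge_zero)
    show ?case
    proof
      fix x
      have "norm (A0 x) \<le> norm (A s x) + norm (A s x - A0 x)" by norm
      then show "m / 2 * norm x \<le> norm (A s x)" using m(2)[of x] *[of x] by simp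
    qed
  qed
  then show ?thesis using that[of "m/2"] m(1) by simp
qed

lemma eventually_inj_of_tendsto:
  fixes A :: "'s \<Rightarrow> 'e::euclidean_space \<Rightarrow> 'f::euclidean_space"
  assumes "\<forall>\<^sub>F s in F. linear (A s)" "linear A0" "inj A0" "\<And>x. ((\<lambda>s. A s x) \<longlongrightarrow> A0 x) F"
  shows "\<forall>\<^sub>F s in F. inj (A s)"
proof -
  obtain m where m: "m > 0" "\<forall>\<^sub>F s in F. \<forall>x. m * norm x \<le> norm (A s x)"
    using eventually_linear_bounded_below[OF assms] .
  show ?thesis using m(2) assms(1)
  proof eventually_elim
    case (elim s)
    have "x = 0" if "A s x = 0" for x
      using elim(1)[rule_format, of x] that m(1) by (simp add: mult_le_0_iff)
    with elim(2) show ?case using linear_injective_0 by blast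
  qed
qed

text \<open>Stands in for the continuity of matrix inversion: the uniform lower bound carries
  convergence of the right-hand sides over to the solutions.\<close>

lemma tendsto_linear_solve:
  fixes A :: "'s \<Rightarrow> 'e::euclidean_space \<Rightarrow> 'f::euclidean_space"
  assumes "\<forall>\<^sub>F s in F. linear (A s)" "linear A0" "inj A0" "\<And>x. ((\<lambda>s. A s x) \<longlongrightarrow> A0 x) F"
    and lim: "((\<lambda>s. A s (z s)) \<longlongrightarrow> A0 z0) F"
  shows "(z \<longlongrightarrow> z0) F"
proof -
  obtain m where m: "m > 0" "\<forall>\<^sub>F s in F. \<forall>x. m * norm x \<le> norm (A s x)"
    using eventually_linear_bounded_below[OF assms(1-4)] .
  have "((\<lambda>s. norm (A s (z s) - A s z0) / m) \<longlongrightarrow> norm (A0 z0 - A0 z0) / m) F"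
    using m(1) by (intro tendsto_intros lim assms(4)) auto
  then have *: "((\<lambda>s. norm (A s (z s) - A s z0) / m) \<longlongrightarrow> 0) F" by simp
  have "((\<lambda>s. z s - z0) \<longlongrightarrow> 0) F"
  proof (rule Lim_null_comparison[OF _ *])
    show "\<forall>\<^sub>F s in F. norm (z s - z0) \<le> norm (A s (z s) - A s z0) / m"
      using m(2) assms(1)
    proof eventually_elim
      case (elim s)
      show ?case using elim(1)[rule_format, of "z s - z0"] m(1)
        by (simp add: linear_diff[OF elim(2)] field_simps)
    qed
  qed
  then show ?thesis by (simp add: LIM_zero_iff)
qed

text \<open>Implicit differentiation of \<open>A y (z y) = k y\<close>; the product rule dictates
  the equation for \<open>z'\<close>. To see that \<open>z'\<close> is the derivative,
  \<open>A y\<close> is applied to the difference quotient of \<open>z\<close>: this turns it into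
  the three remainders \<open>q1\<close>, \<open>q2\<close>, \<open>q3\<close>, and
  \<open>tendsto_linear_solve\<close> removes \<open>A y\<close> again.\<close>

lemma has_derivative_linear_solve:
  fixes A :: "'a::euclidean_space \<Rightarrow> 'e::euclidean_space \<Rightarrow> 'f::euclidean_space"
  assumes lin: "\<forall>\<^sub>F y in at x within S. linear (A y)" and lin0: "linear (A x)" and inj: "inj (A x)"
    and dA: "\<And>v. ((\<lambda>y. A y v) has_derivative A' v) (at x within S)"
    and dk: "(k has_derivative k') (at x within S)"
    and eq: "\<forall>\<^sub>F y in at x within S. A y (z y) = k y" and eq0: "A x (z x) = k x"
    and z': "\<And>h. A x (z' h) = k' h - A' (z x) h"
  shows "(z has_derivative z') (at x within S)"
proof -
  have lA': "linear (A' v)" for v using dA by (rule has_derivative_linear)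
  have lk': "linear k'" using dk by (rule has_derivative_linear)
  have add: "z' (h + h') = z' h + z' h'" for h h'
    by (rule injD[OF inj]) (simp add: linear_add[OF lin0] z' linear_add[OF lA'] linear_add[OF lk'])
  have scale: "z' (r *\<^sub>R h) = r *\<^sub>R z' h" for r h
    by (rule injD[OF inj])
      (simp add: linear_cmul[OF lin0] z' linear_cmul[OF lA'] linear_cmul[OF lk'] scaleR_diff_right)
  have lz': "linear z'" using add scale by (rule linearI)
  then have blz': "bounded_linear z'" by (simp add: linear_conv_bounded_linear)
  obtain Cz where Cz: "\<And>h. norm (z' h) \<le> Cz * norm h" "Cz > 0" using linear_bounded_pos[OF lz'] by blast
  define F where "F = at x within S"
  have lim: "((\<lambda>y. A y v) \<longlongrightarrow> A x v) F" for v
    using has_derivative_continuous[OF dA[of v]] unfolding F_def by (simp add: continuous_within)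
  have q1: "((\<lambda>y. (k y - k x - k' (y - x)) /\<^sub>R norm (y - x)) \<longlongrightarrow> 0) F"
    using dk unfolding F_def has_derivative_within by (auto simp: algebra_simps inverse_eq_divide)
  have q2: "((\<lambda>y. (A y (z x) - A x (z x) - A' (z x) (y - x)) /\<^sub>R norm (y - x)) \<longlongrightarrow> 0) F"
    using dA[of "z x"] unfolding F_def has_derivative_within by (auto simp: algebra_simps inverse_eq_divide)
  \<comment> \<open>This remainder is small because \<open>z' (y - x)\<close> is at most
    \<open>Cz * norm (y - x)\<close> while \<open>A y - A x\<close> tends to zero in operator
    norm.\<close>
  have q3: "((\<lambda>y. (A y (z' (y - x)) - A x (z' (y - x))) /\<^sub>R norm (y - x)) \<longlongrightarrow> 0) F"
  proof (rule Lim_null_comparison)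
    have "((\<lambda>y. (\<Sum>b\<in>Basis. norm (A y b - A x b)) * Cz) \<longlongrightarrow> (\<Sum>b\<in>(Basis::'e set). norm (A x b - A x b)) * Cz) F"
      by (intro tendsto_intros lim)
    then show "((\<lambda>y. (\<Sum>b\<in>(Basis::'e set). norm (A y b - A x b)) * Cz) \<longlongrightarrow> 0) F" by simp
    show "\<forall>\<^sub>F y in F. norm ((A y (z' (y - x)) - A x (z' (y - x))) /\<^sub>R norm (y - x))
        \<le> (\<Sum>b\<in>Basis. norm (A y b - A x b)) * Cz"
      using lin unfolding F_def
    proof eventually_elim
      case (elim y)
      let ?s = "\<Sum>b\<in>Basis. norm (A y b - A x b)"
      have "linear (\<lambda>v. A y v - A x v)" using elim lin0 by (simp add: linear_compose_sub)
      from linear_norm_le_sum_Basis[OF this, of "z' (y - x)"]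
      have "norm (A y (z' (y - x)) - A x (z' (y - x))) \<le> ?s * norm (z' (y - x))" .
      also have "\<dots> \<le> ?s * (Cz * norm (y - x))"
        by (intro mult_left_mono Cz sum_nonneg) auto
      finally have "norm (A y (z' (y - x)) - A x (z' (y - x))) \<le> (?s * Cz) * norm (y - x)"
        by (simp add: mult.assoc)
      moreover have "0 \<le> ?s * Cz" using Cz(2) by (intro mult_nonneg_nonneg sum_nonneg) auto
      ultimately show ?case
        by (cases "y = x") (auto simp: divide_le_eq inverse_eq_divide)
    qed
  qed
  have "((\<lambda>y. A y ((z y - z x - z' (y - x)) /\<^sub>R norm (y - x))) \<longlongrightarrow> A x 0) F"
  proof (rule Lim_transform_eventually)
    show "((\<lambda>y. (k y - k x - k' (y - x)) /\<^sub>R norm (y - x)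
       - (A y (z x) - A x (z x) - A' (z x) (y - x)) /\<^sub>R norm (y - x)
       - (A y (z' (y - x)) - A x (z' (y - x))) /\<^sub>R norm (y - x)) \<longlongrightarrow> A x 0) F"
      using tendsto_diff[OF tendsto_diff[OF q1 q2] q3] by (simp add: linear_0[OF lin0])
    show "\<forall>\<^sub>F y in F. (k y - k x - k' (y - x)) /\<^sub>R norm (y - x)
       - (A y (z x) - A x (z x) - A' (z x) (y - x)) /\<^sub>R norm (y - x)
       - (A y (z' (y - x)) - A x (z' (y - x))) /\<^sub>R norm (y - x)
       = A y ((z y - z x - z' (y - x)) /\<^sub>R norm (y - x))"
      using lin eq unfolding F_def
    proof eventually_elim
      case (elim y)
      show ?case
        unfolding linear_cmul[OF elim(1)] linear_diff[OF elim(1)] elim(2) z' eq0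
        by (simp add: scaleR_diff_right)
    qed
  qed
  then have "((\<lambda>y. (z y - z x - z' (y - x)) /\<^sub>R norm (y - x)) \<longlongrightarrow> 0) F"
    using lin unfolding F_def[symmetric]
    by (intro tendsto_linear_solve[OF _ lin0 inj lim]) auto
  then show ?thesis unfolding F_def has_derivative_within using blz' by (simp add: algebra_simps inverse_eq_divide)
qed

subsection \<open>Linear differential equations\<close>

lemma linear_ode_bound:
  fixes A :: "real \<Rightarrow> 'a::euclidean_space \<Rightarrow> 'a"
  assumes lin: "\<And>t. t \<in> {a..b} \<Longrightarrow> linear (A t)"
    and cont: "\<And>x. continuous_on {a..b} (\<lambda>t. A t x)"
  obtains M where "M > 0" "\<And>t x. t \<in> {a..b} \<Longrightarrow> norm (A t x) \<le> M * norm x"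
proof -
  have "continuous_on {a..b} (\<lambda>t. \<Sum>x\<in>Basis. norm (A t x))"
    by (intro continuous_intros cont)
  then have "bounded ((\<lambda>t. \<Sum>x\<in>Basis. norm (A t x)) ` {a..b})"
    by (intro compact_imp_bounded compact_continuous_image) auto
  then obtain M where M: "M > 0" "\<And>t. t \<in> {a..b} \<Longrightarrow> \<bar>\<Sum>x\<in>Basis. norm (A t x)\<bar> \<le> M"
    unfolding bounded_pos by auto
  show ?thesis
  proof (rule that[OF M(1)])
    fix t x assume t: "t \<in> {a..b}"
    have "norm (A t x) \<le> (\<Sum>b\<in>Basis. norm (A t b)) * norm x"
      by (rule linear_norm_le_sum_Basis[OF lin[OF t]])
    also have "\<dots> \<le> M * norm x"
      using M(2)[OF t] by (intro mult_right_mono) auto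
    finally show "norm (A t x) \<le> M * norm x" .
  qed
qed

lemma linear_family_continuous:
  fixes A :: "real \<Rightarrow> 'a::euclidean_space \<Rightarrow> 'b::real_normed_vector"
  assumes lin: "\<And>t. t \<in> T \<Longrightarrow> linear (A t)"
    and cont: "\<And>x. continuous_on T (\<lambda>t. A t x)" and x: "continuous_on T x"
  shows "continuous_on T (\<lambda>t. A t (x t))"
proof -
  have "continuous_on T (\<lambda>t. \<Sum>b\<in>Basis. (x t \<bullet> b) *\<^sub>R A t b)"
    by (intro continuous_intros cont x)
  then show ?thesis
    using linear_expand[OF lin] by (simp cong: continuous_on_cong)
qed

text \<open>Picard series: \<open>X n\<close> is the n-fold iterated integral of \<open>A\<close>
  applied to \<open>y0\<close>. It is dominated by the terms of an exponential series, so the sum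
  converges uniformly on the whole interval at once.\<close>

lemma linear_ode_exists:
  fixes A :: "real \<Rightarrow> 'a::euclidean_space \<Rightarrow> 'a"
  assumes ab: "a \<le> b" and lin: "\<And>t. t \<in> {a..b} \<Longrightarrow> linear (A t)"
    and cont: "\<And>x. continuous_on {a..b} (\<lambda>t. A t x)"
  obtains y where "y a = y0"
    "\<And>t. t \<in> {a..b} \<Longrightarrow> (y has_vector_derivative A t (y t)) (at t within {a..b})"
proof -
  obtain M where M: "M > 0" "\<And>t x. t \<in> {a..b} \<Longrightarrow> norm (A t x) \<le> M * norm x"
    using linear_ode_bound[OF lin cont] by blast
  have prim: "\<exists>g. g a = 0 \<and> (\<forall>t\<in>{a..b}. (g has_vector_derivative A t (f t)) (at t within {a..b}))"
    if f: "continuous_on {a..b} f" for f :: "real \<Rightarrow> 'a"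
  proof -
    obtain g where "\<And>x. x \<in> {a..b} \<Longrightarrow> (g has_vector_derivative A x (f x)) (at x within {a..b})"
      using antiderivative_continuous[OF linear_family_continuous[OF lin cont f]] by blast
    then show ?thesis
      by (intro exI[of _ "\<lambda>t. g t - g a"]) (auto intro!: derivative_eq_intros)
  qed
  define I where "I f = (SOME g. g a = 0 \<and>
    (\<forall>t\<in>{a..b}. (g has_vector_derivative A t (f t)) (at t within {a..b})))" for f :: "real \<Rightarrow> 'a"
  have I: "I f a = 0" "\<And>t. t \<in> {a..b} \<Longrightarrow> (I f has_vector_derivative A t (f t)) (at t within {a..b})"
    if "continuous_on {a..b} f" for f :: "real \<Rightarrow> 'a"
    using someI_ex[OF prim[OF that]] unfolding I_def by auto
  define X where "X n = (I ^^ n) (\<lambda>_. y0)" for n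
  have X0: "X 0 = (\<lambda>_. y0)" and XS: "X (Suc n) = I (X n)" for n by (auto simp: X_def)
  have Xc: "continuous_on {a..b} (X n)" for n
  proof (induction n)
    case (Suc n)
    show ?case unfolding XS
      by (rule continuous_on_vector_derivative) (rule I(2)[OF Suc])
  qed (simp add: X0)
  have Xb: "norm (X n t) \<le> norm y0 * (M * (t - a)) ^ n / fact n" if "t \<in> {a..b}" for n t
    using that
  proof (induction n arbitrary: t)
    case (Suc n)
    show ?case
    proof (cases "a = t")
      case True then show ?thesis using I(1)[OF Xc, of n] by (simp add: XS)
    next
      case False
      with Suc.prems have at: "a < t" by auto
      let ?\<phi> = "\<lambda>s. norm y0 * (M * (s - a)) ^ Suc n / fact (Suc n)"
      have "norm (X (Suc n) t - X (Suc n) a) \<le> ?\<phi> t - ?\<phi> a"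
      proof (rule differentiable_bound_general[OF at, of "X (Suc n)" ?\<phi> "\<lambda>s. A s (X n s)"
            "\<lambda>s. norm y0 * M * (M * (s - a)) ^ n / fact n"])
        show "continuous_on {a..t} ?\<phi>" by (intro continuous_intros) auto
        show "continuous_on {a..t} (X (Suc n))"
          using Xc[of "Suc n"] by (rule continuous_on_subset) (use Suc.prems in auto)
        show "(X (Suc n) has_vector_derivative A s (X n s)) (at s)" if "a < s" "s < t" for s
          using I(2)[OF Xc[of n], of s] that Suc.prems at_within_Icc_at[of a s b] by (simp add: XS)
        show "norm (A s (X n s)) \<le> norm y0 * M * (M * (s - a)) ^ n / fact n" if "a < s" "s < t" for s
        proof -
          have s: "s \<in> {a..b}" using that Suc.prems by auto
          have "norm (A s (X n s)) \<le> M * norm (X n s)" by (rule M(2)[OF s])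
          also have "\<dots> \<le> M * (norm y0 * (M * (s - a)) ^ n / fact n)"
            using M(1) by (intro mult_left_mono Suc.IH[OF s]) auto
          finally show ?thesis by (simp add: algebra_simps)
        qed
        show "(?\<phi> has_vector_derivative norm y0 * M * (M * (s - a)) ^ n / fact n) (at s)"
          if "a < s" "s < t" for s
        proof -
          have "((\<lambda>s. M * (s - a)) has_real_derivative M) (at s)"
            by (auto intro!: derivative_eq_intros)
          from DERIV_cdivide[OF DERIV_cmult[OF DERIV_power_Suc[OF this]]]
          have "(?\<phi> has_real_derivative
              norm y0 * ((1 + real n) * (M * (M * (s - a)) ^ n)) / fact (Suc n)) (at s)" .
          moreover have "norm y0 * ((1 + real n) * (M * (M * (s - a)) ^ n)) / fact (Suc n)
              = norm y0 * M * (M * (s - a)) ^ n / fact n"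
            by (simp add: divide_simps) (simp add: algebra_simps)?
          ultimately show ?thesis by (simp only: has_real_derivative_iff_has_vector_derivative)
        qed
      qed
      then show ?thesis by (simp add: XS I(1)[OF Xc])
    qed
  qed (simp add: X0)
  define B where "B n = norm y0 * (M * (b - a)) ^ n / fact n" for n
  have Xb': "norm (X n t) \<le> B n" if "t \<in> {a..b}" for n t
  proof -
    have "norm (X n t) \<le> norm y0 * (M * (t - a)) ^ n / fact n" by (rule Xb[OF that])
    also have "\<dots> \<le> B n" unfolding B_def using that M(1)
      by (intro divide_right_mono mult_left_mono power_mono) auto
    finally show ?thesis .
  qed
  have Bs: "summable B"
    using summable_mult[OF summable_exp[of "M * (b - a)"], of "norm y0"]
    unfolding B_def by (simp add: field_simps)
  have summ: "summable (\<lambda>n. X n t)" if "t \<in> {a..b}" for t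
    by (rule summable_comparison_test'[OF Bs, of 0]) (use Xb'[OF that] in auto)
  define y where "y t = (\<Sum>n. X n t)" for t
  \<comment> \<open>Differentiation shifts the series by one place: the constant term gives zero and
    \<open>X (Suc m)\<close> gives \<open>A t (X m t)\<close>. A partial sum of derivatives is
    therefore \<open>A t\<close> of a partial sum with one term less, whence \<open>Suc N\<close>
    below.\<close>
  define X' where "X' n t = (case n of 0 \<Rightarrow> 0 | Suc m \<Rightarrow> A t (X m t))" for n t
  have dX: "(X n has_vector_derivative X' n t) (at t within {a..b})" if "t \<in> {a..b}" for n t
    using I(2)[OF Xc that] by (cases n) (auto simp: X'_def X0 XS)
  have unif: "uniform_limit {a..b} (\<lambda>n t. \<Sum>i<n. X i t) y sequentially"
    unfolding y_def by (rule Weierstrass_m_test[OF Xb' Bs])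
  have "\<exists>g. \<forall>t\<in>{a..b}. (\<lambda>n. X n t) sums g t \<and>
      (g has_derivative (\<lambda>h. h *\<^sub>R A t (y t))) (at t within {a..b})"
  proof (rule has_derivative_series[where f' = "\<lambda>n t h. h *\<^sub>R X' n t"])
    show "a \<in> {a..b}" using ab by simp
    then show "(\<lambda>n. X n a) sums y a" unfolding y_def by (rule summable_sums[OF summ])
    show "(X n has_derivative (\<lambda>h. h *\<^sub>R X' n t)) (at t within {a..b})" if "t \<in> {a..b}" for n t
      using dX[OF that] by (simp add: has_vector_derivative_def)
    fix e :: real assume e: "e > 0"
    then have "e / M > 0" using M(1) by simp
    then obtain N where N: "\<And>n t. n \<ge> N \<Longrightarrow> t \<in> {a..b} \<Longrightarrow> norm ((\<Sum>i<n. X i t) - y t) < e / M"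
      using unif unfolding uniform_limit_iff eventually_at_top_linorder dist_norm by blast
    show "\<forall>\<^sub>F n in sequentially. \<forall>t\<in>{a..b}. \<forall>h.
        norm ((\<Sum>i<n. h *\<^sub>R X' i t) - h *\<^sub>R A t (y t)) \<le> e * norm h"
      unfolding eventually_sequentially
    proof (intro exI[of _ "Suc N"] allI impI ballI)
      fix n t h assume n: "Suc N \<le> n" and t: "t \<in> {a..b}"
      then obtain m where m: "n = Suc m" "m \<ge> N" by (cases n) auto
      note lt = lin[OF t]
      have "(\<Sum>i<n. X' i t) = A t (\<Sum>i<m. X i t)"
        unfolding m(1) sum.lessThan_Suc_shift linear_sum[OF lt] by (simp add: X'_def)
      then have "(\<Sum>i<n. h *\<^sub>R X' i t) - h *\<^sub>R A t (y t) = h *\<^sub>R A t ((\<Sum>i<m. X i t) - y t)"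
        by (simp add: linear_diff[OF lt] scaleR_diff_right flip: scaleR_sum_right)
      also have "norm \<dots> \<le> \<bar>h\<bar> * (M * norm ((\<Sum>i<m. X i t) - y t))"
        using M(2)[OF t] by (simp add: mult_left_mono)
      also have "\<dots> \<le> \<bar>h\<bar> * (M * (e / M))"
        using N[OF m(2) t] M(1) by (intro mult_left_mono) auto
      finally show "norm ((\<Sum>i<n. h *\<^sub>R X' i t) - h *\<^sub>R A t (y t)) \<le> e * norm h"
        using M(1) by (simp add: mult.commute)
    qed
  qed simp
  then obtain g where g: "\<And>t. t \<in> {a..b} \<Longrightarrow> (\<lambda>n. X n t) sums g t"
    "\<And>t. t \<in> {a..b} \<Longrightarrow> (g has_derivative (\<lambda>h. h *\<^sub>R A t (y t))) (at t within {a..b})" by blast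
  have gy: "g t = y t" if "t \<in> {a..b}" for t
    using g(1)[OF that] unfolding y_def by (simp add: sums_iff)
  have "g a = y0"
  proof -
    have "(\<lambda>n. X n a) = (\<lambda>n. if n = 0 then y0 else 0)"
    proof
      fix n show "X n a = (if n = 0 then y0 else 0)"
        by (cases n) (auto simp: X0 XS I(1)[OF Xc])
    qed
    then have "(\<lambda>n. X n a) sums y0" using sums_single[of 0 "\<lambda>_. y0"] by simp
    then show ?thesis using g(1)[of a] ab sums_unique2 by auto
  qed
  moreover have "(g has_vector_derivative A t (g t)) (at t within {a..b})" if "t \<in> {a..b}" for t
    using g(2)[OF that] gy[OF that] by (simp add: has_vector_derivative_def)
  ultimately show ?thesis using that by blast
qed

text \<open>Gronwall's argument: the derivative of \<open>y t \<bullet> y t\<close> is at most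
  \<open>2 * M\<close> times itself, so the weighted function \<open>?f\<close> cannot increase from
  its initial value zero.\<close>

lemma linear_ode_unique:
  fixes A :: "real \<Rightarrow> 'a::euclidean_space \<Rightarrow> 'a"
  assumes lin: "\<And>t. t \<in> {a..b} \<Longrightarrow> linear (A t)"
    and cont: "\<And>x. continuous_on {a..b} (\<lambda>t. A t x)"
    and y: "\<And>t. t \<in> {a..b} \<Longrightarrow> (y has_vector_derivative A t (y t)) (at t within {a..b})"
    and "y a = 0" and t: "t \<in> {a..b}"
  shows "y t = 0"
proof -
  obtain M where M: "M > 0" "\<And>t x. t \<in> {a..b} \<Longrightarrow> norm (A t x) \<le> M * norm x"
    using linear_ode_bound[OF lin cont] by blast
  let ?f = "\<lambda>t. exp (- 2 * M * (t - a)) * (y t \<bullet> y t)"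
  have yc: "continuous_on {a..b} y"
    by (rule continuous_on_vector_derivative) (rule y)
  have "?f t \<le> ?f a"
  proof (rule DERIV_nonpos_imp_decreasing_open[of a t ?f])
    show "a \<le> t" using t by simp
    show "continuous_on {a..t} ?f"
      using t by (intro continuous_intros continuous_on_subset[OF yc]) auto
    fix s assume s: "a < s" "s < t"
    then have s': "s \<in> {a..b}" using t by auto
    have "(y has_derivative (\<lambda>h. h *\<^sub>R A s (y s))) (at s)"
      using y[OF s'] s t at_within_Icc_at[of a s b] by (simp add: has_vector_derivative_def)
    then have "((\<lambda>t. y t \<bullet> y t) has_derivative (\<lambda>h. h * (2 * (y s \<bullet> A s (y s))))) (at s)"
      by (auto intro!: derivative_eq_intros simp: inner_commute)
    then have d: "((\<lambda>t. y t \<bullet> y t) has_real_derivative (2 * (y s \<bullet> A s (y s)))) (at s)"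
      unfolding has_field_derivative_def by (simp add: mult.commute[of _ "2 * _"])
    have "(?f has_real_derivative
       exp (- 2 * M * (s - a)) * (2 * (y s \<bullet> A s (y s)) - 2 * M * (y s \<bullet> y s))) (at s)"
      by (rule derivative_eq_intros d refl | simp add: algebra_simps)+
    moreover have "y s \<bullet> A s (y s) \<le> M * (y s \<bullet> y s)"
    proof -
      have "y s \<bullet> A s (y s) \<le> norm (y s) * (M * norm (y s))"
        using norm_cauchy_schwarz[of "y s" "A s (y s)"] M(2)[OF s', of "y s"]
        by (meson mult_left_mono norm_ge_zero order_trans)
      then show ?thesis by (simp add: power2_norm_eq_inner[symmetric] power2_eq_square algebra_simps)
    qed
    ultimately show "\<exists>z. (?f has_real_derivative z) (at s) \<and> z \<le> 0"
      by (intro exI[of _ "exp (- 2 * M * (s - a)) * (2 * (y s \<bullet> A s (y s)) - 2 * M * (y s \<bullet> y s))"])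
        (simp add: mult_le_0_iff)
  qed
  with \<open>y a = 0\<close> have "y t \<bullet> y t \<le> 0" by (simp add: mult_le_0_iff)
  then show ?thesis by (metis inner_eq_zero_iff inner_ge_zero order_antisym)
qed

subsection \<open>Symmetry of second derivatives\<close>

text \<open>The second difference of \<open>f\<close> over a small parallelogram is symmetric in
  \<open>u\<close> and \<open>v\<close>. Two applications of the mean value theorem, in either
  order, turn it into a value of \<open>fu\<close> or of \<open>fv\<close> near \<open>x\<close>,
  and continuity at \<open>x\<close> does the rest.\<close>

lemma second_derivative_symmetric_real:
  fixes f :: "'a::real_normed_vector \<Rightarrow> real"
  assumes S: "open S" "x \<in> S"
    and f: "\<And>y. y \<in> S \<Longrightarrow> (f has_derivative f' y) (at y)"
    and fu: "\<And>y. y \<in> S \<Longrightarrow> ((\<lambda>y. f' y u) has_derivative fu y) (at y)"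
    and fv: "\<And>y. y \<in> S \<Longrightarrow> ((\<lambda>y. f' y v) has_derivative fv y) (at y)"
    and cu: "isCont (\<lambda>y. fu y v) x" and cv: "isCont (\<lambda>y. fv y u) x"
  shows "fu x v = fv x u"
proof -
  obtain r where r: "r > 0" "ball x r \<subseteq> S" using S open_contains_ball by blast
  \<comment> \<open>The product \<open>h * N\<close> bounds the length of
    \<open>s *\<^sub>R u + t *\<^sub>R v\<close> for coefficients of size at most \<open>h\<close>;
    the summand 1 keeps \<open>N\<close> positive if both vectors vanish.\<close>
  define N where "N = norm u + norm v + 1"
  have N: "N > 0" by (simp add: N_def add_nonneg_pos)
  have inS: "x + s *\<^sub>R u + t *\<^sub>R v \<in> S" if "\<bar>s\<bar> \<le> h" "\<bar>t\<bar> \<le> h" "h * N < r" for s t h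
  proof -
    have "norm (s *\<^sub>R u + t *\<^sub>R v) \<le> \<bar>s\<bar> * norm u + \<bar>t\<bar> * norm v"
      by (rule order_trans[OF norm_triangle_ineq]) simp
    also have "\<dots> \<le> h * norm u + h * norm v"
      using that by (intro add_mono mult_right_mono) auto
    also have "\<dots> \<le> h * N" unfolding N_def using that by (simp add: algebra_simps)
    finally show ?thesis using r(2) that by (auto simp: dist_norm norm_minus_commute subset_iff add.assoc)
  qed
  \<comment> \<open>The vectors and \<open>F\<close> are generalized because the claim is used once
    in each order of \<open>u\<close> and \<open>v\<close>.\<close>
  have mvt: "\<exists>\<xi> \<eta>. \<bar>\<xi>\<bar> \<le> h \<and> \<bar>\<eta>\<bar> \<le> h \<and>
     f (x + h *\<^sub>R u + h *\<^sub>R v) - f (x + h *\<^sub>R u) - f (x + h *\<^sub>R v) + f x = h * (h * F (x + \<xi> *\<^sub>R u + \<eta> *\<^sub>R v) v)"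
    if h: "h > 0" "h * N < r"
      and F: "\<And>y. y \<in> S \<Longrightarrow> ((\<lambda>y. f' y u) has_derivative F y) (at y)"
      and inS: "\<And>s t. \<bar>s\<bar> \<le> h \<Longrightarrow> \<bar>t\<bar> \<le> h \<Longrightarrow> x + s *\<^sub>R u + t *\<^sub>R v \<in> S" for h u v F
  proof -
    let ?g = "\<lambda>s. f (x + s *\<^sub>R u + h *\<^sub>R v) - f (x + s *\<^sub>R u)"
    have "\<exists>\<xi>>0. \<xi> < h \<and> ?g h - ?g 0 = (h - 0) * (f' (x + \<xi> *\<^sub>R u + h *\<^sub>R v) u - f' (x + \<xi> *\<^sub>R u) u)"
    proof (rule MVT2[OF h(1)])
      fix s assume s: "0 \<le> s" "s \<le> h"
      have i: "x + s *\<^sub>R u + h *\<^sub>R v \<in> S" "x + s *\<^sub>R u \<in> S"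
        using inS[of s h] inS[of s 0] s by auto
      have l: "linear (f' (x + s *\<^sub>R u + h *\<^sub>R v))" "linear (f' (x + s *\<^sub>R u))"
        using f[OF i(1)] f[OF i(2)] has_derivative_linear by auto
      have a: "((\<lambda>s. f (x + s *\<^sub>R u + h *\<^sub>R v)) has_derivative (\<lambda>k. f' (x + s *\<^sub>R u + h *\<^sub>R v) (k *\<^sub>R u))) (at s)"
        by (rule has_derivative_compose[where g=f and f="\<lambda>s. x + s *\<^sub>R u + h *\<^sub>R v", OF _ f[OF i(1)]]) (auto intro!: derivative_eq_intros)
      have b: "((\<lambda>s. f (x + s *\<^sub>R u)) has_derivative (\<lambda>k. f' (x + s *\<^sub>R u) (k *\<^sub>R u))) (at s)"
        by (rule has_derivative_compose[where g=f and f="\<lambda>s. x + s *\<^sub>R u", OF _ f[OF i(2)]]) (auto intro!: derivative_eq_intros)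
      show "(?g has_real_derivative f' (x + s *\<^sub>R u + h *\<^sub>R v) u - f' (x + s *\<^sub>R u) u) (at s)"
        unfolding has_field_derivative_def
        by (rule has_derivative_eq_rhs[OF has_derivative_diff[OF a b]])
          (rule ext, simp only: linear_cmul[OF l(1)] linear_cmul[OF l(2)], simp add: algebra_simps)
    qed
    then obtain \<xi> where \<xi>: "\<xi> > 0" "\<xi> < h"
      "?g h - ?g 0 = h * (f' (x + \<xi> *\<^sub>R u + h *\<^sub>R v) u - f' (x + \<xi> *\<^sub>R u) u)" by auto
    have "\<exists>\<eta>>0. \<eta> < h \<and> f' (x + \<xi> *\<^sub>R u + h *\<^sub>R v) u - f' (x + \<xi> *\<^sub>R u + 0 *\<^sub>R v) u
        = (h - 0) * F (x + \<xi> *\<^sub>R u + \<eta> *\<^sub>R v) v"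
    proof (rule MVT2[OF h(1)])
      fix t assume t: "0 \<le> t" "t \<le> h"
      have i: "x + \<xi> *\<^sub>R u + t *\<^sub>R v \<in> S" using inS[of \<xi> t] t \<xi> by auto
      have l: "linear (F (x + \<xi> *\<^sub>R u + t *\<^sub>R v))" using F[OF i] has_derivative_linear by auto
      have "((\<lambda>t. f' (x + \<xi> *\<^sub>R u + t *\<^sub>R v) u) has_derivative (\<lambda>k. F (x + \<xi> *\<^sub>R u + t *\<^sub>R v) (k *\<^sub>R v))) (at t)"
        by (rule has_derivative_compose[where g="\<lambda>y. f' y u" and f="\<lambda>t. x + \<xi> *\<^sub>R u + t *\<^sub>R v", OF _ F[OF i]]) (auto intro!: derivative_eq_intros)
      then show "((\<lambda>t. f' (x + \<xi> *\<^sub>R u + t *\<^sub>R v) u) has_real_derivative F (x + \<xi> *\<^sub>R u + t *\<^sub>R v) v) (at t)"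
        unfolding has_field_derivative_def by (rule has_derivative_eq_rhs) (rule ext, simp add: linear_cmul[OF l])
    qed
    then obtain \<eta> where "\<eta> > 0" "\<eta> < h"
      "f' (x + \<xi> *\<^sub>R u + h *\<^sub>R v) u - f' (x + \<xi> *\<^sub>R u) u = h * F (x + \<xi> *\<^sub>R u + \<eta> *\<^sub>R v) v" by auto
    then show ?thesis using \<xi> by (intro exI[of _ \<xi>] exI[of _ \<eta>]) (auto simp: algebra_simps)
  qed
  have close: "\<bar>fu x v - fv x u\<bar> \<le> 2 * e" if e: "e > 0" for e
  proof -
    obtain d1 where d1: "d1 > 0" "\<And>y. dist y x < d1 \<Longrightarrow> \<bar>fu y v - fu x v\<bar> < e"
      using cu e unfolding continuous_at_eps_delta dist_real_def by metis
    obtain d2 where d2: "d2 > 0" "\<And>y. dist y x < d2 \<Longrightarrow> \<bar>fv y u - fv x u\<bar> < e"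
      using cv e unfolding continuous_at_eps_delta dist_real_def by metis
    define h where "h = min r (min d1 d2) / (2 * N)"
    have h: "h > 0" "h * N < r" "h * N < d1" "h * N < d2"
      using r d1 d2 N by (auto simp: h_def field_simps min_def)
    have near: "dist (x + s *\<^sub>R u + t *\<^sub>R v) x \<le> h * N" if "\<bar>s\<bar> \<le> h" "\<bar>t\<bar> \<le> h" for s t
    proof -
      have "norm (s *\<^sub>R u + t *\<^sub>R v) \<le> \<bar>s\<bar> * norm u + \<bar>t\<bar> * norm v"
        by (rule order_trans[OF norm_triangle_ineq]) simp
      also have "\<dots> \<le> h * norm u + h * norm v"
        using that by (intro add_mono mult_right_mono) auto
      also have "\<dots> \<le> h * N" unfolding N_def using h by (simp add: algebra_simps)
      finally show ?thesis by (simp add: dist_norm add.assoc)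
    qed
    obtain \<xi> \<eta> where 1: "\<bar>\<xi>\<bar> \<le> h" "\<bar>\<eta>\<bar> \<le> h"
      "f (x + h *\<^sub>R u + h *\<^sub>R v) - f (x + h *\<^sub>R u) - f (x + h *\<^sub>R v) + f x = h * (h * fu (x + \<xi> *\<^sub>R u + \<eta> *\<^sub>R v) v)"
      using mvt[OF h(1,2) fu inS[OF _ _ h(2)]] by blast
    obtain \<xi>' \<eta>' where 2: "\<bar>\<xi>'\<bar> \<le> h" "\<bar>\<eta>'\<bar> \<le> h"
      "f (x + h *\<^sub>R v + h *\<^sub>R u) - f (x + h *\<^sub>R v) - f (x + h *\<^sub>R u) + f x = h * (h * fv (x + \<xi>' *\<^sub>R v + \<eta>' *\<^sub>R u) u)"
    proof -
      have "x + s *\<^sub>R v + t *\<^sub>R u \<in> S" if "\<bar>s\<bar> \<le> h" "\<bar>t\<bar> \<le> h" for s t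
        using inS[OF that(2,1) h(2)] by (simp add: algebra_simps)
      from mvt[OF h(1,2) fv this] that show thesis by blast
    qed
    have "h * (h * fu (x + \<xi> *\<^sub>R u + \<eta> *\<^sub>R v) v) = h * (h * fv (x + \<xi>' *\<^sub>R v + \<eta>' *\<^sub>R u) u)"
      using 1(3) 2(3) by (simp add: algebra_simps)
    then have eq: "fu (x + \<xi> *\<^sub>R u + \<eta> *\<^sub>R v) v = fv (x + \<eta>' *\<^sub>R u + \<xi>' *\<^sub>R v) u"
      using h(1) by (simp add: algebra_simps)
    have "\<bar>fu (x + \<xi> *\<^sub>R u + \<eta> *\<^sub>R v) v - fu x v\<bar> < e"
      using near[OF 1(1,2)] h by (intro d1(2)) auto
    moreover have "\<bar>fv (x + \<eta>' *\<^sub>R u + \<xi>' *\<^sub>R v) u - fv x u\<bar> < e"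
      using near[OF 2(2,1)] h by (intro d2(2)) auto
    ultimately show ?thesis using eq by linarith
  qed
  show ?thesis
  proof (rule ccontr)
    assume "fu x v \<noteq> fv x u"
    then show False using close[of "\<bar>fu x v - fv x u\<bar> / 4"] by auto
  qed
qed

lemma second_derivative_symmetric:
  fixes f :: "'a::real_normed_vector \<Rightarrow> 'b::euclidean_space"
  assumes S: "open S" "x \<in> S"
    and f: "\<And>y. y \<in> S \<Longrightarrow> (f has_derivative f' y) (at y)"
    and fu: "\<And>y. y \<in> S \<Longrightarrow> ((\<lambda>y. f' y u) has_derivative fu y) (at y)"
    and fv: "\<And>y. y \<in> S \<Longrightarrow> ((\<lambda>y. f' y v) has_derivative fv y) (at y)"
    and cu: "isCont (\<lambda>y. fu y v) x" and cv: "isCont (\<lambda>y. fv y u) x"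
  shows "fu x v = fv x u"
proof (rule euclidean_eqI)
  fix b :: 'b
  show "fu x v \<bullet> b = fv x u \<bullet> b"
  proof (rule second_derivative_symmetric_real[OF S, of "\<lambda>y. f y \<bullet> b" "\<lambda>y w. f' y w \<bullet> b" u
        "\<lambda>y w. fu y w \<bullet> b" v "\<lambda>y w. fv y w \<bullet> b"])
  qed (auto intro!: has_derivative_inner_left f fu fv continuous_intros cu cv)
qed

text \<open>Expanding \<open>v y\<close> in the basis leaves finitely many products of scalar
  functions with \<open>L y b\<close>, so differentiability for each fixed argument suffices for
  this product rule.\<close>

lemma has_derivative_linear_family:
  fixes L :: "'q::real_normed_vector \<Rightarrow> 'e::euclidean_space \<Rightarrow> 'f::real_normed_vector"
  assumes lin: "\<forall>\<^sub>F y in at q within I. linear (L y)" "linear (L q)"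
    and dL: "\<And>x. ((\<lambda>y. L y x) has_derivative L' x) (at q within I)"
    and linL': "\<And>h. linear (\<lambda>x. L' x h)"
    and v: "(v has_derivative v') (at q within I)" and q: "q \<in> I"
  shows "((\<lambda>y. L y (v y)) has_derivative (\<lambda>h. L' (v q) h + L q (v' h))) (at q within I)"
proof -
  have "((\<lambda>y. \<Sum>b\<in>Basis. (v y \<bullet> b) *\<^sub>R L y b) has_derivative
     (\<lambda>h. \<Sum>b\<in>Basis. (v q \<bullet> b) *\<^sub>R L' b h + (v' h \<bullet> b) *\<^sub>R L q b)) (at q within I)"
    by (intro has_derivative_sum has_derivative_scaleR has_derivative_inner_left v dL)
  moreover have "(\<Sum>b\<in>Basis. (v q \<bullet> b) *\<^sub>R L' b h + (v' h \<bullet> b) *\<^sub>R L q b) = L' (v q) h + L q (v' h)" for h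
    unfolding sum.distrib using linear_expand[OF linL', of "v q" h] linear_expand[OF lin(2), of "v' h"] by simp
  ultimately have *: "((\<lambda>y. \<Sum>b\<in>Basis. (v y \<bullet> b) *\<^sub>R L y b) has_derivative
     (\<lambda>h. L' (v q) h + L q (v' h))) (at q within I)" by simp
  show ?thesis
  proof (rule has_derivative_transform_eventually[OF *])
    show "\<forall>\<^sub>F y in at q within I. (\<Sum>b\<in>Basis. (v y \<bullet> b) *\<^sub>R L y b) = L y (v y)"
      using lin(1) by eventually_elim (rule linear_expand[symmetric])
    show "(\<Sum>b\<in>Basis. (v q \<bullet> b) *\<^sub>R L q b) = L q (v q)" by (rule linear_expand[OF lin(2), symmetric])
  qed (rule q)
qed

lemma has_vector_derivative_quotient:
  assumes "(f has_vector_derivative d) (at a within I)"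
  shows "((\<lambda>s. (f s - f a) /\<^sub>R (s - a)) \<longlongrightarrow> d) (at a within I)"
proof -
  have l: "((\<lambda>y. (1 / norm (y - a)) *\<^sub>R (f y - (f a + (y - a) *\<^sub>R d))) \<longlongrightarrow> 0) (at a within I)"
    using assms unfolding has_vector_derivative_def has_derivative_within by blast
  have "((\<lambda>s. (f s - f a) /\<^sub>R (s - a) - d) \<longlongrightarrow> 0) (at a within I)"
  proof (rule Lim_null_comparison[OF _ tendsto_norm_zero[OF l]])
    show "\<forall>\<^sub>F s in at a within I. norm ((f s - f a) /\<^sub>R (s - a) - d)
       \<le> norm ((1 / norm (s - a)) *\<^sub>R (f s - (f a + (s - a) *\<^sub>R d)))"
      unfolding eventually_at_filter
    proof (intro always_eventually allI impI)
      fix s assume "s \<noteq> a"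
      then have "(f s - f a) /\<^sub>R (s - a) - d = (f s - (f a + (s - a) *\<^sub>R d)) /\<^sub>R (s - a)"
        unfolding diff_diff_eq[symmetric] scaleR_right_diff_distrib by simp
      then show "norm ((f s - f a) /\<^sub>R (s - a) - d)
       \<le> norm ((1 / norm (s - a)) *\<^sub>R (f s - (f a + (s - a) *\<^sub>R d)))"
        by (simp add: inverse_eq_divide)
    qed
  qed
  then show ?thesis by (simp add: LIM_zero_iff)
qed

subsection \<open>Orthogonal projection for a positive definite restriction\<close>

text \<open>In an orthonormal basis \<open>C\<close> of \<open>T\<close>, \<open>L x\<close> lists
  the values of the functional \<open>B x\<close> on \<open>T\<close>. Nondegeneracy makes
  \<open>L\<close> injective on \<open>T\<close>, a dimension count makes it map \<open>T\<close>
  onto \<open>T\<close>, and \<open>P x\<close> is the vector of \<open>T\<close> inducing the same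
  functional as \<open>x\<close>.\<close>

lemma form_projection:
  fixes B :: "'e::euclidean_space \<Rightarrow> 'e \<Rightarrow> real"
  assumes bil: "bilinear B" and T: "subspace T" and nd: "nondegenerate_on B T"
  obtains P where "linear P" "\<And>x. P x \<in> T" "\<And>x u. u \<in> T \<Longrightarrow> B (x - P x) u = 0"
proof -
  have linear_left: "linear (\<lambda>x. B x u)" and linear_right: "linear (B x)" for x u
    using bil unfolding bilinear_def by auto
  obtain C where C: "C \<subseteq> T" "pairwise orthogonal C" "\<And>x. x \<in> C \<Longrightarrow> norm x = 1"
      "independent C" "span C = T"
    using orthonormal_basis_subspace[OF T] by metis
  have fC: "finite C" using C(4) by (rule independent_imp_finite)
  define L where "L x = (\<Sum>c\<in>C. B x c *\<^sub>R c)" for x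
  have linL: "linear L" unfolding L_def
    by (auto intro!: linearI
        simp: algebra_simps linear_add[OF linear_left] linear_cmul[OF linear_left] sum.distrib scaleR_sum_right)
  have LT: "L x \<in> T" for x unfolding L_def using C(1) by (intro subspace_sum[OF T] subspace_scale[OF T]) auto
  have Linner: "B x u = 0" if "L x = 0" "u \<in> T" for x u
  proof -
    have z: "B x c = 0" if "c \<in> C" for c
      using independentD[OF C(4) fC, of "B x" c] \<open>L x = 0\<close> that by (auto simp: L_def)
    show ?thesis
      using \<open>u \<in> T\<close> unfolding C(5)[symmetric]
      by (induction rule: span_induct_alt) (auto simp: linear_add[OF linear_right] linear_cmul[OF linear_right] linear_0[OF linear_right] z)
  qed
  have injT: "inj_on L T"
  proof (rule inj_onI)
    fix x y assume xy: "x \<in> T" "y \<in> T" "L x = L y"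
    then have "L (x - y) = 0" by (simp add: linear_diff[OF linL])
    with nd xy have "x - y = 0" using Linner subspace_diff[OF T] unfolding nondegenerate_on_def by blast
    then show "x = y" by simp
  qed
  have "dim (L ` T) = dim T" using injT T by (intro dim_image_eq[OF linL]) (simp add: span_eq_iff[THEN iffD2])
  then have LTT: "L ` T = T"
    using LT by (intro subspace_dim_equal linear_subspace_image linL T) auto
  have "\<exists>p. p \<in> T \<and> L p = L x" for x using LT[of x] LTT by (metis imageE)
  then obtain P where P: "\<And>x. P x \<in> T" "\<And>x. L (P x) = L x" by metis
  have "linear P"
    by (rule linearI; rule inj_onD[OF injT])
       (auto simp: P linear_add[OF linL] linear_cmul[OF linL] subspace_add[OF T] subspace_scale[OF T])
  moreover have "B (x - P x) u = 0" if "u \<in> T" for x u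
    by (rule Linner[OF _ that]) (simp add: linear_diff[OF linL] P)
  ultimately show ?thesis using that P(1) by blast
qed

subsection \<open>Jacobi equations in a fixed vector space\<close>

locale jacobi_equation =
  fixes B :: "'e::euclidean_space \<Rightarrow> 'e \<Rightarrow> real" and K :: "real \<Rightarrow> 'e \<Rightarrow> 'e" and a b :: real
  assumes ab: "a < b"
    and bil: "bilinear B" and symB: "B x y = B y x"
    and linK: "t \<in> {a..b} \<Longrightarrow> linear (K t)"
    and contK: "continuous_on {a..b} (\<lambda>t. K t x)"
    and symK: "t \<in> {a..b} \<Longrightarrow> B (K t x) y = B x (K t y)"
begin

definition sol :: "(real \<Rightarrow> 'e) \<Rightarrow> (real \<Rightarrow> 'e) \<Rightarrow> bool" where
  "sol y y' \<longleftrightarrow> (\<forall>t\<in>{a..b}. (y has_vector_derivative y' t) (at t within {a..b}) \<and>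
     (y' has_vector_derivative K t (y t)) (at t within {a..b}))"

lemma linear_left: "linear (\<lambda>x. B x u)" and linear_right: "linear (B x)"
  using bil unfolding bilinear_def by auto

lemmas B_simps = linear_add[OF linear_left] linear_add[OF linear_right] linear_diff[OF linear_left] linear_diff[OF linear_right]
  linear_cmul[OF linear_left] linear_cmul[OF linear_right] linear_0[OF linear_left] linear_0[OF linear_right] linear_neg[OF linear_left] linear_neg[OF linear_right]

lemma bounded_bilinear_B: "bounded_bilinear B"
  using bil bilinear_conv_bounded_bilinear by blast

lemma sol_system:
  fixes t :: real
  assumes "t \<in> {a..b}"
  shows "linear (\<lambda>p. (snd p, K t (fst p)))"
  using linK[OF assms] by (auto intro!: linearI simp: linear_add linear_cmul)

lemma sol_exists: obtains y y' where "sol y y'" "y a = v" "y' a = w"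
proof -
  obtain Y where Y: "Y a = (v, w)"
    "\<And>t. t \<in> {a..b} \<Longrightarrow> (Y has_vector_derivative (snd (Y t), K t (fst (Y t)))) (at t within {a..b})"
  proof (rule linear_ode_exists[of a b "\<lambda>t p. (snd p, K t (fst p))" "(v, w)"])
    show "continuous_on {a..b} (\<lambda>t. (snd x, K t (fst x)))" for x
      by (intro continuous_intros contK)
  qed (use ab sol_system in auto)
  have "sol (\<lambda>t. fst (Y t)) (\<lambda>t. snd (Y t))"
    unfolding sol_def
  proof (intro ballI conjI)
    fix t assume "t \<in> {a..b}"
    note d = Y(2)[OF this, unfolded has_vector_derivative_def]
    show "((\<lambda>t. fst (Y t)) has_vector_derivative snd (Y t)) (at t within {a..b})"
      using has_derivative_fst[OF d] by (simp add: has_vector_derivative_def)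
    show "((\<lambda>t. snd (Y t)) has_vector_derivative K t (fst (Y t))) (at t within {a..b})"
      using has_derivative_snd[OF d] by (simp add: has_vector_derivative_def)
  qed
  with Y(1) show ?thesis using that by simp
qed

lemma sol_zero:
  assumes "sol y y'" "y a = 0" "y' a = 0" "t \<in> {a..b}"
  shows "y t = 0" "y' t = 0"
proof -
  have "(y t, y' t) = 0"
  proof (rule linear_ode_unique[of a b "\<lambda>t p. (snd p, K t (fst p))" "\<lambda>t. (y t, y' t)"])
    show "continuous_on {a..b} (\<lambda>t. (snd x, K t (fst x)))" for x
      by (intro continuous_intros contK)
    show "((\<lambda>t. (y t, y' t)) has_vector_derivative (snd (y t, y' t), K t (fst (y t, y' t)))) (at t within {a..b})"
      if "t \<in> {a..b}" for t
      using assms(1) that unfolding sol_def by (auto intro!: has_vector_derivative_Pair)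
  qed (use assms sol_system in \<open>auto simp: zero_prod_def\<close>)
  then show "y t = 0" "y' t = 0" by (auto simp: zero_prod_def)
qed

lemma sol_lincomb:
  assumes "sol y y'" "sol z z'"
  shows "sol (\<lambda>t. r *\<^sub>R y t + s *\<^sub>R z t) (\<lambda>t. r *\<^sub>R y' t + s *\<^sub>R z' t)"
  unfolding sol_def
proof (intro ballI conjI)
  fix t assume t: "t \<in> {a..b}"
  note d = assms[unfolded sol_def, rule_format, OF t]
  have c: "((\<lambda>t. r *\<^sub>R f t + s *\<^sub>R g t) has_vector_derivative r *\<^sub>R f' + s *\<^sub>R g') (at t within {a..b})"
    if "(f has_vector_derivative f') (at t within {a..b})" "(g has_vector_derivative g') (at t within {a..b})"
    for f g :: "real \<Rightarrow> 'e" and f' g'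
    using that by (auto simp: has_vector_derivative_def algebra_simps intro!: derivative_eq_intros)
  show "((\<lambda>t. r *\<^sub>R y t + s *\<^sub>R z t) has_vector_derivative r *\<^sub>R y' t + s *\<^sub>R z' t) (at t within {a..b})"
    using d by (intro c) auto
  show "((\<lambda>t. r *\<^sub>R y' t + s *\<^sub>R z' t) has_vector_derivative K t (r *\<^sub>R y t + s *\<^sub>R z t)) (at t within {a..b})"
    unfolding linear_add[OF linK[OF t]] linear_cmul[OF linK[OF t]] using d by (intro c) auto
qed

lemma sol_unique:
  assumes "sol y y'" "sol z z'" "y a = z a" "y' a = z' a" "t \<in> {a..b}"
  shows "y t = z t" "y' t = z' t"
  using sol_zero[OF sol_lincomb[OF assms(1,2), of 1 "-1"] _ _ assms(5)] assms(3,4) by auto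

definition flow :: "'e \<times> 'e \<Rightarrow> (real \<Rightarrow> 'e) \<times> (real \<Rightarrow> 'e)" where
  "flow p = (SOME q. sol (fst q) (snd q) \<and> fst q a = fst p \<and> snd q a = snd p)"

lemma flow: "sol (fst (flow p)) (snd (flow p))" "fst (flow p) a = fst p" "snd (flow p) a = snd p"
proof -
  obtain y y' where "sol y y'" "y a = fst p" "y' a = snd p" using sol_exists .
  then have "\<exists>q. sol (fst q) (snd q) \<and> fst q a = fst p \<and> snd q a = snd p" by (intro exI[of _ "(y, y')"]) auto
  from someI_ex[OF this] show "sol (fst (flow p)) (snd (flow p))" "fst (flow p) a = fst p" "snd (flow p) a = snd p"
    unfolding flow_def by auto
qed

lemma linear_flow:
  assumes "t \<in> {a..b}"
  shows "linear (\<lambda>p. fst (flow p) t)" "linear (\<lambda>p. snd (flow p) t)"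
proof -
  have "fst (flow (r *\<^sub>R p + s *\<^sub>R q)) t = r *\<^sub>R fst (flow p) t + s *\<^sub>R fst (flow q) t"
    "snd (flow (r *\<^sub>R p + s *\<^sub>R q)) t = r *\<^sub>R snd (flow p) t + s *\<^sub>R snd (flow q) t" for r s p q
    using sol_unique[OF flow(1)[of "r *\<^sub>R p + s *\<^sub>R q"] sol_lincomb[OF flow(1)[of p] flow(1)[of q], of r s] _ _ assms]
    by (auto simp: flow)
  from this[of 1 _ 1] this[of _ _ 0]
  show "linear (\<lambda>p. fst (flow p) t)" "linear (\<lambda>p. snd (flow p) t)"
    by (auto intro!: linearI)
qed

text \<open>The derivative reduces to \<open>B (K t (y t)) (z t) - B (y t) (K t (z t))\<close>,
  which symmetry of \<open>K t\<close> annihilates.\<close>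

lemma wronskian:
  assumes y: "sol y y'" and z: "sol z z'" and t: "t \<in> {a..b}"
  shows "B (y' t) (z t) - B (y t) (z' t) = B (y' a) (z a) - B (y a) (z' a)"
proof -
  let ?W = "\<lambda>t. B (y' t) (z t) - B (y t) (z' t)"
  have "\<exists>c. \<forall>x\<in>{a..b}. ?W x = c"
  proof (rule has_vector_derivative_zero_constant)
    fix x assume x: "x \<in> {a..b}"
    note d = y[unfolded sol_def, rule_format, OF x] z[unfolded sol_def, rule_format, OF x]
    note bb = bounded_bilinear.has_vector_derivative[OF bounded_bilinear_B]
    have "(?W has_vector_derivative (B (y' x) (z' x) + B (K x (y x)) (z x)
        - (B (y x) (K x (z x)) + B (y' x) (z' x)))) (at x within {a..b})"
      using d by (intro has_vector_derivative_diff bb) auto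
    then show "(?W has_vector_derivative 0) (at x within {a..b})"
      by (simp add: symK[OF x])
  qed auto
  then show ?thesis using t ab by auto
qed

text \<open>If \<open>K t\<close> kills \<open>n\<close>, both \<open>n\<close> and
  \<open>(t - a) *\<^sub>R n\<close> are solutions; the two formulas are the conservation of the
  Wronskian of \<open>y\<close> with each of them. Hence the component along \<open>n\<close> is
  affine in \<open>t\<close>.\<close>

lemma sol_kernel:
  assumes n: "\<And>t. t \<in> {a..b} \<Longrightarrow> K t n = 0" and y: "sol y y'" and t: "t \<in> {a..b}"
  shows "B (y t) n = B (y a) n + (t - a) * B (y' a) n" "B (y' t) n = B (y' a) n"
proof -
  have 1: "sol (\<lambda>_. n) (\<lambda>_. 0)" unfolding sol_def by (auto intro!: derivative_eq_intros simp: n)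
  have "((\<lambda>t. (t - a) *\<^sub>R n) has_vector_derivative n) (at t within {a..b})" for t
    by (auto simp: has_vector_derivative_def intro!: derivative_eq_intros)
  then have 2: "sol (\<lambda>t. (t - a) *\<^sub>R n) (\<lambda>_. n)" unfolding sol_def
    by (auto simp: n linear_cmul[OF linK])
  show *: "B (y' t) n = B (y' a) n" using wronskian[OF y 1 t] by (simp add: B_simps)
  show "B (y t) n = B (y a) n + (t - a) * B (y' a) n" using wronskian[OF y 2 t] * by (simp add: B_simps)
qed

end

section \<open>Focal fields of a subspace \<open>T\<close> with shape operator
  \<open>S\<close>\<close>

locale focal_problem = jacobi_equation B K a b
  for B :: "'e::euclidean_space \<Rightarrow> 'e \<Rightarrow> real" and K a b +
  fixes n :: 'e and T :: "'e set" and S :: "'e \<Rightarrow> 'e"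
  assumes Kn: "t \<in> {a..b} \<Longrightarrow> K t n = 0"
    and nonneg: "B x n = 0 \<Longrightarrow> 0 \<le> B x x"
    and T: "subspace T" and Tn: "u \<in> T \<Longrightarrow> B u n = 0" and nondegT: "nondegenerate_on B T"
    and ST: "u \<in> T \<Longrightarrow> S u \<in> T"
    and S_add: "u \<in> T \<Longrightarrow> v \<in> T \<Longrightarrow> S (u + v) = S u + S v"
    and S_scale: "u \<in> T \<Longrightarrow> S (r *\<^sub>R u) = r *\<^sub>R S u"
    and symS: "u \<in> T \<Longrightarrow> v \<in> T \<Longrightarrow> B (S u) v = B u (S v)"
begin

text \<open>A nonnegative form that is nondegenerate is definite: along a null vector
  \<open>u\<close> with \<open>B u v \<noteq> 0\<close>, the value of the form at
  \<open>v + r *\<^sub>R u\<close> is a nonconstant affine function of \<open>r\<close> and would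
  become negative.\<close>

lemma posT: assumes "u \<in> T" "u \<noteq> 0" shows "0 < B u u"
proof (rule ccontr)
  assume "\<not> 0 < B u u"
  then have 0: "B u u = 0" using nonneg[OF Tn[OF assms(1)]] by simp
  have "B u v = 0" if v: "v \<in> T" for v
  proof (rule ccontr)
    assume ne: "B u v \<noteq> 0"
    \<comment> \<open>Solves \<open>B v v + 2 * r * B u v = -1\<close> for \<open>r\<close>.\<close>
    let ?r = "- (B v v + 1) / (2 * B u v)"
    have "v + ?r *\<^sub>R u \<in> T" using v assms by (intro subspace_add subspace_scale T)
    then have "0 \<le> B (v + ?r *\<^sub>R u) (v + ?r *\<^sub>R u)" using nonneg Tn by blast
    also have "\<dots> = B v v + 2 * ?r * B u v" by (simp add: B_simps 0 symB[of v u] del: divide_minus_left minus_divide_left)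
    also have "\<dots> = -1" using ne by (simp add: field_simps)
    finally show False by simp
  qed
  then show False using nondegT assms unfolding nondegenerate_on_def by blast
qed

text \<open>Says that \<open>ell\<close> at \<open>t\<close> meets \<open>LP\<close> only in zero,
  expressed by \<open>flow\<close> so that no manifold is involved; the final theorem identifies its
  negation with \<open>focal_instant\<close> on \<open>{a<..b}\<close>.\<close>

definition focal_free :: "real \<Rightarrow> bool" where
  "focal_free t \<longleftrightarrow> (\<forall>v w. v \<in> T \<and> (\<forall>u\<in>T. B (w + S v) u = 0) \<and> fst (flow (v, w)) t = 0 \<longrightarrow> v = 0 \<and> w = 0)"

lemma S0: "S 0 = 0"
  using S_scale[of 0 0] subspace_0[OF T] by simp

definition P :: "'e \<Rightarrow> 'e" where
  "P = (SOME P. linear P \<and> (\<forall>x. P x \<in> T) \<and> (\<forall>x. \<forall>u\<in>T. B (x - P x) u = 0))"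

lemma P: "linear P" "P x \<in> T" "u \<in> T \<Longrightarrow> B (x - P x) u = 0"
proof -
  have "\<exists>P. linear P \<and> (\<forall>x. P x \<in> T) \<and> (\<forall>x. \<forall>u\<in>T. B (x - P x) u = 0)"
    using form_projection[OF bil T nondegT] by metis
  from someI_ex[OF this]
  show "linear P" "P x \<in> T" "u \<in> T \<Longrightarrow> B (x - P x) u = 0" unfolding P_def by auto
qed

lemma P_eq: assumes "v \<in> T" "\<And>u. u \<in> T \<Longrightarrow> B (x - v) u = 0" shows "P x = v"
proof -
  have "P x - v \<in> T" using P(2) assms(1) by (rule subspace_diff[OF T])
  moreover have "B (P x - v) u = 0" if "u \<in> T" for u
    using assms(2)[OF that] P(3)[OF that, of x] by (simp add: B_simps)
  ultimately have "P x - v = 0" using nondegT unfolding nondegenerate_on_def by blast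
  then show ?thesis by simp
qed

lemma P_id: "u \<in> T \<Longrightarrow> P u = u" by (rule P_eq) (auto simp: B_simps)

lemma P_diff: "P (x - P x) = 0" by (rule P_eq) (auto simp: P subspace_0[OF T])

text \<open>\<open>x \<mapsto> (P x, W x)\<close> parametrizes the Lagrangian subspace of initial data of focal fields.\<close>

definition W :: "'e \<Rightarrow> 'e" where "W x = (x - P x) - S (P x)"

lemma linW: "linear W"
  by (rule linearI)
    (simp_all add: W_def linear_add[OF P(1)] linear_cmul[OF P(1)] S_add S_scale P(2) algebra_simps)

definition U :: "real \<Rightarrow> 'e \<Rightarrow> 'e" where "U t x = fst (flow (P x, W x)) t"
definition U' :: "real \<Rightarrow> 'e \<Rightarrow> 'e" where "U' t x = snd (flow (P x, W x)) t"

lemma sol_U: "sol (\<lambda>t. U t x) (\<lambda>t. U' t x)"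
  using flow(1)[of "(P x, W x)"] by (simp add: U_def[abs_def] U'_def[abs_def])

lemma U_a: "U a x = P x" "U' a x = W x"
  using flow(2,3)[of "(P x, W x)"] by (simp_all add: U_def U'_def)

lemma linear_U: assumes "t \<in> {a..b}" shows "linear (U t)" "linear (U' t)"
proof -
  have l: "linear (\<lambda>x. (P x, W x))"
    by (rule linearI) (simp_all add: linear_add[OF P(1)] linear_cmul[OF P(1)] linear_add[OF linW] linear_cmul[OF linW])
  show "linear (U t)" "linear (U' t)"
    using linear_compose[OF l linear_flow(1)[OF assms]] linear_compose[OF l linear_flow(2)[OF assms]]
    by (simp_all add: U_def[abs_def] U'_def[abs_def] o_def)
qed

text \<open>The Wronskian of two focal fields vanishes at \<open>a\<close>: the parts
  \<open>x - P x\<close> are orthogonal to \<open>T\<close>, and what remains is the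
  antisymmetrization of \<open>B (S (P x)) (P y)\<close>, zero by symmetry of
  \<open>S\<close>.\<close>

lemma lagrangian: assumes "t \<in> {a..b}" shows "B (U' t x) (U t y) = B (U t x) (U' t y)"
proof -
  have "B (W x) (P y) = B (P x) (W y)"
    unfolding W_def using symS[OF P(2) P(2), of x y] P(3)[OF P(2), of x y] P(3)[OF P(2), of y x]
    by (simp add: B_simps symB[of "P x" y] symB[of "P x" "P y"])
  then show ?thesis using wronskian[OF sol_U[of x] sol_U[of y] assms] by (simp add: U_a)
qed

text \<open>\<open>P x\<close> and \<open>S (P x)\<close> are orthogonal to \<open>n\<close>, so
  only \<open>x\<close> itself contributes to the component along \<open>n\<close>. For
  \<open>t > a\<close>, a focal field orthogonal to \<open>n\<close> at \<open>t\<close> thus has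
  its parameter \<open>x\<close> orthogonal to \<open>n\<close>.\<close>

lemma U_n: assumes "t \<in> {a..b}" shows "B (U t x) n = (t - a) * B x n" "B (U' t x) n = B x n"
proof -
  have "B (P x) n = 0" "B (W x) n = B x n"
    unfolding W_def by (simp_all add: B_simps Tn P(2) ST)
  then show "B (U t x) n = (t - a) * B x n" "B (U' t x) n = B x n"
    using sol_kernel[OF Kn sol_U[of x] assms] by (simp_all add: U_a)
qed

lemma focal_free_iff: "focal_free t \<longleftrightarrow> (\<forall>x. U t x = 0 \<longrightarrow> x = 0)"
proof
  assume ff: "focal_free t"
  show "\<forall>x. U t x = 0 \<longrightarrow> x = 0"
  proof (intro allI impI)
    fix x assume "U t x = 0"
    then have "fst (flow (P x, W x)) t = 0" by (simp add: U_def)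
    moreover have "\<forall>u\<in>T. B (W x + S (P x)) u = 0" by (simp add: W_def P(3))
    ultimately have "P x = 0 \<and> W x = 0"
      using ff P(2) unfolding focal_free_def by blast
    then have "P x = 0" "W x = 0" by auto
    then show "x = 0" unfolding W_def by (simp add: S0)
  qed
next
  assume inj: "\<forall>x. U t x = 0 \<longrightarrow> x = 0"
  show "focal_free t" unfolding focal_free_def
  proof (intro allI impI, elim conjE)
    fix v w assume v: "v \<in> T" and w: "\<forall>u\<in>T. B (w + S v) u = 0" and z: "fst (flow (v, w)) t = 0"
    \<comment> \<open>Inverts the parametrization: \<open>w + S v\<close> is orthogonal to
      \<open>T\<close>, so \<open>P ?x = v\<close>, and then \<open>W ?x = w\<close>.\<close>
    let ?x = "v + (w + S v)"
    have "P ?x = v" by (rule P_eq[OF v]) (use w in simp)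
    then have "W ?x = w" by (simp add: W_def)
    with \<open>P ?x = v\<close> z have "U t ?x = 0" by (simp add: U_def)
    with inj have "?x = 0" by blast
    with \<open>P ?x = v\<close> \<open>W ?x = w\<close> show "v = 0 \<and> w = 0"
      by (simp add: linear_0[OF P(1)] linear_0[OF linW])
  qed
qed

text \<open>Rescaling the normal part of the initial data removes the degeneracy of \<open>U t\<close> at \<open>t = a\<close>.\<close>

definition A :: "real \<Rightarrow> 'e \<Rightarrow> 'e" where "A s x = U s (P x + (x - P x) /\<^sub>R (s - a))"

text \<open>The limit is the identity on both parts: \<open>U s (P x)\<close> tends to its initial
  value \<open>P x\<close>, whereas the field of the normal part \<open>?q\<close> starts at zero
  with derivative \<open>W ?q = ?q\<close>, the limit of its quotient by
  \<open>s - a\<close>.\<close>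

lemma A_tendsto: "((\<lambda>s. A s x) \<longlongrightarrow> x) (at a within {a..b})"
proof -
  let ?q = "x - P x"
  have aa: "a \<in> {a..b}" using ab by simp
  have d: "((\<lambda>t. U t y) has_vector_derivative W y) (at a within {a..b})" for y
    using sol_U[of y, unfolded sol_def, rule_format, OF aa] by (simp add: U_a)
  have 1: "((\<lambda>s. U s (P x)) \<longlongrightarrow> P x) (at a within {a..b})"
    using has_vector_derivative_continuous[OF d[of "P x"]] by (simp add: continuous_within U_a P_id P(2))
  have "W ?q = ?q" by (simp add: W_def P_diff S0)
  with has_vector_derivative_quotient[OF d[of ?q]]
  have 2: "((\<lambda>s. U s ?q /\<^sub>R (s - a)) \<longlongrightarrow> ?q) (at a within {a..b})" by (simp add: U_a P_diff)
  have 3: "((\<lambda>s. U s (P x) + U s ?q /\<^sub>R (s - a)) \<longlongrightarrow> x) (at a within {a..b})"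
    using tendsto_add[OF 1 2] by simp
  show ?thesis
  proof (rule Lim_transform_eventually[OF 3])
    show "\<forall>\<^sub>F s in at a within {a..b}. U s (P x) + U s ?q /\<^sub>R (s - a) = A s x"
      unfolding eventually_at_filter
      by (intro always_eventually allI impI) (simp only: A_def linear_add[OF linear_U(1)] linear_cmul[OF linear_U(1)])
  qed
qed

lemma linear_A: "s \<in> {a..b} \<Longrightarrow> linear (A s)"
  by (rule linearI)
    (simp_all only: A_def linear_add[OF linear_U(1)] linear_cmul[OF linear_U(1)] linear_diff[OF linear_U(1)]
       linear_add[OF P(1)] linear_cmul[OF P(1)] scaleR_add_right scaleR_diff_right, simp_all add: algebra_simps)

lemma ev_linear_A: "\<forall>\<^sub>F s in at a within {a..b}. linear (A s)"
  unfolding eventually_at_filter by (intro always_eventually allI impI linear_A)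

text \<open>\<open>A s\<close> is close to the identity, hence injective, and for
  \<open>s \<noteq> a\<close> it differs from \<open>U s\<close> by an invertible rescaling
  only.\<close>

lemma eventually_focal_free: "\<forall>\<^sub>F s in at a within {a..b}. focal_free s"
proof -
  have "\<forall>\<^sub>F s in at a within {a..b}. inj (A s)"
    by (rule eventually_inj_of_tendsto[OF ev_linear_A linear_id inj_on_id]) (simp add: A_tendsto)
  moreover have "\<forall>\<^sub>F s in at a within {a..b}. s \<in> {a..b} \<and> s \<noteq> a"
    unfolding eventually_at_filter by simp
  ultimately show ?thesis
  proof eventually_elim
    case (elim s)
    show ?case unfolding focal_free_iff
    proof (intro allI impI)
      fix x assume x: "U s x = 0"
      \<comment> \<open>Undoes the rescaling in \<open>A\<close>, so that
        \<open>A s ?z = U s x\<close>.\<close>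
      let ?z = "P x + (s - a) *\<^sub>R (x - P x)"
      have Pz: "P ?z = P x" by (simp add: linear_add[OF P(1)] linear_cmul[OF P(1)] P_diff P_id P(2))
      have "A s ?z = U s x" using elim(2) by (simp add: A_def Pz)
      with x have "A s ?z = A s 0" using linear_0[OF linear_A] elim(2) by simp
      then have z: "?z = 0" using elim(1) by (auto dest: injD)
      then have "P x = 0" using Pz by (simp add: linear_0[OF P(1)])
      with z elim(2) show "x = 0" by simp
    qed
  qed
qed

lemma focal_free_near: obtains s where "s \<in> {a<..b}" "\<And>t. t \<in> {a<..s} \<Longrightarrow> focal_free t"
proof -
  obtain d where d: "d > 0" "\<And>x. x \<in> {a..b} \<Longrightarrow> x \<noteq> a \<Longrightarrow> dist x a < d \<Longrightarrow> focal_free x"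
    using eventually_focal_free unfolding eventually_at by blast
  show ?thesis
    by (rule that[of "min b (a + d / 2)"]) (use d ab in \<open>auto simp: dist_real_def\<close>)
qed

section \<open>Comparison of a conjugate field with the focal fields\<close>

lemma conjugate_orth:
  assumes \<tau>: "\<tau> \<in> {a<..b}" and ff: "\<And>t. t \<in> {a<..<\<tau>} \<Longrightarrow> focal_free t"
    and J: "sol J J'" and Ja: "J a = 0" and J\<tau>: "J \<tau> = 0" and uT: "u \<in> T"
  shows "B (J' a) u = 0"
proof (rule ccontr)
  assume ne: "B (J' a) u \<noteq> 0"
  define w where "w = J' a"
  define F where "F = at a within {a..b}"
  have Pw: "P w \<noteq> 0" using P(3)[OF uT, of w] ne by (auto simp: w_def)
  \<comment> \<open>The component of \<open>J\<close> along \<open>n\<close> is affine in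
    \<open>t\<close> and vanishes at both \<open>a\<close> and \<open>\<tau>\<close>.\<close>
  have wn: "B w n = 0"
    using sol_kernel(1)[OF Kn J, of \<tau>] \<tau> by (auto simp: Ja J\<tau> w_def B_simps)
  have Jn: "B (J t) n = 0" "B (J' t) n = 0" if "t \<in> {a..b}" for t
    using sol_kernel[OF Kn J that] wn by (auto simp: Ja w_def[symmetric] B_simps)
  have inj: "inj (U t)" if "t \<in> {a<..<\<tau>}" for t
    using ff[OF that] linear_U(1)[of t] that \<tau> unfolding focal_free_iff
    by (subst linear_injective_0) auto
  define inv' where "inv' t = (SOME g. \<forall>y. U t (g y) = y)" for t
  have inv': "U t (inv' t y) = y" if t: "t \<in> {a<..<\<tau>}" for t y
  proof -
    have "surj (U t)" using linear_U(1)[of t] inj[OF t] t \<tau> by (intro linear_injective_imp_surjective) auto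
    then have "\<exists>g. \<forall>y. U t (g y) = y" unfolding surj_def by metis
    from someI_ex[OF this] show ?thesis unfolding inv'_def by blast
  qed
  have evI: "\<forall>\<^sub>F s in F. s \<in> {a<..<\<tau>}"
    unfolding F_def eventually_at by (rule exI[of _ "\<tau> - a"]) (use \<tau> in \<open>auto simp: dist_real_def\<close>)
  \<comment> \<open>These are the rescaled coefficients of \<open>J s\<close> with respect to
    \<open>U s\<close>: they solve \<open>A s (z s) = J s /\<^sub>R (s - a)\<close>, whose
    right-hand side tends to \<open>w\<close> while \<open>A s\<close> tends to the identity. So
    \<open>z\<close> tends to \<open>w\<close>, which makes precise that the tangential coefficient
    of \<open>J s\<close> is approximately \<open>(s - a) *\<^sub>R P w\<close>.\<close>
  define z where "z s = P (inv' s (J s)) /\<^sub>R (s - a) + (inv' s (J s) - P (inv' s (J s)))" for s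
  have Pz: "P (z s) = P (inv' s (J s)) /\<^sub>R (s - a)" for s
    unfolding z_def by (simp add: linear_add[OF P(1)] linear_cmul[OF P(1)] P_diff P_id P(2))
  have Az: "A s (z s) = J s /\<^sub>R (s - a)" if "s \<in> {a<..<\<tau>}" for s
  proof -
    have s: "s \<in> {a..b}" using that \<tau> by auto
    have "A s (z s) = U s (inv' s (J s) /\<^sub>R (s - a))"
      unfolding A_def Pz by (simp add: z_def flip: scaleR_add_right)
    then show ?thesis by (simp add: linear_cmul[OF linear_U(1)[OF s]] inv'[OF that])
  qed
  have "(z \<longlongrightarrow> w) F"
  proof (rule tendsto_linear_solve[of A F id])
    have aa: "a \<in> {a..b}" using ab by simp
    have "((\<lambda>s. J s /\<^sub>R (s - a)) \<longlongrightarrow> w) F"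
      using has_vector_derivative_quotient[of J w a "{a..b}"] J[unfolded sol_def, rule_format, OF aa]
      by (simp add: Ja w_def F_def)
    then have "((\<lambda>s. A s (z s)) \<longlongrightarrow> w) F"
      by (rule Lim_transform_eventually) (use evI in eventually_elim, simp add: Az)
    then show "((\<lambda>s. A s (z s)) \<longlongrightarrow> id w) F" by simp
  qed (simp_all add: F_def ev_linear_A A_tendsto linear_id[unfolded id_def] id_def)
  moreover have "continuous (at w) (\<lambda>z. B (P z) w)"
    by (intro linear_continuous_at) (simp add: linear_conv_bounded_linear[symmetric] linear_compose[OF P(1) linear_left, unfolded o_def])
  ultimately have "((\<lambda>s. B (P (z s)) w) \<longlongrightarrow> B (P w) w) F"
    using isCont_tendsto_compose by blast
  \<comment> \<open>Equal to \<open>B (P w) (P w)\<close>, since \<open>w - P w\<close> is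
    orthogonal to \<open>T\<close>.\<close>
  moreover have "B (P w) w > 0"
    using posT[OF P(2) Pw] P(3)[OF P(2), of w w] by (simp add: B_simps symB)
  ultimately have "\<forall>\<^sub>F s in F. B (P (z s)) w > 0" by (rule order_tendstoD(1))
  then have "\<forall>\<^sub>F s in F. s \<in> {a<..<\<tau>} \<and> B (P (z s)) w > 0"
    using evI by eventually_elim simp
  moreover have "F \<noteq> bot" unfolding F_def using ab by (simp add: at_within_Icc_at_right trivial_limit_at_right_real)
  ultimately obtain d where d: "d \<in> {a<..<\<tau>}" "B (P (z d)) w > 0"
    using eventually_happens' by blast
  define cd where "cd = inv' d (J d)"
  have dI: "d \<in> {a..b}" using d \<tau> by auto
  have Pcd: "B (P cd) w > 0"
  proof -
    have "P cd = (d - a) *\<^sub>R P (z d)" using d unfolding Pz cd_def by simp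
    then show ?thesis using d by (simp add: B_simps)
  qed
  have Ucd: "U d cd = J d" unfolding cd_def by (rule inv'[OF d(1)])
  \<comment> \<open>The Wronskian of \<open>J\<close> with the focal field of parameter
    \<open>cd\<close>. It is fixed before the right cut-off is introduced, so one and the same
    positive number appears in all the bounds below.\<close>
  define \<kappa> where "\<kappa> = B (J' d) (J d) - B (U' d cd) (J d)"
  have "\<kappa> = B w (P cd)"
    using wronskian[OF J sol_U[of cd] dI] by (simp add: \<kappa>_def Ucd U_a Ja w_def B_simps symB[of "U' d cd"])
  then have \<kappa>: "\<kappa> > 0" using Pcd by (simp add: symB)
  have Jc: "continuous_on {a..b} J"
    by (rule continuous_on_vector_derivative[of _ _ J']) (use J in \<open>auto simp: sol_def\<close>)
  obtain CJ where CJ: "CJ > 0" "\<And>t. t \<in> {a..b} \<Longrightarrow> norm (J t) \<le> CJ"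
    using compact_imp_bounded[OF compact_continuous_image[OF Jc compact_Icc]] unfolding bounded_pos by auto
  obtain CB where CB: "CB > 0" "\<And>x y. norm (B x y) \<le> norm x * norm y * CB"
    using bounded_bilinear.pos_bounded[OF bounded_bilinear_B] by blast
  obtain M where M: "M > 0" "\<And>t x. t \<in> {a..b} \<Longrightarrow> norm (K t x) \<le> M * norm x"
    using linear_ode_bound[OF linK contK] by blast
  \<comment> \<open>Makes \<open>L * norm e\<close> a bound for \<open>B (K t e) (V t)\<close>:
    \<open>M\<close> comes from \<open>K\<close>, \<open>2 * CJ\<close> from the two terms of
    \<open>V t\<close>, and \<open>CB\<close> from \<open>B\<close>.\<close>
  define L where "L = M * (2 * CJ) * CB"
  \<comment> \<open>With \<open>t1\<close> as right cut-off, \<open>lam\<close> rises from 0 at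
    \<open>d\<close> to 1 at \<open>t1\<close>; hence \<open>V d = J d\<close>, so that
    \<open>G d\<close> contains \<open>\<kappa>\<close>, and \<open>V t1 = 0\<close>, so that
    \<open>G t1 = 0\<close>.\<close>
  have bound: "\<kappa> \<le> B (J t1) (J d) / (t1 - d) + L * norm (J t1) * (t1 - d)" if t1: "t1 \<in> {d<..<\<tau>}" for t1
  proof -
    define e where "e = J t1"
    define lam where "lam t = (t - d) / (t1 - d)" for t
    define V where "V t = J t - lam t *\<^sub>R e" for t
    define V' where "V' t = J' t - e /\<^sub>R (t1 - d)" for t
    define c where "c t = inv' t (V t)" for t
    define G where "G t = B (V' t) (V t) - B (U' t (c t)) (V t)" for t
    have I: "t \<in> {a..b}" "t \<in> {a<..<\<tau>}" "t \<in> {a<..<b}" if "t \<in> {d..t1}" for t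
      using that d t1 \<tau> by auto
    have en: "B e n = 0" using Jn t1 d \<tau> by (auto simp: e_def)
    have Vn: "B (V t) n = 0" "B (V' t) n = 0" if "t \<in> {d..t1}" for t
      using Jn[OF I(1)[OF that]] en by (auto simp: V_def V'_def B_simps)
    have Uc: "U t (c t) = V t" if "t \<in> {d..t1}" for t
      unfolding c_def by (rule inv'[OF I(2)[OF that]])
    have dJ: "(J has_vector_derivative J' t) (at t)" "(J' has_vector_derivative K t (J t)) (at t)"
      and dU: "((\<lambda>t. U t x) has_vector_derivative U' t x) (at t)" "((\<lambda>t. U' t x) has_vector_derivative K t (U t x)) (at t)"
      if "t \<in> {d..t1}" for t x
      using J[unfolded sol_def, rule_format, OF I(1)[OF that]] sol_U[of x, unfolded sol_def, rule_format, OF I(1)[OF that]]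
        I(3)[OF that] at_within_Icc_at[of a t b] by auto
    have dlam: "(lam has_real_derivative inverse (t1 - d)) (at t)" for t
    proof -
      have "((\<lambda>t. t - d) has_real_derivative 1) (at t)" by (auto intro!: derivative_eq_intros)
      from DERIV_cdivide[OF this, of "t1 - d"] show ?thesis by (simp add: lam_def[abs_def] inverse_eq_divide)
    qed
    have dV: "(V has_vector_derivative V' t) (at t)" "(V' has_vector_derivative K t (J t)) (at t)" if t: "t \<in> {d..t1}" for t
    proof -
      show "(V has_vector_derivative V' t) (at t)" unfolding V_def[abs_def] V'_def
        using dJ(1)[OF t] dlam[of t] by (auto intro!: derivative_eq_intros)
      show "(V' has_vector_derivative K t (J t)) (at t)" unfolding V'_def[abs_def]
        using dJ(2)[OF t] by (auto intro!: derivative_eq_intros)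
    qed
    \<comment> \<open>Differentiating \<open>U t (c t) = V t\<close> determines \<open>c'\<close>;
      the solution lemma supplies the differentiability of \<open>c\<close>, which is given only
      through pointwise inverses of \<open>U t\<close>.\<close>
    have dc: "\<exists>c'. (c has_vector_derivative c') (at t) \<and> U t c' = V' t - U' t (c t)" if t: "t \<in> {d..t1}" for t
    proof -
      note lU = linear_U[OF I(1)[OF t]]
      have evt: "\<forall>\<^sub>F s in at t. s \<in> {a<..<\<tau>}"
        using I(2)[OF t] by (intro eventually_at_in_open') auto
      define c' where "c' = inv' t (V' t - U' t (c t))"
      have c': "U t c' = V' t - U' t (c t)" unfolding c'_def by (rule inv'[OF I(2)[OF t]])
      have "(c has_derivative (\<lambda>h. h *\<^sub>R c')) (at t)"
      proof (rule has_derivative_linear_solve[where A=U and A'="\<lambda>v h. h *\<^sub>R U' t v" and k=V and k'="\<lambda>h. h *\<^sub>R V' t"])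
        show "\<forall>\<^sub>F y in at t. linear (U y)"
          using evt by eventually_elim (rule linear_U(1), use \<tau> in auto)
        show "\<forall>\<^sub>F y in at t. U y (c y) = V y"
          using evt by eventually_elim (simp add: c_def inv')
        show "U t (h *\<^sub>R c') = h *\<^sub>R V' t - h *\<^sub>R U' t (c t)" for h
          by (simp add: linear_cmul[OF lU(1)] c' scaleR_right_diff_distrib)
      qed (use lU inj[OF I(2)[OF t]] dU[OF t] dV[OF t] Uc[OF t] in \<open>auto simp: has_vector_derivative_def\<close>)
      then show ?thesis using c' by (auto simp: has_vector_derivative_def)
    qed
    have dG: "\<exists>g. (G has_real_derivative g) (at t) \<and> - L * norm e \<le> g" if t: "t \<in> {d..t1}" for t
    proof -
      note t' = I(1)[OF t] and lU = linear_U[OF I(1)[OF t]]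
      obtain c' where c': "(c has_vector_derivative c') (at t)" "U t c' = V' t - U' t (c t)"
        using dc[OF t] by blast
      have "((\<lambda>t. U' t (c t)) has_derivative (\<lambda>h. h *\<^sub>R K t (U t (c t)) + U' t (h *\<^sub>R c'))) (at t)"
      proof (rule has_derivative_linear_family[where L'="\<lambda>x h. h *\<^sub>R K t (U t x)"])
        have "\<forall>\<^sub>F s in at t. s \<in> {a<..<\<tau>}"
          using I(2)[OF t] by (intro eventually_at_in_open') auto
        then show "\<forall>\<^sub>F y in at t. linear (U' y)"
          by eventually_elim (rule linear_U(2), use \<tau> in auto)
        show "linear (\<lambda>x. h *\<^sub>R K t (U t x))" for h
          using linear_compose[OF lU(1) linK[OF t']] by (auto simp: o_def intro: linear_compose_scale_right)
      qed (use lU dU[OF t] c' in \<open>auto simp: has_vector_derivative_def\<close>)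
      then have dU'c: "((\<lambda>t. U' t (c t)) has_vector_derivative K t (V t) + U' t c') (at t)"
        by (simp add: has_vector_derivative_def Uc[OF t] linear_cmul[OF lU(2)] scaleR_add_right)
      note bb = bounded_bilinear.has_vector_derivative[OF bounded_bilinear_B]
      have "(G has_vector_derivative (B (V' t) (V' t) + B (K t (J t)) (V t)
          - (B (U' t (c t)) (V' t) + B (K t (V t) + U' t c') (V t)))) (at t)"
        unfolding G_def[abs_def] by (intro has_vector_derivative_diff bb dV[OF t] dU'c)
      \<comment> \<open>Completion of the square: by \<open>lagrangian\<close>,
        \<open>B (U' t c') (V t) = B (V' t - U' t (c t)) (U' t (c t))\<close>, which turns the terms
        quadratic in derivatives into the square of \<open>U t c' = V' t - U' t (c t)\<close>. The
        term with \<open>lam t\<close> is left over because \<open>V'\<close> has derivative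
        \<open>K t (J t)\<close> instead of \<open>K t (V t)\<close>.\<close>
      moreover have "B (V' t) (V' t) + B (K t (J t)) (V t) - (B (U' t (c t)) (V' t) + B (K t (V t) + U' t c') (V t))
          = B (U t c') (U t c') + lam t * B (K t e) (V t)"
      proof -
        have "B (U' t c') (V t) = B (U t c') (U' t (c t))"
          using lagrangian[OF t', of c' "c t"] Uc[OF t] by simp
        moreover have "K t (J t) = K t (V t) + lam t *\<^sub>R K t e"
          by (simp add: V_def linear_diff[OF linK[OF t']] linear_cmul[OF linK[OF t']])
        ultimately show ?thesis by (simp add: c'(2) B_simps symB[of "U' t (c t)" "V' t"])
      qed
      ultimately have "(G has_real_derivative (B (U t c') (U t c') + lam t * B (K t e) (V t))) (at t)"
        by (simp add: has_real_derivative_iff_has_vector_derivative)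
      \<comment> \<open>Nonnegativity requires orthogonality to \<open>n\<close>. As
        \<open>V t\<close> is orthogonal to \<open>n\<close> and \<open>t > a\<close>, so is
        \<open>c t\<close>, hence so is \<open>U' t (c t)\<close>; and \<open>V' t\<close> is
        orthogonal to \<open>n\<close> as well.\<close>
      moreover have "0 \<le> B (U t c') (U t c')"
      proof (rule nonneg)
        have "(t - a) * B (c t) n = 0" using U_n(1)[OF t', of "c t"] Vn(1)[OF t] Uc[OF t] by simp
        then have "B (c t) n = 0" using I(2)[OF t] by simp
        then show "B (U t c') n = 0" using U_n(2)[OF t', of "c t"] Vn(2)[OF t] by (simp add: c'(2) B_simps)
      qed
      moreover have "\<bar>lam t * B (K t e) (V t)\<bar> \<le> L * norm e"
      proof -
        have lam: "0 \<le> lam t" "lam t \<le> 1" using t t1 by (auto simp: lam_def field_simps)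
        have "norm (lam t *\<^sub>R e) \<le> CJ"
          using mult_mono[OF lam(2) CJ(2)[of t1]] lam(1) t1 d \<tau> by (auto simp: e_def)
        then have "norm (V t) \<le> 2 * CJ"
          unfolding V_def using CJ(2)[OF t'] norm_triangle_ineq4[of "J t" "lam t *\<^sub>R e"] by linarith
        then have "norm (K t e) * norm (V t) * CB \<le> (M * norm e) * (2 * CJ) * CB"
          using CB(1) M(2)[OF t', of e] M(1) by (intro mult_right_mono mult_mono) auto
        then have "\<bar>B (K t e) (V t)\<bar> \<le> L * norm e"
          using CB(2)[of "K t e" "V t"] by (simp add: L_def mult_ac)
        then show ?thesis using lam mult_mono[of "lam t" 1 "\<bar>B (K t e) (V t)\<bar>" "L * norm e"]
          by (simp add: abs_mult)
      qed
      ultimately show ?thesis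
        by (intro exI[of _ "B (U t c') (U t c') + lam t * B (K t e) (V t)"]) (auto simp: abs_le_iff)
    qed
    \<comment> \<open>Adding \<open>L * norm e * t\<close> absorbs the error term, so that the sum
      is monotone on \<open>{d..t1}\<close>.\<close>
    have "G d + L * norm e * d \<le> G t1 + L * norm e * t1"
    proof (rule DERIV_nonneg_imp_nondecreasing[of d t1 "\<lambda>t. G t + L * norm e * t"])
      show "d \<le> t1" using t1 by simp
      fix t assume "d \<le> t" "t \<le> t1"
      then obtain g where "(G has_real_derivative g) (at t)" "- L * norm e \<le> g" using dG[of t] by auto
      then show "\<exists>y. ((\<lambda>t. G t + L * norm e * t) has_real_derivative y) (at t) \<and> 0 \<le> y"
        by (intro exI[of _ "g + L * norm e"]) (auto intro!: derivative_eq_intros)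
    qed
    moreover have "G t1 = 0"
    proof -
      have "V t1 = 0" using t1 by (simp add: V_def lam_def e_def)
      then show ?thesis by (simp add: G_def B_simps)
    qed
    moreover have "G d = \<kappa> - B e (J d) / (t1 - d)"
    proof -
      have Vd: "V d = J d" by (simp add: V_def lam_def)
      then have "c d = cd" by (simp add: c_def cd_def)
      then show ?thesis by (simp add: G_def Vd V'_def \<kappa>_def B_simps divide_inverse)
    qed
    ultimately show ?thesis by (simp add: e_def algebra_simps)
  qed
  have J0: "(J \<longlongrightarrow> 0) (at_left \<tau>)"
  proof -
    have "(J has_vector_derivative J' \<tau>) (at \<tau> within {a..b})" using J \<tau> by (auto simp: sol_def)
    then have "(J \<longlongrightarrow> J \<tau>) (at \<tau> within {a..b})"
      using has_vector_derivative_continuous continuous_within by blast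
    then have "(J \<longlongrightarrow> J \<tau>) (at \<tau> within {a..\<tau>})"
      by (rule tendsto_within_subset) (use \<tau> in auto)
    then show ?thesis using \<tau> by (simp add: J\<tau> at_within_Icc_at_left)
  qed
  \<comment> \<open>With \<open>d\<close> fixed, \<open>t - d\<close> stays away from zero, so both
    terms vanish in the limit along with \<open>J t\<close>.\<close>
  have "((\<lambda>t. B (J t) (J d) / (t - d) + L * norm (J t) * (t - d)) \<longlongrightarrow> B 0 (J d) / (\<tau> - d) + L * norm (0::'e) * (\<tau> - d)) (at_left \<tau>)"
    using d by (intro tendsto_intros J0 bounded_bilinear.tendsto[OF bounded_bilinear_B]) auto
  moreover have "\<forall>\<^sub>F t in at_left \<tau>. \<kappa> \<le> B (J t) (J d) / (t - d) + L * norm (J t) * (t - d)"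
    using eventually_at_left_real[of d \<tau>] d by (auto elim!: eventually_mono intro!: bound)
  ultimately have "\<kappa> \<le> B 0 (J d) / (\<tau> - d) + L * norm (0::'e) * (\<tau> - d)"
    by (intro tendsto_lowerbound) auto
  then show False using \<kappa> by (simp add: B_simps)
qed

end

section \<open>Derivatives of smooth maps and of families of linear and bilinear maps\<close>

abbreviation fd :: "('a::real_normed_vector \<Rightarrow> 'b::real_normed_vector) \<Rightarrow> 'a \<Rightarrow> 'a \<Rightarrow> 'b" where
  "fd f x \<equiv> frechet_derivative f (at x)"

lemma fd_eqI: "(f has_derivative f') (at x) \<Longrightarrow> fd f x = f'"
  by (rule frechet_derivative_at[symmetric])

lemma fd_works: "f differentiable (at x) \<Longrightarrow> (f has_derivative fd f x) (at x)"
  using frechet_derivative_works by blast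

lemma fd_cong_open:
  assumes "open X" "x \<in> X" "\<And>y. y \<in> X \<Longrightarrow> f y = g y"
  shows "fd f x = fd g x"
proof -
  have "(f has_derivative f') (at x) \<longleftrightarrow> (g has_derivative f') (at x)" for f'
    using assms by (metis has_derivative_transform_within_open)
  then show ?thesis unfolding frechet_derivative_def by simp
qed

lemma C_inf_has_derivative: "C_infinity_on X f \<Longrightarrow> x \<in> X \<Longrightarrow> (f has_derivative fd f x) (at x)"
  unfolding C_infinity_on_def by (metis Ck_on.simps(2) fd_works)

lemma C_inf_differentiable: "C_infinity_on X f \<Longrightarrow> x \<in> X \<Longrightarrow> f differentiable (at x)"
  by (meson C_inf_has_derivative differentiableI)

lemma C_inf_fd: "C_infinity_on X f \<Longrightarrow> C_infinity_on X (\<lambda>x. fd f x v)"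
  unfolding C_infinity_on_def by (metis Ck_on.simps(2))

lemma C_inf_continuous: "C_infinity_on X f \<Longrightarrow> continuous_on X f"
  unfolding C_infinity_on_def by (metis Ck_on.simps(1))

lemma fd_symmetric:
  fixes f :: "'a::euclidean_space \<Rightarrow> 'b::euclidean_space"
  assumes X: "open X" "x \<in> X" and f: "C_infinity_on X f"
  shows "fd (\<lambda>y. fd f y u) x v = fd (\<lambda>y. fd f y v) x u"
proof (rule second_derivative_symmetric[OF X, of f "fd f" u "fd (\<lambda>y. fd f y u)" v "fd (\<lambda>y. fd f y v)"])
  have "continuous_on X (\<lambda>y. fd (\<lambda>y. fd f y p) y q)" for p q
    by (intro C_inf_continuous C_inf_fd f)
  then show "isCont (\<lambda>y. fd (\<lambda>y. fd f y u) y v) x" "isCont (\<lambda>y. fd (\<lambda>y. fd f y v) y u) x"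
    using X by (auto simp: continuous_on_eq_continuous_at)
qed (auto intro: C_inf_has_derivative C_inf_fd f)

lemma linear_fd: "f differentiable (at x) \<Longrightarrow> linear (fd f x)"
  using has_derivative_linear fd_works by blast

lemma linear_fd_param:
  fixes L :: "'q::real_normed_vector \<Rightarrow> 'e::real_vector \<Rightarrow> 'f::real_normed_vector"
  assumes X: "open X" "x \<in> X" and lin: "\<And>y. y \<in> X \<Longrightarrow> linear (L y)"
    and d: "\<And>v. (\<lambda>y. L y v) differentiable (at x)"
  shows "linear (\<lambda>v. fd (\<lambda>y. L y v) x h)"
proof (rule linearI)
  fix v w r
  have "fd (\<lambda>y. L y (v + w)) x = fd (\<lambda>y. L y v + L y w) x"
    by (rule fd_cong_open[OF X]) (simp add: linear_add[OF lin])
  also have "\<dots> = (\<lambda>h. fd (\<lambda>y. L y v) x h + fd (\<lambda>y. L y w) x h)"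
    by (intro fd_eqI has_derivative_add fd_works d)
  finally show "fd (\<lambda>y. L y (v + w)) x h = fd (\<lambda>y. L y v) x h + fd (\<lambda>y. L y w) x h" by simp
  have "fd (\<lambda>y. L y (r *\<^sub>R v)) x = fd (\<lambda>y. r *\<^sub>R L y v) x"
    by (rule fd_cong_open[OF X]) (simp add: linear_cmul[OF lin])
  also have "\<dots> = (\<lambda>h. r *\<^sub>R fd (\<lambda>y. L y v) x h)"
    by (intro fd_eqI has_derivative_scaleR_right fd_works d)
  finally show "fd (\<lambda>y. L y (r *\<^sub>R v)) x h = r *\<^sub>R fd (\<lambda>y. L y v) x h" by simp
qed

lemma eventually_in_open_within:
  assumes "open X" "x q \<in> X" "(x has_derivative x') (at q within I)"
  shows "\<forall>\<^sub>F p in at q within I. x p \<in> X"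
  using has_derivative_continuous[OF assms(3)] assms(1,2) unfolding continuous_within
  by (metis topological_tendstoD)

text \<open>Base point and argument move together along \<open>p\<close>; it serves for Christoffel
  maps, metrics and differentials of transition maps evaluated along fields. The bilinear version
  below is obtained by applying it to one argument at a time.\<close>

lemma has_derivative_linear_chain:
  fixes L :: "'q::real_normed_vector \<Rightarrow> 'e::euclidean_space \<Rightarrow> 'f::real_normed_vector"
  assumes X: "open X" "x q \<in> X" and lin: "\<And>y. y \<in> X \<Longrightarrow> linear (L y)"
    and d: "\<And>v. (\<lambda>y. L y v) differentiable (at (x q))"
    and dx: "(x has_derivative x') (at q within I)" and dv: "(v has_derivative v') (at q within I)"
    and q: "q \<in> I"
  shows "((\<lambda>p. L (x p) (v p)) has_derivative
     (\<lambda>h. fd (\<lambda>y. L y (v q)) (x q) (x' h) + L (x q) (v' h))) (at q within I)"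
proof (rule has_derivative_linear_family[where L="\<lambda>p. L (x p)" and L'="\<lambda>v h. fd (\<lambda>y. L y v) (x q) (x' h)"])
  show "\<forall>\<^sub>F p in at q within I. linear (L (x p))"
    using eventually_in_open_within[of X x q, OF X dx] by eventually_elim (rule lin)
  show "((\<lambda>p. L (x p) w) has_derivative (\<lambda>h. fd (\<lambda>y. L y w) (x q) (x' h))) (at q within I)" for w
    by (rule has_derivative_compose[OF dx fd_works[OF d]])
  show "linear (\<lambda>w. fd (\<lambda>y. L y w) (x q) (x' h))" for h
    by (rule linear_fd_param[OF X lin d])
qed (use lin X dv q in auto)

lemma has_derivative_bilinear_chain:
  fixes F :: "'q::real_normed_vector \<Rightarrow> 'e::euclidean_space \<Rightarrow> 'e2::euclidean_space \<Rightarrow> 'f::real_normed_vector"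
  assumes X: "open X" "x q \<in> X" and bil: "\<And>y. y \<in> X \<Longrightarrow> bilinear (F y)"
    and d: "\<And>u v. (\<lambda>y. F y u v) differentiable (at (x q))"
    and dx: "(x has_derivative x') (at q within I)" and du: "(u has_derivative u') (at q within I)"
    and dv: "(v has_derivative v') (at q within I)" and q: "q \<in> I"
  shows "((\<lambda>p. F (x p) (u p) (v p)) has_derivative
     (\<lambda>h. fd (\<lambda>y. F y (u q) (v q)) (x q) (x' h) + F (x q) (u' h) (v q) + F (x q) (u q) (v' h))) (at q within I)"
proof (rule has_derivative_linear_family[where L="\<lambda>p. F (x p) (u p)"
      and L'="\<lambda>w h. fd (\<lambda>y. F y (u q) w) (x q) (x' h) + F (x q) (u' h) w"])
  have l: "linear (F y z)" "linear (\<lambda>z. F y z w)" if "y \<in> X" for y z w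
    using bil[OF that] by (auto simp: bilinear_def)
  show "\<forall>\<^sub>F p in at q within I. linear (F (x p) (u p))"
    using eventually_in_open_within[of X x q, OF X dx] by eventually_elim (rule l)
  show "linear (F (x q) (u q))" by (rule l[OF X(2)])
  show "((\<lambda>p. F (x p) (u p) w) has_derivative
      (\<lambda>h. fd (\<lambda>y. F y (u q) w) (x q) (x' h) + F (x q) (u' h) w)) (at q within I)" for w
    by (rule has_derivative_linear_chain[where L="\<lambda>y z. F y z w", OF X l(2) d dx du q])
  show "linear (\<lambda>w. fd (\<lambda>y. F y (u q) w) (x q) (x' h) + F (x q) (u' h) w)" for h
    by (intro linear_compose_add linear_fd_param[OF X l(1) d] l X)
qed (use dv q in auto)

subsection \<open>The Levi-Civita connection of a metric on an open set\<close>

text \<open>\<open>L\<close> records the functional \<open>B z\<close> by its values on the basis;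
  nondegeneracy makes it injective, hence surjective. This is what gives a meaning to the
  \<open>THE\<close> in the Christoffel map.\<close>

lemma form_riesz:
  fixes B :: "'e::euclidean_space \<Rightarrow> 'e \<Rightarrow> real"
  assumes bil: "bilinear B" and nd: "nondegenerate_on B UNIV" and f: "linear f"
  shows "\<exists>!z. \<forall>w. B z w = f w"
proof -
  define L where "L z = (\<Sum>b\<in>Basis. B z b *\<^sub>R b)" for z
  have linear_left: "linear (\<lambda>z. B z w)" and linear_right: "linear (B z)" for z w using bil by (auto simp: bilinear_def)
  have comp: "L z \<bullet> b = B z b" if "b \<in> Basis" for z b
    using that by (simp add: L_def inner_sum_left inner_Basis if_distrib cong: if_cong)
  have ext: "(\<forall>w. B z w = g w) \<longleftrightarrow> (\<forall>b\<in>Basis. B z b = g b)" if "linear g" for z g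
    using linear_expand[OF linear_right, of z] linear_expand[OF that] by (metis (no_types, lifting) sum.cong)
  have linL: "linear L"
    by (rule linearI) (simp_all add: L_def linear_add[OF linear_left] linear_cmul[OF linear_left] scaleR_add_left sum.distrib scaleR_sum_right)
  have "z = 0" if "L z = 0" for z
  proof -
    have "\<forall>b\<in>Basis. B z b = 0" using comp[of _ z] that by auto
    then have "\<forall>w. B z w = 0" using ext[of "\<lambda>_. 0" z] by (simp add: linear_zero)
    then show ?thesis using nd by (auto simp: nondegenerate_on_def)
  qed
  then have "inj L" using linear_injective_0[OF linL] by blast
  from linear_injective_imp_surjective[OF linL this] have "surj L" by simp
  from surjD[OF this] obtain z where z: "(\<Sum>b\<in>Basis. f b *\<^sub>R b) = L z" ..
  have "\<forall>b\<in>Basis. B z b = f b"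
    by (simp add: comp[symmetric] z[symmetric] inner_sum_left inner_Basis if_distrib cong: if_cong)
  then have z: "\<forall>w. B z w = f w" using ext[OF f] by blast
  show ?thesis
  proof (rule ex1I[of "\<lambda>z. \<forall>w. B z w = f w" z, OF z])
    fix z' assume "\<forall>w. B z' w = f w"
    then have "\<forall>w. B (z' - z) w = 0" using z by (simp add: linear_diff[OF linear_left])
    then show "z' = z" using nd by (force simp: nondegenerate_on_def)
  qed
qed

locale coord_metric =
  fixes X :: "'e::euclidean_space set" and G :: "'e \<Rightarrow> 'e \<Rightarrow> 'e \<Rightarrow> real"
  assumes X: "open X"
    and bil: "x \<in> X \<Longrightarrow> bilinear (G x)" and sym: "x \<in> X \<Longrightarrow> G x u v = G x v u"
    and nondeg: "x \<in> X \<Longrightarrow> nondegenerate_on (G x) UNIV"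
    and smooth: "C_infinity_on X (\<lambda>x. G x u v)"
begin

lemma linear_left: "x \<in> X \<Longrightarrow> linear (\<lambda>z. G x z w)" and linear_right: "x \<in> X \<Longrightarrow> linear (G x z)"
  using bil by (auto simp: bilinear_def)

text \<open>The Christoffel symbols of the first kind.\<close>

definition koszul :: "'e \<Rightarrow> 'e \<Rightarrow> 'e \<Rightarrow> 'e \<Rightarrow> real" where
  "koszul x u v w = (fd (\<lambda>y. G y v w) x u + fd (\<lambda>y. G y u w) x v - fd (\<lambda>y. G y u v) x w) / 2"

definition chr :: "'e \<Rightarrow> 'e \<Rightarrow> 'e \<Rightarrow> 'e" where
  "chr x u v = (THE z. \<forall>w. G x z w = koszul x u v w)"

lemma dG: "x \<in> X \<Longrightarrow> (\<lambda>y. G y u v) differentiable (at x)"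
  using smooth by (rule C_inf_differentiable)

lemma linear_dG:
  assumes "x \<in> X"
  shows "linear (fd (\<lambda>y. G y u v) x)" "linear (\<lambda>u. fd (\<lambda>y. G y u v) x h)" "linear (\<lambda>v. fd (\<lambda>y. G y u v) x h)"
  using linear_fd[OF dG[OF assms]] linear_fd_param[OF X assms linear_left dG[OF assms]] linear_fd_param[OF X assms linear_right dG[OF assms]]
  by auto

lemma sym_dG: "x \<in> X \<Longrightarrow> fd (\<lambda>y. G y u v) x = fd (\<lambda>y. G y v u) x"
  by (rule fd_cong_open[OF X]) (auto simp: sym)

lemma linear_koszul:
  assumes "x \<in> X"
  shows "linear (koszul x u v)" "linear (\<lambda>u. koszul x u v w)" "linear (\<lambda>v. koszul x u v w)"
  by (rule linearI; simp add: koszul_def linear_add[OF linear_dG(1)[OF assms]] linear_add[OF linear_dG(2)[OF assms]]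
      linear_add[OF linear_dG(3)[OF assms]] linear_cmul[OF linear_dG(1)[OF assms]] linear_cmul[OF linear_dG(2)[OF assms]]
      linear_cmul[OF linear_dG(3)[OF assms]] field_simps)+

lemma koszul_sym: "x \<in> X \<Longrightarrow> koszul x u v w = koszul x v u w"
  by (simp add: koszul_def sym_dG[of x u v])

lemma G_chr: assumes x: "x \<in> X" shows "G x (chr x u v) w = koszul x u v w"
proof -
  have "\<exists>!z. \<forall>w. G x z w = koszul x u v w"
    by (rule form_riesz[OF bil[OF x] nondeg[OF x] linear_koszul(1)[OF x]])
  from theI'[OF this] show ?thesis unfolding chr_def by simp
qed

lemma G_ext: "x \<in> X \<Longrightarrow> (\<And>w. G x z w = G x z' w) \<Longrightarrow> z = z'"
  using form_riesz[OF bil nondeg linear_right, of x x z'] by blast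

lemma chr_sym: "x \<in> X \<Longrightarrow> chr x u v = chr x v u"
  by (rule G_ext) (auto simp: G_chr koszul_sym)

lemma linear_chr_left: assumes x: "x \<in> X" shows "linear (\<lambda>u. chr x u v)"
  by (rule linearI; rule G_ext[OF x])
    (simp_all only: G_chr[OF x] linear_add[OF linear_left[OF x]] linear_cmul[OF linear_left[OF x]] linear_add[OF linear_koszul(2)[OF x]]
      linear_cmul[OF linear_koszul(2)[OF x]])

lemma linear_chr_right: assumes x: "x \<in> X" shows "linear (chr x u)"
  by (rule linearI; rule G_ext[OF x])
    (simp_all only: G_chr[OF x] linear_add[OF linear_left[OF x]] linear_cmul[OF linear_left[OF x]] linear_add[OF linear_koszul(3)[OF x]]
      linear_cmul[OF linear_koszul(3)[OF x]])

lemma bilinear_chr: "x \<in> X \<Longrightarrow> bilinear (chr x)"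
  by (simp add: bilinear_def linear_chr_left linear_chr_right)

text \<open>Of the six derivatives in the two Koszul expressions, four cancel after use of the
  symmetry of the metric and the other two coincide.\<close>

lemma metric_compat:
  assumes "x \<in> X"
  shows "fd (\<lambda>y. G y p w) x u = G x (chr x u p) w + G x p (chr x u w)"
  by (simp add: G_chr sym[OF assms, of p] assms koszul_def sym_dG[OF assms, of w p] sym_dG[OF assms, of w u]
      sym_dG[OF assms, of p u] field_simps)

lemma smooth_koszul: "x \<in> X \<Longrightarrow> (\<lambda>y. koszul y u v w) differentiable (at x)"
  and cont_fd_koszul: "continuous_on X (\<lambda>x. fd (\<lambda>y. koszul y u v w) x h)"
proof -
  note d2 = C_inf_has_derivative[OF C_inf_fd[OF smooth]]
  have h: "((\<lambda>y. koszul y u v w) has_derivative (\<lambda>h. (fd (\<lambda>y. fd (\<lambda>y. G y v w) y u) x h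
      + fd (\<lambda>y. fd (\<lambda>y. G y u w) y v) x h - fd (\<lambda>y. fd (\<lambda>y. G y u v) y w) x h) / 2)) (at x)"
    if "x \<in> X" for x
    unfolding koszul_def by (rule derivative_eq_intros d2 that refl | simp)+
  show "x \<in> X \<Longrightarrow> (\<lambda>y. koszul y u v w) differentiable (at x)" using h by (meson differentiableI)
  have "continuous_on X (\<lambda>x. (fd (\<lambda>y. fd (\<lambda>y. G y v w) y u) x h
      + fd (\<lambda>y. fd (\<lambda>y. G y u w) y v) x h - fd (\<lambda>y. fd (\<lambda>y. G y u v) y w) x h) / 2)"
    by (intro continuous_intros C_inf_continuous C_inf_fd smooth) auto
  then show "continuous_on X (\<lambda>x. fd (\<lambda>y. koszul y u v w) x h)"
    by (rule continuous_on_eq) (simp add: fd_eqI[OF h])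
qed

text \<open>The metric as an endomorphism of the coordinate space (its Gram matrix), so that the
  lemmas on linear equations with a parameter apply to the Christoffel map.\<close>

definition Grep :: "'e \<Rightarrow> 'e \<Rightarrow> 'e" where "Grep x z = (\<Sum>b\<in>Basis. G x z b *\<^sub>R b)"

lemma linear_Grep: "x \<in> X \<Longrightarrow> linear (Grep x)"
  by (rule linearI)
    (simp_all add: Grep_def linear_add[OF linear_left] linear_cmul[OF linear_left] scaleR_add_left sum.distrib scaleR_sum_right)

lemma inj_Grep: assumes "x \<in> X" shows "inj (Grep x)"
  unfolding linear_injective_0[OF linear_Grep[OF assms]]
proof (intro allI impI)
  fix z assume z: "Grep x z = 0"
  have "G x z b = 0" if "b \<in> Basis" for b
    using that arg_cong[OF z, of "\<lambda>v. v \<bullet> b"]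
    by (simp add: Grep_def inner_sum_left inner_Basis if_distrib cong: if_cong)
  then have "G x z w = G x 0 w" for w
    using linear_expand[OF linear_right[OF assms], of z w] linear_0[OF linear_left[OF assms]] by simp
  then show "z = 0" by (rule G_ext[OF assms])
qed

lemma ev_in_X: "x \<in> X \<Longrightarrow> \<forall>\<^sub>F y in at x. y \<in> X"
  using X by (rule eventually_at_in_open')

text \<open>The Christoffel map solves \<open>Grep y (chr y u v) = k y\<close>, where
  \<open>k\<close> has the components \<open>koszul y u v b\<close>; implicit differentiation
  replaces a formula with the inverse metric.\<close>

lemma chr_differentiable:
  assumes x: "x \<in> X"
  shows "(\<lambda>y. chr y u v) differentiable (at x)"
proof -
  let ?A' = "\<lambda>z h. \<Sum>b\<in>Basis. fd (\<lambda>y. G y z b) x h *\<^sub>R b"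
  let ?k' = "\<lambda>h. \<Sum>b\<in>Basis. fd (\<lambda>y. koszul y u v b) x h *\<^sub>R b"
  have "surj (Grep x)"
    using linear_injective_imp_surjective[OF linear_Grep[OF x] inj_Grep[OF x]] by simp
  then have "\<exists>z. Grep x z = ?k' h - ?A' (chr x u v) h" for h
    using surjD[of "Grep x" "?k' h - ?A' (chr x u v) h"] by metis
  then obtain z' where z': "\<And>h. Grep x (z' h) = ?k' h - ?A' (chr x u v) h" by metis
  have "((\<lambda>y. chr y u v) has_derivative z') (at x)"
  proof (rule has_derivative_linear_solve[where A=Grep and A'="?A'" and k'="?k'"
        and k="\<lambda>y. \<Sum>b\<in>Basis. koszul y u v b *\<^sub>R b"])
    show "\<forall>\<^sub>F y in at x. linear (Grep y)"
      using ev_in_X[OF x] by eventually_elim (rule linear_Grep)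
    show "((\<lambda>y. Grep y z) has_derivative ?A' z) (at x)" for z
      unfolding Grep_def by (intro has_derivative_sum has_derivative_scaleR_left fd_works dG x)
    show "((\<lambda>y. \<Sum>b\<in>Basis. koszul y u v b *\<^sub>R b) has_derivative ?k') (at x)"
      by (intro has_derivative_sum has_derivative_scaleR_left fd_works smooth_koszul x)
    show "\<forall>\<^sub>F y in at x. Grep y (chr y u v) = (\<Sum>b\<in>Basis. koszul y u v b *\<^sub>R b)"
      using ev_in_X[OF x] by eventually_elim (simp add: Grep_def G_chr)
  qed (auto simp: linear_Grep x inj_Grep z', simp add: Grep_def G_chr x)
  then show ?thesis by (rule differentiableI)
qed

lemma linear_dchr:
  assumes "x \<in> X"
  shows "linear (fd (\<lambda>y. chr y u v) x)" "linear (\<lambda>u. fd (\<lambda>y. chr y u v) x h)" "linear (\<lambda>v. fd (\<lambda>y. chr y u v) x h)"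
  using linear_fd[OF chr_differentiable[OF assms]] linear_fd_param[OF X assms linear_chr_left chr_differentiable[OF assms]]
    linear_fd_param[OF X assms linear_chr_right chr_differentiable[OF assms]]
  by auto

lemma G_dchr:
  assumes x: "x \<in> X"
  shows "G x (fd (\<lambda>y. chr y u v) x h) w = fd (\<lambda>y. koszul y u v w) x h - fd (\<lambda>y. G y (chr x u v) w) x h"
proof -
  have "((\<lambda>y. G y (chr y u v) w) has_derivative
     (\<lambda>h. fd (\<lambda>y. G y (chr x u v) w) x h + G x (fd (\<lambda>y. chr y u v) x h) w)) (at x)"
    by (rule has_derivative_linear_chain[where x="\<lambda>y. y" and q=x and L="\<lambda>y z. G y z w"])
      (use X x linear_left dG fd_works[OF chr_differentiable[OF x]] in auto)
  then have "fd (\<lambda>y. G y (chr y u v) w) x =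
     (\<lambda>h. fd (\<lambda>y. G y (chr x u v) w) x h + G x (fd (\<lambda>y. chr y u v) x h) w)" by (rule fd_eqI)
  moreover have "fd (\<lambda>y. G y (chr y u v) w) x = fd (\<lambda>y. koszul y u v w) x"
    by (rule fd_cong_open[OF X x]) (simp add: G_chr)
  ultimately show ?thesis by (metis add_diff_cancel_left')
qed

lemma continuous_chr: "continuous_on X (\<lambda>x. chr x u v)"
  by (intro continuous_at_imp_continuous_on ballI differentiable_imp_continuous_within chr_differentiable)

text \<open>By \<open>G_dchr\<close> the derivative again solves a linear equation with matrix
  \<open>Grep s\<close> and a continuous right-hand side. It is needed for the continuity of the
  curvature, and thus of the coefficients of the Jacobi equation.\<close>

lemma continuous_dchr: "continuous_on X (\<lambda>x. fd (\<lambda>y. chr y u v) x h)"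
proof (intro continuous_at_imp_continuous_on ballI)
  fix x assume x: "x \<in> X"
  have cG: "((\<lambda>s. G s z b) \<longlongrightarrow> G x z b) (at x)" for z b
    using C_inf_continuous[OF smooth] x X by (metis continuous_on_eq_continuous_at isCont_def)
  have cdG: "((\<lambda>s. fd (\<lambda>y. G y z b) s h) \<longlongrightarrow> fd (\<lambda>y. G y z b) x h) (at x)" for z b
    using C_inf_continuous[OF C_inf_fd[OF smooth]] x X by (metis continuous_on_eq_continuous_at isCont_def)
  have cc: "((\<lambda>s. chr s u v) \<longlongrightarrow> chr x u v) (at x)"
    using continuous_chr x X by (metis continuous_on_eq_continuous_at isCont_def)
  have ck: "((\<lambda>s. fd (\<lambda>y. koszul y u v b) s h) \<longlongrightarrow> fd (\<lambda>y. koszul y u v b) x h) (at x)" for b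
    using cont_fd_koszul x X by (metis continuous_on_eq_continuous_at isCont_def)
  have ev: "\<forall>\<^sub>F s in at x. linear (Grep s)"
    using ev_in_X[OF x] by eventually_elim (rule linear_Grep)
  have expand: "fd (\<lambda>y. G y (chr s u v) b) s h = (\<Sum>c\<in>Basis. (chr s u v \<bullet> c) *\<^sub>R fd (\<lambda>y. G y c b) s h)"
    if "s \<in> X" for s b by (rule linear_expand[OF linear_dG(2)[OF that]])
  have "((\<lambda>s. fd (\<lambda>y. chr y u v) s h) \<longlongrightarrow> fd (\<lambda>y. chr y u v) x h) (at x)"
  proof (rule tendsto_linear_solve[OF ev linear_Grep[OF x] inj_Grep[OF x]])
    show "((\<lambda>s. Grep s z) \<longlongrightarrow> Grep x z) (at x)" for z
      unfolding Grep_def by (intro tendsto_intros cG)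
    have "((\<lambda>s. \<Sum>b\<in>Basis. (fd (\<lambda>y. koszul y u v b) s h
          - (\<Sum>c\<in>Basis. (chr s u v \<bullet> c) *\<^sub>R fd (\<lambda>y. G y c b) s h)) *\<^sub>R b)
        \<longlongrightarrow> (\<Sum>b\<in>Basis. (fd (\<lambda>y. koszul y u v b) x h
          - (\<Sum>c\<in>Basis. (chr x u v \<bullet> c) *\<^sub>R fd (\<lambda>y. G y c b) x h)) *\<^sub>R b)) (at x)"
      by (intro tendsto_intros cdG cc ck)
    then have *: "((\<lambda>s. \<Sum>b\<in>Basis. (fd (\<lambda>y. koszul y u v b) s h
          - (\<Sum>c\<in>Basis. (chr s u v \<bullet> c) *\<^sub>R fd (\<lambda>y. G y c b) s h)) *\<^sub>R b)
        \<longlongrightarrow> Grep x (fd (\<lambda>y. chr y u v) x h)) (at x)"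
      by (simp add: Grep_def G_dchr[OF x] expand[OF x])
    show "((\<lambda>s. Grep s (fd (\<lambda>y. chr y u v) s h)) \<longlongrightarrow> Grep x (fd (\<lambda>y. chr y u v) x h)) (at x)"
      by (rule Lim_transform_eventually[OF *])
        (use ev_in_X[OF x] in eventually_elim, simp add: Grep_def G_dchr expand)
  qed
  then show "isCont (\<lambda>x. fd (\<lambda>y. chr y u v) x h) x" by (simp add: isCont_def)
qed

subsection \<open>Curvature\<close>

text \<open>The commutator of covariant derivatives evaluated on fields with constant components,
  whose bracket is zero.\<close>

definition riem :: "'e \<Rightarrow> 'e \<Rightarrow> 'e \<Rightarrow> 'e \<Rightarrow> 'e" where
  "riem x u v w = fd (\<lambda>y. chr y v w) x u - fd (\<lambda>y. chr y u w) x v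
     + chr x u (chr x v w) - chr x v (chr x u w)"

lemma linear_riem: assumes x: "x \<in> X" shows "linear (riem x u v)"
proof -
  have "linear (\<lambda>w. riem x u v w)"
    unfolding riem_def
    by (intro linear_compose_add linear_compose_sub linear_dchr x
      linear_compose[OF linear_chr_right[OF x] linear_chr_right[OF x], unfolded o_def] linear_chr_right)
  then show ?thesis by simp
qed

lemma riem_antisym: "riem x u v w = - riem x v u w"
  by (simp add: riem_def)

text \<open>Since the Christoffel map is symmetric in its arguments, the derivative terms and the
  quadratic terms cancel in pairs.\<close>

lemma riem_bianchi:
  assumes x: "x \<in> X" shows "riem x u v w + riem x v w u + riem x w u v = 0"
proof -
  have s: "fd (\<lambda>y. chr y p q) x = fd (\<lambda>y. chr y q p) x" for p q
    by (rule fd_cong_open[OF X x]) (rule chr_sym)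
  show ?thesis
    unfolding riem_def chr_sym[OF x, of w u] chr_sym[OF x, of w v] chr_sym[OF x, of v u] s[of w u] s[of w v] s[of v u]
    by simp
qed

text \<open>By metric compatibility the expression is the commutator of two directional derivatives
  applied to half of the function \<open>G y w w\<close>, and such derivatives commute.\<close>

lemma riem_skew_diag:
  assumes x: "x \<in> X" shows "G x (riem x u v w) w = 0"
proof -
  have *: "G x (fd (\<lambda>y. chr y v w) x u) w + G x (chr x u (chr x v w)) w + G x (chr x v w) (chr x u w)
     = fd (\<lambda>y. fd (\<lambda>y. G y w w) y v) x u / 2" for u v
  proof -
    have k: "koszul y v w w = fd (\<lambda>y. G y w w) y v / 2" for y by (simp add: koszul_def)
    have "fd (\<lambda>y. koszul y v w w) x = (\<lambda>u. fd (\<lambda>y. fd (\<lambda>y. G y w w) y v) x u / 2)"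
      unfolding k by (rule fd_eqI) (auto intro!: derivative_eq_intros C_inf_has_derivative[OF C_inf_fd[OF smooth] x])
    then show ?thesis
      using G_dchr[OF x, of v w u w] metric_compat[OF x, of "chr x v w" w u] by simp
  qed
  from *[of v u] *[of u v] fd_symmetric[OF X x smooth[of w w], of u v] sym[OF x, of "chr x v w" "chr x u w"]
  show ?thesis
    unfolding riem_def linear_diff[OF linear_left[OF x]] linear_add[OF linear_left[OF x]] by simp
qed

lemma riem_skew: assumes x: "x \<in> X" shows "G x (riem x u v w) z = - G x (riem x u v z) w"
  using riem_skew_diag[OF x, of u v "w + z"] riem_skew_diag[OF x, of u v w] riem_skew_diag[OF x, of u v z]
  by (simp add: linear_add[OF linear_riem[OF x]] linear_add[OF linear_left[OF x]] linear_add[OF linear_right[OF x]])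

text \<open>With \<open>u = w\<close> this is the self-adjointness of
  \<open>v \<mapsto> R(u,v)u\<close>, the source of the symmetry of \<open>K t\<close>.\<close>

lemma riem_pair_sym: assumes x: "x \<in> X" shows "G x (riem x u v w) z = G x (riem x w z u) v"
proof -
  let ?R = "\<lambda>a b c d. G x (riem x a b c) d"
  have b: "?R p q r d + ?R q r p d + ?R r p q d = 0" for p q r d
    using arg_cong[OF riem_bianchi[OF x, of p q r], of "\<lambda>z. G x z d"]
    by (simp add: linear_add[OF linear_left[OF x]] linear_0[OF linear_left[OF x]])
  have a: "?R p q r d = - ?R q p r d" for p q r d
    using arg_cong[OF riem_antisym[of x p q r], of "\<lambda>z. G x z d"] by (simp add: linear_neg[OF linear_left[OF x]])
  note s = riem_skew[OF x]
  \<comment> \<open>Four cyclic sums, one for each choice of the last argument, together with the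
    two skew symmetries.\<close>
  have "?R w u v z = ?R v z w u" for u v w z
    using b[of u v w z] b[of v w z u] b[of w z u v] b[of z u v w]
      s[of v w u z] s[of u v w z] s[of w z v u] s[of z u w v]
      a[of u w z v] s[of w u z v] a[of v z u w] s[of z v u w] a[of z v w u]
    by linarith
  then show ?thesis .
qed

text \<open>Joint continuity follows from continuity for fixed arguments, by multilinearity.\<close>

context
  fixes I :: "real set" and c :: "real \<Rightarrow> 'e"
  assumes c: "continuous_on I c" "c ` I \<subseteq> X"
begin

lemma continuous_metric:
  assumes u: "continuous_on I u" and v: "continuous_on I v"
  shows "continuous_on I (\<lambda>t. G (c t) (u t) (v t))"
proof (rule linear_family_continuous[of I "\<lambda>t. G (c t) (u t)"])
  show "continuous_on I (\<lambda>t. G (c t) (u t) x)" for x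
    by (rule linear_family_continuous[of I "\<lambda>t p. G (c t) p x"])
      (use c linear_left u continuous_on_compose2[OF C_inf_continuous[OF smooth] c] in auto)
qed (use c linear_right v in auto)

lemma continuous_chr_along:
  assumes u: "continuous_on I u" and v: "continuous_on I v"
  shows "continuous_on I (\<lambda>t. chr (c t) (u t) (v t))"
proof (rule linear_family_continuous[of I "\<lambda>t. chr (c t) (u t)"])
  show "continuous_on I (\<lambda>t. chr (c t) (u t) x)" for x
    by (rule linear_family_continuous[of I "\<lambda>t p. chr (c t) p x"])
      (use c linear_chr_left u continuous_on_compose2[OF continuous_chr c] in auto)
qed (use c linear_chr_right v in auto)

lemma continuous_dchr_along:
  assumes p: "continuous_on I p" and q: "continuous_on I q" and r: "continuous_on I r"
  shows "continuous_on I (\<lambda>t. fd (\<lambda>y. chr y (p t) (q t)) (c t) (r t))"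
proof (rule linear_family_continuous[of I "\<lambda>t. fd (\<lambda>y. chr y (p t) (q t)) (c t)"])
  show "continuous_on I (\<lambda>t. fd (\<lambda>y. chr y (p t) (q t)) (c t) x)" for x
  proof (rule linear_family_continuous[of I "\<lambda>t q. fd (\<lambda>y. chr y (p t) q) (c t) x"])
    show "continuous_on I (\<lambda>t. fd (\<lambda>y. chr y (p t) z) (c t) x)" for z
      by (rule linear_family_continuous[of I "\<lambda>t p. fd (\<lambda>y. chr y p z) (c t) x"])
        (use c linear_dchr p continuous_on_compose2[OF continuous_dchr c] in auto)
  qed (use c linear_dchr q in auto)
qed (use c linear_dchr r in auto)

lemma continuous_riem:
  assumes "continuous_on I u" "continuous_on I v" "continuous_on I w"
  shows "continuous_on I (\<lambda>t. riem (c t) (u t) (v t) (w t))"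
  unfolding riem_def by (intro continuous_intros continuous_chr_along continuous_dchr_along assms)

end

end

subsection \<open>Change of coordinates\<close>

locale coord_change = M: coord_metric X G + N: coord_metric Y H
  for X :: "'e::euclidean_space set" and G and Y :: "'e set" and H +
  fixes D :: "'e set" and \<Phi> :: "'e \<Rightarrow> 'e"
  assumes D: "open D" "D \<subseteq> X" "\<Phi> ` D \<subseteq> Y" and smooth: "C_infinity_on D \<Phi>"
    and isometry: "x \<in> D \<Longrightarrow> G x u v = H (\<Phi> x) (fd \<Phi> x u) (fd \<Phi> x v)"
begin

lemma in_dom: "x \<in> D \<Longrightarrow> x \<in> X" "x \<in> D \<Longrightarrow> \<Phi> x \<in> Y"
  using D by auto

lemma linear_fd\<Phi>: "x \<in> D \<Longrightarrow> linear (fd \<Phi> x)"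
  by (intro linear_fd C_inf_differentiable[OF smooth])

lemma fd_metric:
  assumes x: "x \<in> D"
  shows "fd (\<lambda>y. G y u v) x h = fd (\<lambda>y. H y (fd \<Phi> x u) (fd \<Phi> x v)) (\<Phi> x) (fd \<Phi> x h)
     + H (\<Phi> x) (fd (\<lambda>y. fd \<Phi> y u) x h) (fd \<Phi> x v) + H (\<Phi> x) (fd \<Phi> x u) (fd (\<lambda>y. fd \<Phi> y v) x h)"
proof -
  have "((\<lambda>y. H (\<Phi> y) (fd \<Phi> y u) (fd \<Phi> y v)) has_derivative
     (\<lambda>h. fd (\<lambda>y. H y (fd \<Phi> x u) (fd \<Phi> x v)) (\<Phi> x) (fd \<Phi> x h)
     + H (\<Phi> x) (fd (\<lambda>y. fd \<Phi> y u) x h) (fd \<Phi> x v) + H (\<Phi> x) (fd \<Phi> x u) (fd (\<lambda>y. fd \<Phi> y v) x h))) (at x)"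
    by (rule has_derivative_bilinear_chain[where x=\<Phi> and X=Y and F=H])
      (use x N.X in_dom N.bil N.dG C_inf_has_derivative[OF smooth] C_inf_has_derivative[OF C_inf_fd[OF smooth]] in auto)
  moreover have "fd (\<lambda>y. G y u v) x = fd (\<lambda>y. H (\<Phi> y) (fd \<Phi> y u) (fd \<Phi> y v)) x"
    by (rule fd_cong_open[OF D(1) x]) (rule isometry)
  ultimately show ?thesis by (simp add: fd_eqI)
qed

lemma second_sym: "x \<in> D \<Longrightarrow> fd (\<lambda>y. fd \<Phi> y u) x v = fd (\<lambda>y. fd \<Phi> y v) x u"
  by (rule fd_symmetric[OF D(1) _ smooth])

text \<open>A vector killed by the differential of an isometry is orthogonal to everything, hence
  zero; so the differential is injective and, by dimension, onto.\<close>

lemma fd\<Phi>_surj: assumes x: "x \<in> D" obtains u where "fd \<Phi> x u = w"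
proof -
  have "u = 0" if "fd \<Phi> x u = 0" for u
  proof (rule M.G_ext[OF in_dom(1)[OF x]])
    show "G x u v = G x 0 v" for v
      by (simp add: isometry[OF x] that linear_0[OF linear_fd\<Phi>[OF x]])
  qed
  then have "inj (fd \<Phi> x)" using linear_injective_0[OF linear_fd\<Phi>[OF x]] by blast
  from linear_injective_imp_surjective[OF linear_fd\<Phi>[OF x] this] have "surj (fd \<Phi> x)" by simp
  from surjD[OF this] obtain u where "w = fd \<Phi> x u" ..
  then show ?thesis using that by simp
qed

text \<open>Differentiating the isometry condition puts six second derivatives of
  \<open>\<Phi>\<close> into the Koszul expression. By their symmetry four cancel and the other two
  agree, which yields the inhomogeneous term.\<close>

lemma chr_change:
  assumes x: "x \<in> D"
  shows "N.chr (\<Phi> x) (fd \<Phi> x u) (fd \<Phi> x v) = fd \<Phi> x (M.chr x u v) - fd (\<lambda>y. fd \<Phi> y v) x u"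
proof (rule N.G_ext[OF in_dom(2)[OF x]])
  fix w'
  obtain w where w: "w' = fd \<Phi> x w" using fd\<Phi>_surj[OF x] by metis
  let ?H = "H (\<Phi> x)" and ?D2 = "\<lambda>u h. fd (\<lambda>y. fd \<Phi> y u) x h"
  have s: "?H p q = ?H q p" for p q by (rule N.sym[OF in_dom(2)[OF x]])
  have "?H (fd \<Phi> x (M.chr x u v)) w' = M.koszul x u v w"
    unfolding w by (simp add: isometry[OF x, symmetric] M.G_chr in_dom x)
  also have "\<dots> = N.koszul (\<Phi> x) (fd \<Phi> x u) (fd \<Phi> x v) w' + ?H (?D2 v u) w'"
    unfolding M.koszul_def N.koszul_def w fd_metric[OF x]
    using second_sym[OF x, of u v] second_sym[OF x, of u w] second_sym[OF x, of v w]
      s[of "?D2 v u" "fd \<Phi> x w"] s[of "?D2 w u" "fd \<Phi> x v"] s[of "?D2 w v" "fd \<Phi> x u"]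
    by (simp add: field_simps)
  finally show "?H (N.chr (\<Phi> x) (fd \<Phi> x u) (fd \<Phi> x v)) w' = ?H (fd \<Phi> x (M.chr x u v) - ?D2 v u) w'"
    by (simp add: N.G_chr in_dom x linear_diff[OF N.linear_left])
qed

text \<open>Differentiate the transformation law of the Christoffel map once more; the terms with third derivatives, and those
  with second derivatives, are symmetric in the two arguments that are antisymmetrized.\<close>

lemma riem_change:
  assumes x: "x \<in> D"
  shows "N.riem (\<Phi> x) (fd \<Phi> x z) (fd \<Phi> x u) (fd \<Phi> x v) = fd \<Phi> x (M.riem x z u v)"
proof -
  let ?N = "N.chr (\<Phi> x)" and ?M = "M.chr x" and ?T = "fd \<Phi> x" and ?D2 = "\<lambda>u h. fd (\<lambda>y. fd \<Phi> y u) x h"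
  have xX: "x \<in> X" and xY: "\<Phi> x \<in> Y" using in_dom x by auto
  note d1 = C_inf_has_derivative[OF smooth x] and d2 = C_inf_has_derivative[OF C_inf_fd[OF smooth] x]
  have dchr: "fd (\<lambda>y. N.chr y (?T u) (?T v)) (\<Phi> x) (?T h) + ?N (?D2 u h) (?T v) + ?N (?T u) (?D2 v h)
     = ?D2 (?M u v) h + ?T (fd (\<lambda>y. M.chr y u v) x h) - fd (\<lambda>y. fd (\<lambda>y. fd \<Phi> y v) y u) x h" for u v h
  proof -
    have "((\<lambda>y. N.chr (\<Phi> y) (fd \<Phi> y u) (fd \<Phi> y v)) has_derivative
      (\<lambda>h. fd (\<lambda>y. N.chr y (?T u) (?T v)) (\<Phi> x) (?T h) + ?N (?D2 u h) (?T v) + ?N (?T u) (?D2 v h))) (at x)"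
      by (rule has_derivative_bilinear_chain[where x=\<Phi> and X=Y and F=N.chr])
        (use xY N.X N.bilinear_chr N.chr_differentiable d1 d2 in auto)
    moreover have "((\<lambda>y. fd \<Phi> y (M.chr y u v)) has_derivative
      (\<lambda>h. ?D2 (?M u v) h + ?T (fd (\<lambda>y. M.chr y u v) x h))) (at x)"
      by (rule has_derivative_linear_chain[where x="\<lambda>y. y" and q=x and L="fd \<Phi>" and X=D])
        (use x D linear_fd\<Phi> C_inf_differentiable[OF C_inf_fd[OF smooth] x] fd_works[OF M.chr_differentiable[OF xX]] in auto)
    then have "((\<lambda>y. fd \<Phi> y (M.chr y u v) - fd (\<lambda>y. fd \<Phi> y v) y u) has_derivative
      (\<lambda>h. ?D2 (?M u v) h + ?T (fd (\<lambda>y. M.chr y u v) x h) - fd (\<lambda>y. fd (\<lambda>y. fd \<Phi> y v) y u) x h)) (at x)"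
      by (intro has_derivative_diff C_inf_has_derivative[OF C_inf_fd[OF C_inf_fd[OF smooth]] x])
    moreover have "fd (\<lambda>y. N.chr (\<Phi> y) (fd \<Phi> y u) (fd \<Phi> y v)) x
       = fd (\<lambda>y. fd \<Phi> y (M.chr y u v) - fd (\<lambda>y. fd \<Phi> y v) y u) x"
      by (rule fd_cong_open[OF D(1) x]) (rule chr_change)
    ultimately show ?thesis by (simp add: fd_eqI fun_eq_iff)
  qed
  have dchr': "fd (\<lambda>y. N.chr y (?T u) (?T v)) (\<Phi> x) (?T h) = ?D2 (?M u v) h
     + ?T (fd (\<lambda>y. M.chr y u v) x h) - fd (\<lambda>y. fd (\<lambda>y. fd \<Phi> y v) y u) x h - ?N (?D2 u h) (?T v) - ?N (?T u) (?D2 v h)" for u v h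
    using dchr[of u v h] by (simp add: algebra_simps)
  have quad: "?N (?T p) (?N (?T q) (?T v)) = ?T (?M p (?M q v)) - ?D2 (?M q v) p - ?N (?T p) (?D2 v q)" for p q
    unfolding chr_change[OF x, of q v] linear_diff[OF N.linear_chr_right[OF xY]] chr_change[OF x, of p] ..
  have D3: "fd (\<lambda>y. fd (\<lambda>y. fd \<Phi> y v) y u) x z = fd (\<lambda>y. fd (\<lambda>y. fd \<Phi> y v) y z) x u"
    by (rule fd_symmetric[OF D(1) x C_inf_fd[OF smooth]])
  show ?thesis
    unfolding N.riem_def M.riem_def dchr' quad D3 second_sym[OF x, of u z]
      linear_diff[OF linear_fd\<Phi>[OF x]] linear_add[OF linear_fd\<Phi>[OF x]]
    by (simp add: algebra_simps)
qed

end

subsection \<open>Charts and transition maps\<close>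

lemma chart_inv_left: "is_chart c \<Longrightarrow> p \<in> dom_of c \<Longrightarrow> chart_inv c (coord c p) = p"
  unfolding is_chart_def homeomorphism_def by blast

lemma chart_inv_right:
  assumes "is_chart c" "x \<in> coord c ` dom_of c"
  shows "coord c (chart_inv c x) = x" "chart_inv c x \<in> dom_of c"
  using assms unfolding is_chart_def homeomorphism_def by blast+

lemma open_overlap:
  fixes c :: "('m::topological_space, 'e::euclidean_space) chart"
  assumes c: "is_chart c" and U: "open U"
  shows "open (coord c ` (dom_of c \<inter> U))"
proof -
  have "open (coord c ` dom_of c \<inter> chart_inv c -` U)"
    using c U unfolding is_chart_def homeomorphism_def by (intro continuous_open_preimage) auto
  also have "coord c ` dom_of c \<inter> chart_inv c -` U = coord c ` (dom_of c \<inter> U)"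
    using chart_inv_left[OF c] by auto
  finally show ?thesis .
qed

lemma transition_coord: "is_chart c \<Longrightarrow> p \<in> dom_of c \<Longrightarrow> transition c d (coord c p) = coord d p"
  by (simp add: transition_def chart_inv_left)

lemma compatible_smooth:
  "compatible c d \<Longrightarrow> C_infinity_on (coord c ` (dom_of c \<inter> dom_of d)) (transition c d)"
  by (simp add: compatible_def)

lemma transition_has_derivative:
  assumes "compatible c d" "p \<in> dom_of c" "p \<in> dom_of d"
  shows "(transition c d has_derivative fd (transition c d) (coord c p)) (at (coord c p))"
  using C_inf_has_derivative[OF compatible_smooth[OF assms(1)]] assms(2,3) by blast

lemma linear_fd_transition:
  assumes "compatible c d" "p \<in> dom_of c" "p \<in> dom_of d"
  shows "linear (fd (transition c d) (coord c p))"
  using transition_has_derivative[OF assms] by (rule has_derivative_linear)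

text \<open>Formulated for charts outside any fixed atlas, because its consequence
  \<open>fd_transition_inverse\<close> is also applied to slice charts, which belong to
  \<open>maximal_atlas\<close> only.\<close>

lemma fd_transition_chain:
  assumes ch: "is_chart c" "is_chart d" and comp: "compatible c d" "compatible d e"
    and p: "p \<in> dom_of c" "p \<in> dom_of d" "p \<in> dom_of e" and op: "open (dom_of d \<inter> dom_of e)"
  shows "fd (transition c e) (coord c p) v
    = fd (transition d e) (coord d p) (fd (transition c d) (coord c p) v)"
proof -
  let ?X = "coord c ` (dom_of c \<inter> (dom_of d \<inter> dom_of e))"
  have "fd (transition c e) (coord c p) = fd (\<lambda>x. transition d e (transition c d x)) (coord c p)"
  proof (rule fd_cong_open[of ?X])
    show "open ?X" by (rule open_overlap[OF ch(1) op])
    show "coord c p \<in> ?X" using p by auto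
    show "transition c e y = transition d e (transition c d y)" if "y \<in> ?X" for y
      using that by (auto simp: transition_coord ch)
  qed
  also have "\<dots> = (\<lambda>v. fd (transition d e) (coord d p) (fd (transition c d) (coord c p) v))"
  proof (rule fd_eqI)
    have "(transition d e has_derivative fd (transition d e) (coord d p)) (at (transition c d (coord c p)))"
      using transition_has_derivative[OF comp(2) p(2,3)] by (simp add: transition_coord ch p)
    from has_derivative_compose[OF transition_has_derivative[OF comp(1) p(1,2)] this]
    show "((\<lambda>x. transition d e (transition c d x)) has_derivative
        (\<lambda>v. fd (transition d e) (coord d p) (fd (transition c d) (coord c p) v))) (at (coord c p))" .
  qed
  finally show ?thesis by simp
qed

lemma fd_transition_self:
  assumes ch: "is_chart c" and p: "p \<in> dom_of c"
  shows "fd (transition c c) (coord c p) v = v"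
proof -
  have "fd (transition c c) (coord c p) = fd (\<lambda>x. x) (coord c p)"
    by (rule fd_cong_open[of "coord c ` dom_of c"]) (use ch p in \<open>auto simp: is_chart_def transition_def chart_inv_left\<close>)
  also have "\<dots> = (\<lambda>x. x)" by (rule fd_eqI) (rule has_derivative_ident)
  finally show ?thesis by simp
qed

lemma fd_transition_inverse:
  assumes ch: "is_chart c" "is_chart d" and comp: "compatible c d" "compatible d c"
    and p: "p \<in> dom_of c" "p \<in> dom_of d"
  shows "fd (transition d c) (coord d p) (fd (transition c d) (coord c p) v) = v"
proof -
  have "open (dom_of d \<inter> dom_of c)" using ch by (auto simp: is_chart_def)
  from fd_transition_chain[OF ch comp p(1,2,1) this] show ?thesis
    by (simp add: fd_transition_self ch p)
qed

section \<open>The coordinate theory applied to the charts of a semi-Riemannian manifold\<close>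

locale semi_riemannian_manifold =
  fixes A :: "('m::{t2_space, second_countable_topology}, 'e::euclidean_space) chart set"
    and g :: "'m \<Rightarrow> 'e \<Rightarrow> 'e \<Rightarrow> real"
  assumes semi_riemannian: "semi_riemannian A g"
begin

lemma chart: "c \<in> A \<Longrightarrow> is_chart c" and compat: "c \<in> A \<Longrightarrow> d \<in> A \<Longrightarrow> compatible c d"
  using semi_riemannian by (auto simp: semi_riemannian_def smooth_atlas_def)

lemma open_dom: "c \<in> A \<Longrightarrow> open (dom_of c)"
  using chart by (auto simp: is_chart_def)

lemma chart_at: "chart_at A p \<in> A" "p \<in> dom_of (chart_at A p)"
proof -
  have "p \<in> (\<Union>c\<in>A. dom_of c)"
    using semi_riemannian unfolding semi_riemannian_def smooth_atlas_def by blast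
  then have "\<exists>c. c \<in> A \<and> p \<in> dom_of c" by blast
  from someI_ex[OF this] show "chart_at A p \<in> A" "p \<in> dom_of (chart_at A p)"
    unfolding chart_at_def by auto
qed

lemma bilinear_g: "bilinear (g p)" and sym_g: "g p u v = g p v u"
  and nondeg_g: "nondegenerate_on (g p) UNIV"
  using semi_riemannian by (auto simp: semi_riemannian_def)

lemma linear_to_chart: "c \<in> A \<Longrightarrow> p \<in> dom_of c \<Longrightarrow> linear (to_chart A c p)"
  unfolding to_chart_def by (intro linear_fd_transition compat chart_at)

lemma linear_from_chart: "c \<in> A \<Longrightarrow> p \<in> dom_of c \<Longrightarrow> linear (from_chart A c p)"
  unfolding from_chart_def by (intro linear_fd_transition compat chart_at)

lemma from_to: "c \<in> A \<Longrightarrow> p \<in> dom_of c \<Longrightarrow> from_chart A c p (to_chart A c p v) = v"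
  and to_from: "c \<in> A \<Longrightarrow> p \<in> dom_of c \<Longrightarrow> to_chart A c p (from_chart A c p v) = v"
  unfolding from_chart_def to_chart_def by (intro fd_transition_inverse chart chart_at compat; simp)+

lemma to_chart_change:
  assumes "c \<in> A" "d \<in> A" "p \<in> dom_of c" "p \<in> dom_of d"
  shows "to_chart A d p v = fd (transition c d) (coord c p) (to_chart A c p v)"
  unfolding to_chart_def
  by (rule fd_transition_chain) (use assms in \<open>auto intro: chart compat chart_at open_dom\<close>)

lemma to_chart_self: "to_chart A (chart_at A p) p v = v"
  unfolding to_chart_def by (intro fd_transition_self chart chart_at)

lemma metric_to_chart:
  "c \<in> A \<Longrightarrow> p \<in> dom_of c \<Longrightarrow> metric_in_chart A g c (coord c p) (to_chart A c p u) (to_chart A c p v) = g p u v"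
  by (simp add: metric_in_chart_def chart_inv_left chart from_to)

lemma coord_metric:
  assumes c: "c \<in> A" shows "coord_metric (coord c ` dom_of c) (metric_in_chart A g c)"
proof
  show "open (coord c ` dom_of c)" using chart[OF c] by (simp add: is_chart_def)
  show "C_infinity_on (coord c ` dom_of c) (\<lambda>x. metric_in_chart A g c x u v)" for u v
    using semi_riemannian c by (auto simp: semi_riemannian_def)
  fix x assume "x \<in> coord c ` dom_of c"
  then obtain p where p: "p \<in> dom_of c" "x = coord c p" by auto
  have G: "metric_in_chart A g c x = (\<lambda>u v. g p (from_chart A c p u) (from_chart A c p v))"
    by (simp add: metric_in_chart_def[abs_def] p chart_inv_left chart c)
  have l: "linear (from_chart A c p)" by (rule linear_from_chart[OF c p(1)])
  have g1: "linear (\<lambda>u. g p u v)" and g2: "linear (g p v)" for v using bilinear_g by (auto simp: bilinear_def)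
  show "bilinear (metric_in_chart A g c x)"
    unfolding G bilinear_def using linear_compose[OF l g1] linear_compose[OF l g2] by (auto simp: o_def)
  show "metric_in_chart A g c x u v = metric_in_chart A g c x v u" for u v
    unfolding G by (rule sym_g)
  show "nondegenerate_on (metric_in_chart A g c x) UNIV"
    unfolding nondegenerate_on_def G
  proof (intro ballI impI)
    fix u assume z: "\<forall>v\<in>UNIV. g p (from_chart A c p u) (from_chart A c p v) = 0"
    have "g p (from_chart A c p u) v = 0" for v
      using z[rule_format, of "to_chart A c p v"] by (simp add: from_to c p)
    then have "from_chart A c p u = 0" using nondeg_g by (auto simp: nondegenerate_on_def)
    then have "to_chart A c p (from_chart A c p u) = to_chart A c p 0" by simp
    then show "u = 0" by (simp add: to_from c p linear_0[OF linear_to_chart[OF c p(1)]])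
  qed
qed

lemma coord_change:
  assumes c: "c \<in> A" and d: "d \<in> A"
  shows "coord_change (coord c ` dom_of c) (metric_in_chart A g c) (coord d ` dom_of d) (metric_in_chart A g d)
    (coord c ` (dom_of c \<inter> dom_of d)) (transition c d)"
proof -
  interpret M: coord_metric "coord c ` dom_of c" "metric_in_chart A g c" by (rule coord_metric[OF c])
  interpret N: coord_metric "coord d ` dom_of d" "metric_in_chart A g d" by (rule coord_metric[OF d])
  show ?thesis
  proof unfold_locales
    show "open (coord c ` (dom_of c \<inter> dom_of d))" by (intro open_overlap chart c open_dom d)
    show "transition c d ` coord c ` (dom_of c \<inter> dom_of d) \<subseteq> coord d ` dom_of d"
      by (auto simp: transition_coord chart c)
    show "C_infinity_on (coord c ` (dom_of c \<inter> dom_of d)) (transition c d)"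
      by (intro compatible_smooth compat c d)
    fix x u v assume "x \<in> coord c ` (dom_of c \<inter> dom_of d)"
    then obtain p where p: "p \<in> dom_of c" "p \<in> dom_of d" "x = coord c p" by auto
    have to: "w = to_chart A c p (from_chart A c p w)" for w by (simp add: to_from c p)
    have tr: "transition c d x = coord d p" by (simp add: p transition_coord chart c)
    have "metric_in_chart A g c x u v = g p (from_chart A c p u) (from_chart A c p v)"
      using metric_to_chart[OF c p(1), of "from_chart A c p u" "from_chart A c p v"] p to by simp
    also have "\<dots> = metric_in_chart A g d (transition c d x) (to_chart A d p (from_chart A c p u)) (to_chart A d p (from_chart A c p v))"
      unfolding tr by (rule metric_to_chart[OF d p(2), symmetric])
    finally show "metric_in_chart A g c x u v
        = metric_in_chart A g d (transition c d x) (fd (transition c d) x u) (fd (transition c d) x v)"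
      unfolding to_chart_change[OF c d p(1,2)] to[symmetric] p(3)[symmetric] .
  qed auto
qed

abbreviation chr :: "('m, 'e) chart \<Rightarrow> 'e \<Rightarrow> 'e \<Rightarrow> 'e \<Rightarrow> 'e" where
  "chr c \<equiv> coord_metric.chr (metric_in_chart A g c)"

abbreviation riem :: "('m, 'e) chart \<Rightarrow> 'e \<Rightarrow> 'e \<Rightarrow> 'e \<Rightarrow> 'e \<Rightarrow> 'e" where
  "riem c \<equiv> coord_metric.riem (metric_in_chart A g c)"

lemma christoffel_eq: "c \<in> A \<Longrightarrow> christoffel A g c = chr c"
  by (intro ext) (simp add: christoffel_def coord_metric.chr_def[OF coord_metric] coord_metric.koszul_def[OF coord_metric])

text \<open>\<open>curvature\<close> is computed in the preferred chart of each point, which jumps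
  along a curve; tensoriality moves it into one chart around the point, where continuity can be
  discussed.\<close>

lemma curvature_to_chart:
  assumes c: "c \<in> A" and p: "p \<in> dom_of c"
  shows "to_chart A c p (curvature A g p u v w)
    = riem c (coord c p) (to_chart A c p u) (to_chart A c p v) (to_chart A c p w)"
proof -
  let ?c = "chart_at A p"
  interpret M: coord_metric "coord ?c ` dom_of ?c" "metric_in_chart A g ?c" by (rule coord_metric[OF chart_at(1)])
  interpret T: coord_change "coord ?c ` dom_of ?c" "metric_in_chart A g ?c" "coord c ` dom_of c" "metric_in_chart A g c"
    "coord ?c ` (dom_of ?c \<inter> dom_of c)" "transition ?c c" by (rule coord_change[OF chart_at(1) c])
  have x: "coord ?c p \<in> coord ?c ` (dom_of ?c \<inter> dom_of c)" using chart_at(2) p by auto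
  then have xM: "coord ?c p \<in> coord ?c ` dom_of ?c" by auto
  \<comment> \<open>Constant fields have zero derivative and zero bracket, so the iterated covariant
    derivatives collapse to \<open>riem\<close>.\<close>
  have "curvature A g p u v w = riem ?c (coord ?c p) u v w"
    unfolding curvature_def curvature_in_chart_def nabla_in_chart_def bracket_in_chart_def
      christoffel_eq[OF chart_at(1)] M.riem_def
    using linear_0[OF M.linear_chr_left[OF xM]] by (simp add: frechet_derivative_const)
  then show ?thesis
    using T.riem_change[OF x, of u v w] unfolding to_chart_def
    by (simp add: transition_coord chart chart_at)
qed

end

subsection \<open>Parallel transport along a geodesic\<close>

lemma linear_has_vector_derivative:
  fixes L :: "'a::euclidean_space \<Rightarrow> 'b::real_normed_vector"
  assumes "linear L" "(f has_vector_derivative f') F"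
  shows "((\<lambda>t. L (f t)) has_vector_derivative L f') F"
  using bounded_linear.has_vector_derivative[of L] assms linear_conv_bounded_linear by blast

lemma has_vector_derivative_Un:
  assumes "(f has_vector_derivative d) (at x within S)" "(f has_vector_derivative d) (at x within T)"
  shows "(f has_vector_derivative d) (at x within (S \<union> T))"
  using assms unfolding has_vector_derivative_def has_derivative_within
  by (simp add: at_within_union filterlim_sup)

locale geodesic_segment = semi_riemannian_manifold A g
  for A :: "('m::{t2_space, second_countable_topology}, 'e::euclidean_space) chart set" and g +
  fixes a b :: real and \<gamma> :: "real \<Rightarrow> 'm"
  assumes ab: "a < b" and geod: "geodesic A g a b \<gamma>"
begin

abbreviation vel :: "real \<Rightarrow> 'e" where "vel \<equiv> velocity A a b \<gamma>"

abbreviation to\<gamma> :: "('m, 'e) chart \<Rightarrow> real \<Rightarrow> 'e \<Rightarrow> 'e" where "to\<gamma> c t \<equiv> to_chart A c (\<gamma> t)"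

lemma cont_\<gamma>: "continuous_on {a..b} \<gamma>" using geod by (simp add: geodesic_def)

lemma eventually_dom:
  assumes "c \<in> A" "t \<in> {a..b}" "\<gamma> t \<in> dom_of c" "I \<subseteq> {a..b}"
  shows "\<forall>\<^sub>F s in at t within I. \<gamma> s \<in> dom_of c"
proof -
  have "(\<gamma> \<longlongrightarrow> \<gamma> t) (at t within {a..b})" using cont_\<gamma> assms(2) by (simp add: continuous_on_def)
  then have "(\<gamma> \<longlongrightarrow> \<gamma> t) (at t within I)" by (rule tendsto_within_subset) (rule assms(4))
  then show ?thesis using open_dom[OF assms(1)] assms(3) by (rule topological_tendstoD)
qed

text \<open>The chart used in \<open>velocity\<close> depends on \<open>t\<close>; the chain rule
  through the transition map replaces it by any chart around the point.\<close>

lemma coord_\<gamma>_deriv: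
  assumes c: "c \<in> A" and t: "t \<in> {a..b}" and dom: "\<gamma> t \<in> dom_of c"
  shows "((\<lambda>s. coord c (\<gamma> s)) has_vector_derivative to\<gamma> c t (vel t)) (at t within {a..b})"
proof -
  let ?c = "chart_at A (\<gamma> t)"
  have "(coord ?c \<circ> \<gamma>) differentiable (at t within {a..b})" using geod t by (simp add: geodesic_def)
  then have "((\<lambda>s. coord ?c (\<gamma> s)) has_derivative (\<lambda>h. h *\<^sub>R vel t)) (at t within {a..b})"
    unfolding velocity_def by (simp add: vector_derivative_works o_def has_vector_derivative_def)
  from has_derivative_compose[OF this transition_has_derivative[OF compat[OF chart_at(1) c] chart_at(2) dom]]
  have "((\<lambda>s. transition ?c c (coord ?c (\<gamma> s))) has_vector_derivative to\<gamma> c t (vel t)) (at t within {a..b})"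
    by (simp add: has_vector_derivative_def to_chart_def
      linear_cmul[OF linear_fd_transition[OF compat[OF chart_at(1) c] chart_at(2) dom]])
  moreover have "\<forall>\<^sub>F s in at t within {a..b}. transition ?c c (coord ?c (\<gamma> s)) = coord c (\<gamma> s)"
    using eventually_dom[OF chart_at(1) t chart_at(2) order_refl]
    by eventually_elim (simp add: transition_coord chart chart_at)
  ultimately show ?thesis
    unfolding has_vector_derivative_def
    by (rule has_derivative_transform_eventually) (use t in \<open>simp_all add: transition_coord chart chart_at\<close>)
qed

text \<open>\<open>has_cov_deriv\<close> in a single chart and relative to a set \<open>I\<close>: a
  single chart makes it checkable, and \<open>I\<close> admits the subintervals on which parallel
  fields are first constructed.\<close>

definition cov :: "('m, 'e) chart \<Rightarrow> real set \<Rightarrow> (real \<Rightarrow> 'e) \<Rightarrow> 'e \<Rightarrow> real \<Rightarrow> bool" where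
  "cov c I V w t \<longleftrightarrow> ((\<lambda>s. to\<gamma> c s (V s)) has_vector_derivative
     (to\<gamma> c t w - chr c (coord c (\<gamma> t)) (to\<gamma> c t (vel t)) (to\<gamma> c t (V t)))) (at t within I)"

lemma has_cov_deriv_iff_all:
  "has_cov_deriv A g a b \<gamma> V w t \<longleftrightarrow> (\<forall>c\<in>A. \<gamma> t \<in> dom_of c \<longrightarrow> cov c {a..b} V w t)"
  unfolding has_cov_deriv_def cov_def using christoffel_eq by auto

text \<open>The product rule produces a second derivative of the transition map, exactly the
  inhomogeneous term of \<open>chr_change\<close>; so one chart is enough to verify
  \<open>has_cov_deriv\<close>.\<close>

lemma cov_change:
  assumes c: "c \<in> A" and d: "d \<in> A" and dom: "\<gamma> t \<in> dom_of c" "\<gamma> t \<in> dom_of d"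
    and I: "I \<subseteq> {a..b}" and t: "t \<in> I" and V: "cov c I V w t"
  shows "cov d I V w t"
proof -
  interpret T: coord_change "coord c ` dom_of c" "metric_in_chart A g c" "coord d ` dom_of d" "metric_in_chart A g d"
    "coord c ` (dom_of c \<inter> dom_of d)" "transition c d" by (rule coord_change[OF c d])
  let ?T = "transition c d" and ?x = "coord c (\<gamma> t)"
  let ?v = "to\<gamma> c t (vel t)" and ?V = "to\<gamma> c t (V t)"
  have tab: "t \<in> {a..b}" using I t by auto
  have x: "?x \<in> coord c ` (dom_of c \<inter> dom_of d)" using dom by auto
  have "((\<lambda>s. fd ?T (coord c (\<gamma> s)) (to\<gamma> c s (V s))) has_derivative
     (\<lambda>h. fd (\<lambda>y. fd ?T y ?V) ?x (h *\<^sub>R ?v) + fd ?T ?x (h *\<^sub>R (to\<gamma> c t w - chr c ?x ?v ?V)))) (at t within I)"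
  proof (rule has_derivative_linear_chain[where x="\<lambda>s. coord c (\<gamma> s)" and L="fd ?T" and X="coord c ` (dom_of c \<inter> dom_of d)"])
    show "((\<lambda>s. coord c (\<gamma> s)) has_derivative (\<lambda>h. h *\<^sub>R ?v)) (at t within I)"
      using has_vector_derivative_within_subset[OF coord_\<gamma>_deriv[OF c tab dom(1)] I]
      by (simp add: has_vector_derivative_def)
    show "((\<lambda>s. to\<gamma> c s (V s)) has_derivative (\<lambda>h. h *\<^sub>R (to\<gamma> c t w - chr c ?x ?v ?V))) (at t within I)"
      using V by (simp add: cov_def has_vector_derivative_def)
  qed (use x t T.D T.linear_fd\<Phi> C_inf_differentiable[OF C_inf_fd[OF T.smooth]] in auto)
  moreover have "fd (\<lambda>y. fd ?T y ?V) ?x (h *\<^sub>R ?v) + fd ?T ?x (h *\<^sub>R (to\<gamma> c t w - chr c ?x ?v ?V))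
     = h *\<^sub>R (to\<gamma> d t w - chr d (coord d (\<gamma> t)) (to\<gamma> d t (vel t)) (to\<gamma> d t (V t)))" for h
  proof -
    have l: "linear (fd (\<lambda>y. fd ?T y ?V) ?x)"
      by (intro linear_fd C_inf_differentiable[OF C_inf_fd[OF T.smooth] x])
    have tr: "coord d (\<gamma> t) = ?T ?x" by (simp add: transition_coord chart c dom)
    show ?thesis
      unfolding to_chart_change[OF c d dom] tr T.chr_change[OF x]
        linear_cmul[OF l] linear_cmul[OF T.linear_fd\<Phi>[OF x]] linear_diff[OF T.linear_fd\<Phi>[OF x]]
      by (simp add: algebra_simps)
  qed
  ultimately have *: "((\<lambda>s. fd ?T (coord c (\<gamma> s)) (to\<gamma> c s (V s))) has_derivative
     (\<lambda>h. h *\<^sub>R (to\<gamma> d t w - chr d (coord d (\<gamma> t)) (to\<gamma> d t (vel t)) (to\<gamma> d t (V t))))) (at t within I)"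
    by simp
  show ?thesis unfolding cov_def has_vector_derivative_def
  proof (rule has_derivative_transform_eventually[OF *])
    show "\<forall>\<^sub>F s in at t within I. fd ?T (coord c (\<gamma> s)) (to\<gamma> c s (V s)) = to\<gamma> d s (V s)"
      using eventually_dom[OF c tab dom(1) I] eventually_dom[OF d tab dom(2) I]
      by eventually_elim (rule to_chart_change[OF c d, symmetric])
  qed (simp_all add: to_chart_change[OF c d dom, symmetric] t)
qed

lemma has_cov_deriv_iff:
  assumes "c \<in> A" "t \<in> {a..b}" "\<gamma> t \<in> dom_of c"
  shows "has_cov_deriv A g a b \<gamma> V w t \<longleftrightarrow> cov c {a..b} V w t"
  unfolding has_cov_deriv_iff_all using cov_change[OF assms(1) _ assms(3) _ order_refl assms(2)] assms by blast

text \<open>In a chart, \<open>metric_compat\<close> makes the derivative of the coefficients of the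
  metric cancel the Christoffel terms of both fields.\<close>

lemma metric_deriv:
  assumes V: "has_cov_deriv A g a b \<gamma> V v t" and W: "has_cov_deriv A g a b \<gamma> W w t" and t: "t \<in> {a..b}"
  shows "((\<lambda>s. g (\<gamma> s) (V s) (W s)) has_vector_derivative g (\<gamma> t) v (W t) + g (\<gamma> t) (V t) w) (at t within {a..b})"
proof -
  define c where "c = chart_at A (\<gamma> t)"
  have c: "c \<in> A" and dom: "\<gamma> t \<in> dom_of c" by (simp_all add: c_def chart_at)
  interpret M: coord_metric "coord c ` dom_of c" "metric_in_chart A g c" by (rule coord_metric[OF c])
  let ?G = "metric_in_chart A g c" and ?x = "coord c (\<gamma> t)"
  let ?u = "to\<gamma> c t (vel t)" and ?V = "to\<gamma> c t (V t)" and ?W = "to\<gamma> c t (W t)"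
  let ?V' = "to\<gamma> c t v - chr c ?x ?u ?V" and ?W' = "to\<gamma> c t w - chr c ?x ?u ?W"
  have x: "?x \<in> coord c ` dom_of c" using dom by auto
  have "((\<lambda>s. ?G (coord c (\<gamma> s)) (to\<gamma> c s (V s)) (to\<gamma> c s (W s))) has_derivative
     (\<lambda>h. fd (\<lambda>y. ?G y ?V ?W) ?x (h *\<^sub>R ?u) + ?G ?x (h *\<^sub>R ?V') ?W + ?G ?x ?V (h *\<^sub>R ?W'))) (at t within {a..b})"
    by (rule has_derivative_bilinear_chain[where x="\<lambda>s. coord c (\<gamma> s)" and X="coord c ` dom_of c"])
      (use M.X x M.bil M.dG t coord_\<gamma>_deriv[OF c t dom] V W has_cov_deriv_iff[OF c t dom]
        in \<open>auto simp: has_vector_derivative_def cov_def\<close>)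
  moreover have "fd (\<lambda>y. ?G y ?V ?W) ?x (h *\<^sub>R ?u) + ?G ?x (h *\<^sub>R ?V') ?W + ?G ?x ?V (h *\<^sub>R ?W')
     = h *\<^sub>R (g (\<gamma> t) v (W t) + g (\<gamma> t) (V t) w)" for h
    unfolding linear_cmul[OF M.linear_dG(1)[OF x]] M.metric_compat[OF x]
    by (simp add: linear_cmul[OF M.linear_chr_left[OF x]] linear_cmul[OF M.linear_left[OF x]] linear_cmul[OF M.linear_right[OF x]] linear_diff[OF M.linear_left[OF x]]
        linear_diff[OF M.linear_right[OF x]] metric_to_chart[OF c dom] algebra_simps)
  ultimately have *: "((\<lambda>s. ?G (coord c (\<gamma> s)) (to\<gamma> c s (V s)) (to\<gamma> c s (W s))) has_derivative
     (\<lambda>h. h *\<^sub>R (g (\<gamma> t) v (W t) + g (\<gamma> t) (V t) w))) (at t within {a..b})" by simp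
  show ?thesis unfolding has_vector_derivative_def
  proof (rule has_derivative_transform_eventually[OF *])
    show "\<forall>\<^sub>F s in at t within {a..b}.
        ?G (coord c (\<gamma> s)) (to\<gamma> c s (V s)) (to\<gamma> c s (W s)) = g (\<gamma> s) (V s) (W s)"
      using eventually_dom[OF c t dom order_refl] by eventually_elim (rule metric_to_chart[OF c])
  qed (use t in \<open>simp_all add: metric_to_chart c dom\<close>)
qed

lemma chart_interval:
  assumes x: "x \<in> {a..b}"
  obtains d where "d > 0" "\<And>s. s \<in> {a..b} \<Longrightarrow> dist s x < d \<Longrightarrow> \<gamma> s \<in> dom_of (chart_at A (\<gamma> x))"
proof -
  obtain d where "d > 0" "\<And>s. s \<in> {a..b} \<Longrightarrow> s \<noteq> x \<Longrightarrow> dist s x < d \<Longrightarrow> \<gamma> s \<in> dom_of (chart_at A (\<gamma> x))"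
    using eventually_dom[OF chart_at(1) x chart_at(2) order_refl] unfolding eventually_at by blast
  then show ?thesis using that[of d] chart_at(2) by metis
qed

lemma continuous_in_chart:
  assumes c: "c \<in> A" and I: "I \<subseteq> {a..b}" "\<gamma> ` I \<subseteq> dom_of c"
  shows "continuous_on I (\<lambda>s. coord c (\<gamma> s))" "continuous_on I (\<lambda>s. to\<gamma> c s (vel s))"
proof -
  have d: "\<gamma> t \<in> dom_of c" "t \<in> {a..b}" if "t \<in> I" for t using I that by auto
  show "continuous_on I (\<lambda>s. coord c (\<gamma> s))"
    by (rule continuous_on_vector_derivative)
      (rule has_vector_derivative_within_subset[OF coord_\<gamma>_deriv[OF c] I(1)], use d in auto)
  have hc: "has_cov_deriv A g a b \<gamma> vel 0 t" if "t \<in> I" for t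
    using geod d(2)[OF that] unfolding geodesic_def by blast
  have "((\<lambda>s. to\<gamma> c s (vel s)) has_vector_derivative
     (to\<gamma> c t 0 - chr c (coord c (\<gamma> t)) (to\<gamma> c t (vel t)) (to\<gamma> c t (vel t)))) (at t within I)" if "t \<in> I" for t
    using hc[OF that] unfolding has_cov_deriv_iff[OF c d(2)[OF that] d(1)[OF that]] cov_def
    by (rule has_vector_derivative_within_subset) (rule I(1))
  then show "continuous_on I (\<lambda>s. to\<gamma> c s (vel s))" by (rule continuous_on_vector_derivative)
qed

definition parallel_on :: "real set \<Rightarrow> (real \<Rightarrow> 'e) \<Rightarrow> bool" where
  "parallel_on I V \<longleftrightarrow> (\<forall>t\<in>I. \<forall>c\<in>A. \<gamma> t \<in> dom_of c \<longrightarrow> cov c I V 0 t)"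

lemma parallel_on_chart:
  assumes c: "c \<in> A" and st: "{s..t} \<subseteq> {a..b}" "s \<le> t" "\<gamma> ` {s..t} \<subseteq> dom_of c"
  obtains V where "V s = v" "parallel_on {s..t} V"
proof -
  interpret M: coord_metric "coord c ` dom_of c" "metric_in_chart A g c" by (rule coord_metric[OF c])
  have dom: "\<gamma> r \<in> dom_of c" if "r \<in> {s..t}" for r using st(3) that by blast
  note cc = continuous_in_chart[OF c st(1,3)]
  obtain z where z: "z s = to\<gamma> c s v" "\<And>r. r \<in> {s..t} \<Longrightarrow>
      (z has_vector_derivative - chr c (coord c (\<gamma> r)) (to\<gamma> c r (vel r)) (z r)) (at r within {s..t})"
  proof (rule linear_ode_exists[OF st(2), of "\<lambda>r v. - chr c (coord c (\<gamma> r)) (to\<gamma> c r (vel r)) v"])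
    show "linear (\<lambda>v. - chr c (coord c (\<gamma> r)) (to\<gamma> c r (vel r)) v)" if "r \<in> {s..t}" for r
      using M.linear_chr_right dom[OF that] by (intro linear_compose_neg) auto
    show "continuous_on {s..t} (\<lambda>r. - chr c (coord c (\<gamma> r)) (to\<gamma> c r (vel r)) x)" for x
      using dom by (intro continuous_on_minus M.continuous_chr_along cc continuous_on_const) auto
  qed (use that in blast)
  define V where "V r = from_chart A c (\<gamma> r) (z r)" for r
  have Vz: "to\<gamma> c r (V r) = z r" if "r \<in> {s..t}" for r
    unfolding V_def by (rule to_from[OF c dom[OF that]])
  have "cov c {s..t} V 0 r" if r: "r \<in> {s..t}" for r
    unfolding cov_def
  proof (rule has_vector_derivative_transform[OF r Vz])
    show "(z has_vector_derivative to\<gamma> c r 0 - chr c (coord c (\<gamma> r)) (to\<gamma> c r (vel r)) (to\<gamma> c r (V r))) (at r within {s..t})"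
      using z(2)[OF r] Vz[OF r] linear_0[OF linear_to_chart[OF c dom[OF r]]] by simp
  qed
  then have "parallel_on {s..t} V"
    unfolding parallel_on_def using cov_change[OF c _ dom _ st(1)] by blast
  moreover have "V s = v"
    unfolding V_def z(1) using dom st(2) by (intro from_to[OF c]) auto
  ultimately show ?thesis using that by blast
qed

text \<open>At the junction the one-sided derivatives agree because the equation prescribes them
  from the common value alone.\<close>

lemma parallel_on_join:
  assumes U: "parallel_on {r..s} U" and V: "parallel_on {s..t} V" and eq: "U s = V s" and rst: "r \<le> s" "s \<le> t"
  shows "parallel_on {r..t} (\<lambda>x. if x \<le> s then U x else V x)"
  unfolding parallel_on_def
proof (intro ballI impI)
  fix x c assume x: "x \<in> {r..t}" and c: "c \<in> A" "\<gamma> x \<in> dom_of c"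
  let ?W = "\<lambda>x. if x \<le> s then U x else V x"
  let ?w = "to\<gamma> c x 0 - chr c (coord c (\<gamma> x)) (to\<gamma> c x (vel x)) (to\<gamma> c x (?W x))"
  have 1: "((\<lambda>y. to\<gamma> c y (?W y)) has_vector_derivative ?w) (at x within {r..s})" if "x \<in> {r..s}"
  proof (rule has_vector_derivative_transform[OF that, of _ "\<lambda>y. to\<gamma> c y (U y)"])
    show "((\<lambda>y. to\<gamma> c y (U y)) has_vector_derivative ?w) (at x within {r..s})"
      using U that c unfolding parallel_on_def cov_def by auto
  qed auto
  have 2: "((\<lambda>y. to\<gamma> c y (?W y)) has_vector_derivative ?w) (at x within {s..t})" if "x \<in> {s..t}"
  proof (rule has_vector_derivative_transform[OF that, of _ "\<lambda>y. to\<gamma> c y (V y)"])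
    show "((\<lambda>y. to\<gamma> c y (V y)) has_vector_derivative ?w) (at x within {s..t})"
      using V that c eq unfolding parallel_on_def cov_def by (cases "x = s") auto
  qed (use eq in \<open>auto simp: order_antisym\<close>)
  show "cov c {r..t} ?W 0 x" unfolding cov_def
  proof -
    consider "x < s" | "x = s" | "x > s" by linarith
    then show "((\<lambda>y. to\<gamma> c y (?W y)) has_vector_derivative ?w) (at x within {r..t})"
    proof cases
      case 1
      have "at x within {r..t} = at x within {r..s}"
        by (rule at_within_nhd[of _ "{..<s}"]) (use 1 rst in auto)
      then show ?thesis using \<open>x \<in> {r..s} \<Longrightarrow> _\<close> 1 x by simp
    next
      case 2
      have "{r..t} = {r..s} \<union> {s..t}" using rst by auto
      then show ?thesis
        using has_vector_derivative_Un[OF \<open>x \<in> {r..s} \<Longrightarrow> _\<close> \<open>x \<in> {s..t} \<Longrightarrow> _\<close>] 2 rst by simp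
    next
      case 3
      have "at x within {r..t} = at x within {s..t}"
        by (rule at_within_nhd[of _ "{s<..}"]) (use 3 rst in auto)
      then show ?thesis using \<open>x \<in> {s..t} \<Longrightarrow> _\<close> 3 x by simp
    qed
  qed
qed

text \<open>Bisection of the interval: short pieces lie in one chart, and adjacent pieces are glued.
  The initial vector is quantified inside the induction because the right piece starts at the value
  reached by the left one.\<close>

lemma parallel_exists: "\<exists>V. V a = v \<and> parallel_on {a..b} V"
proof -
  have "a \<le> b" using ab by simp
  then have "a \<le> a \<and> b \<le> b \<and> a \<le> b \<longrightarrow> (\<forall>v. \<exists>V. V a = v \<and> parallel_on {a..b} V)"
  proof (induction rule: Bolzano[where P="\<lambda>s t. a \<le> s \<and> t \<le> b \<and> s \<le> t \<longrightarrow> (\<forall>v. \<exists>V. V s = v \<and> parallel_on {s..t} V)"])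
    case (trans r s t)
    show ?case
    proof (intro impI allI)
      fix v assume rt: "a \<le> r \<and> t \<le> b \<and> r \<le> t"
      obtain U where U: "U r = v" "parallel_on {r..s} U" using trans rt by force
      obtain V where V: "V s = U s" "parallel_on {s..t} V" using trans rt by force
      from parallel_on_join[OF U(2) V(2) V(1)[symmetric]] trans U(1)
      show "\<exists>V. V r = v \<and> parallel_on {r..t} V"
        by (intro exI[of _ "\<lambda>x. if x \<le> s then U x else V x"]) auto
    qed
  next
    case (local x)
    then have x: "x \<in> {a..b}" by simp
    obtain d where d: "d > 0" "\<And>s. s \<in> {a..b} \<Longrightarrow> dist s x < d \<Longrightarrow> \<gamma> s \<in> dom_of (chart_at A (\<gamma> x))"
      using chart_interval[OF x] by blast
    show ?case
    proof (intro exI[of _ d] conjI d(1) allI impI)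
      fix s t v assume st: "s \<le> x \<and> x \<le> t \<and> t - s < d" and ab': "a \<le> s \<and> t \<le> b \<and> s \<le> t"
      have "{s..t} \<subseteq> {a..b}" using ab' by auto
      moreover have "\<gamma> ` {s..t} \<subseteq> dom_of (chart_at A (\<gamma> x))"
        using st ab' by (auto intro!: d(2) simp: dist_real_def)
      ultimately show "\<exists>V. V s = v \<and> parallel_on {s..t} V"
        using parallel_on_chart[OF chart_at(1)] ab' by metis
    qed
  qed
  then show ?thesis using ab by simp
qed

definition E :: "'e \<Rightarrow> real \<Rightarrow> 'e" where
  "E v = (SOME V. V a = v \<and> parallel_on {a..b} V)"

lemma E: "E v a = v" "parallel_on {a..b} (E v)"
  using someI_ex[OF parallel_exists[of v]] unfolding E_def by auto

text \<open>Parallel transport from \<open>\<gamma> a\<close> to \<open>\<gamma> t\<close>,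
  assembled from the transports of the basis vectors so that linearity is built in.\<close>

definition frame :: "real \<Rightarrow> 'e \<Rightarrow> 'e" where
  "frame t y = (\<Sum>i\<in>Basis. (y \<bullet> i) *\<^sub>R E i t)"

lemma linear_frame: "linear (frame t)"
  by (rule linearI) (simp_all add: frame_def inner_add_left scaleR_add_left sum.distrib scaleR_sum_right)

lemma frame_a: "frame a y = y"
  by (simp add: frame_def E euclidean_representation)

lemma frame_cov:
  assumes t: "t \<in> {a..b}" and y: "(y has_vector_derivative y') (at t within {a..b})"
  shows "has_cov_deriv A g a b \<gamma> (\<lambda>s. frame s (y s)) (frame t y') t"
  unfolding has_cov_deriv_iff_all
proof (intro ballI impI)
  fix c assume c: "c \<in> A" and dom: "\<gamma> t \<in> dom_of c"
  interpret M: coord_metric "coord c ` dom_of c" "metric_in_chart A g c" by (rule coord_metric[OF c])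
  let ?x = "coord c (\<gamma> t)" and ?v = "to\<gamma> c t (vel t)"
  have x: "?x \<in> coord c ` dom_of c" using dom by auto
  note lt = linear_to_chart[OF c dom]
  have tof: "to\<gamma> c s (frame s z) = (\<Sum>i\<in>Basis. (z \<bullet> i) *\<^sub>R to\<gamma> c s (E i s))" if "\<gamma> s \<in> dom_of c" for s z
    unfolding frame_def using linear_to_chart[OF c that] by (simp add: linear_sum linear_cmul)
  have dE: "((\<lambda>s. to\<gamma> c s (E i s)) has_vector_derivative - chr c ?x ?v (to\<gamma> c t (E i t))) (at t within {a..b})" for i
    using E(2)[of i] t c dom linear_0[OF lt] unfolding parallel_on_def cov_def by force
  have "((\<lambda>s. \<Sum>i\<in>Basis. (y s \<bullet> i) *\<^sub>R to\<gamma> c s (E i s)) has_vector_derivative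
    (\<Sum>i\<in>Basis. (y t \<bullet> i) *\<^sub>R - chr c ?x ?v (to\<gamma> c t (E i t)) + (y' \<bullet> i) *\<^sub>R to\<gamma> c t (E i t))) (at t within {a..b})"
  proof (rule has_vector_derivative_sum)
    fix i :: 'e
    have "((\<lambda>s. y s \<bullet> i) has_real_derivative y' \<bullet> i) (at t within {a..b})"
      using has_derivative_inner_left[OF y[unfolded has_vector_derivative_def], of i]
      unfolding has_field_derivative_def by (rule has_derivative_eq_rhs) (simp add: fun_eq_iff)
    then show "((\<lambda>s. (y s \<bullet> i) *\<^sub>R to\<gamma> c s (E i s)) has_vector_derivative
      (y t \<bullet> i) *\<^sub>R - chr c ?x ?v (to\<gamma> c t (E i t)) + (y' \<bullet> i) *\<^sub>R to\<gamma> c t (E i t)) (at t within {a..b})"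
      by (rule has_vector_derivative_scaleR) (rule dE)
  qed
  also have "(\<Sum>i\<in>Basis. (y t \<bullet> i) *\<^sub>R - chr c ?x ?v (to\<gamma> c t (E i t)) + (y' \<bullet> i) *\<^sub>R to\<gamma> c t (E i t))
     = to\<gamma> c t (frame t y') - chr c ?x ?v (to\<gamma> c t (frame t (y t)))"
    by (simp add: tof[OF dom] linear_sum[OF M.linear_chr_right[OF x]] linear_cmul[OF M.linear_chr_right[OF x]] sum.distrib sum_negf sum_subtractf)
  finally have *: "((\<lambda>s. \<Sum>i\<in>Basis. (y s \<bullet> i) *\<^sub>R to\<gamma> c s (E i s)) has_vector_derivative \<dots>) (at t within {a..b})" .
  show "cov c {a..b} (\<lambda>s. frame s (y s)) (frame t y') t"
    unfolding cov_def has_vector_derivative_def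
  proof (rule has_derivative_transform_eventually[OF *[unfolded has_vector_derivative_def]])
    show "\<forall>\<^sub>F s in at t within {a..b}. (\<Sum>i\<in>Basis. (y s \<bullet> i) *\<^sub>R to\<gamma> c s (E i s)) = to\<gamma> c s (frame s (y s))"
      using eventually_dom[OF c t dom order_refl] by eventually_elim (rule tof[symmetric])
  qed (use tof[OF dom] t in auto)
qed

lemma frame_parallel: "t \<in> {a..b} \<Longrightarrow> has_cov_deriv A g a b \<gamma> (\<lambda>s. frame s y) 0 t"
  using frame_cov[of t "\<lambda>_. y" 0] by (simp add: linear_0[OF linear_frame])

lemma vel_parallel: "t \<in> {a..b} \<Longrightarrow> has_cov_deriv A g a b \<gamma> vel 0 t"
  using geod by (simp add: geodesic_def)

lemma g_simps:
  "g p 0 v = 0" "g p v 0 = 0" "g p (u + u') v = g p u v + g p u' v" "g p v (u + u') = g p v u + g p v u'"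
  "g p (r *\<^sub>R u) v = r * g p u v" "g p v (r *\<^sub>R u) = r * g p v u"
  "g p (u - u') v = g p u v - g p u' v" "g p v (u - u') = g p v u - g p v u'"
  using bilinear_g[of p] by (auto simp: bilinear_lzero bilinear_rzero bilinear_ladd bilinear_radd
      bilinear_lmul bilinear_rmul bilinear_lsub bilinear_rsub)

lemma parallel_product:
  assumes V: "\<And>t. t \<in> {a..b} \<Longrightarrow> has_cov_deriv A g a b \<gamma> V 0 t"
    and W: "\<And>t. t \<in> {a..b} \<Longrightarrow> has_cov_deriv A g a b \<gamma> W 0 t" and t: "t \<in> {a..b}"
  shows "g (\<gamma> t) (V t) (W t) = g (\<gamma> a) (V a) (W a)"
proof -
  have "\<exists>k. \<forall>t\<in>{a..b}. g (\<gamma> t) (V t) (W t) = k"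
  proof (rule has_vector_derivative_zero_constant)
    fix s assume s: "s \<in> {a..b}"
    show "((\<lambda>t. g (\<gamma> t) (V t) (W t)) has_vector_derivative 0) (at s within {a..b})"
      using metric_deriv[OF V[OF s] W[OF s] s] by (simp add: g_simps)
  qed auto
  then show ?thesis using t ab by auto
qed

lemma frame_isometry: "t \<in> {a..b} \<Longrightarrow> g (\<gamma> t) (frame t x) (frame t y) = g (\<gamma> a) x y"
  using parallel_product[OF frame_parallel frame_parallel, of t x y] by (simp add: frame_a)

lemma frame_inj: assumes t: "t \<in> {a..b}" shows "inj (frame t)"
  unfolding linear_injective_0[OF linear_frame]
proof (intro allI impI)
  fix x assume x: "frame t x = 0"
  have "g (\<gamma> a) x y = 0" for y using frame_isometry[OF t, of x y] x by (simp add: g_simps)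
  then show "x = 0" using nondeg_g unfolding nondegenerate_on_def by blast
qed

lemma frame_surj: assumes t: "t \<in> {a..b}" obtains y where "frame t y = v"
proof -
  from linear_injective_imp_surjective[OF linear_frame frame_inj[OF t]] have "surj (frame t)" by simp
  from surjD[OF this] obtain y where "v = frame t y" ..
  then show ?thesis using that by simp
qed

definition coframe :: "real \<Rightarrow> 'e \<Rightarrow> 'e" where "coframe t v = (THE y. frame t y = v)"

lemma coframe: assumes t: "t \<in> {a..b}" shows "coframe t (frame t y) = y" "frame t (coframe t v) = v"
proof -
  show 1: "coframe t (frame t y) = y" for y
    unfolding coframe_def using injD[OF frame_inj[OF t]] by (intro the_equality) auto
  obtain y where "frame t y = v" using frame_surj[OF t] by blast
  then show "frame t (coframe t v) = v" using 1 by auto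
qed

lemma g_ext: "(\<And>w. g p u w = g p v w) \<Longrightarrow> u = v"
proof -
  assume e: "\<And>w. g p u w = g p v w"
  have "\<forall>w\<in>UNIV. g p (u - v) w = 0" by (simp add: g_simps e)
  then have "u - v = 0" using nondeg_g[of p] unfolding nondegenerate_on_def by blast
  then show ?thesis by simp
qed

text \<open>The velocity of a geodesic is parallel. Its products with all parallel fields are
  therefore constant, as are those of \<open>frame t (vel a)\<close>, and nondegeneracy identifies
  the two.\<close>

lemma vel_frame: assumes t: "t \<in> {a..b}" shows "vel t = frame t (vel a)"
proof (rule g_ext[of "\<gamma> t"])
  fix w
  obtain y where y: "frame t y = w" using frame_surj[OF t] by blast
  show "g (\<gamma> t) (vel t) w = g (\<gamma> t) (frame t (vel a)) w"
    using parallel_product[OF vel_parallel frame_parallel t, of y] frame_isometry[OF t, of "vel a" y]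
    by (simp add: y frame_a)
qed

subsection \<open>The Jacobi equation in a parallel frame\<close>

definition curv :: "real \<Rightarrow> 'e \<Rightarrow> 'e" where
  "curv t v = curvature A g (\<gamma> t) (vel t) v (vel t)"

definition K :: "real \<Rightarrow> 'e \<Rightarrow> 'e" where "K t y = coframe t (curv t (frame t y))"

lemma curv_chart:
  assumes c: "c \<in> A" and dom: "\<gamma> t \<in> dom_of c"
  shows "g (\<gamma> t) (curv t v) w = metric_in_chart A g c (coord c (\<gamma> t))
    (riem c (coord c (\<gamma> t)) (to\<gamma> c t (vel t)) (to\<gamma> c t v) (to\<gamma> c t (vel t))) (to\<gamma> c t w)"
  unfolding metric_to_chart[OF c dom, symmetric] curv_def curvature_to_chart[OF c dom] ..

lemma curv_sym: "g (\<gamma> t) (curv t v) w = g (\<gamma> t) v (curv t w)"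
proof -
  note c = chart_at(1)[of "\<gamma> t"] and dom = chart_at(2)[of "\<gamma> t"]
  interpret M: coord_metric "coord (chart_at A (\<gamma> t)) ` dom_of (chart_at A (\<gamma> t))" "metric_in_chart A g (chart_at A (\<gamma> t))"
    by (rule coord_metric[OF c])
  show ?thesis
    unfolding sym_g[of "\<gamma> t" v] curv_chart[OF c dom] by (rule M.riem_pair_sym) (use dom in auto)
qed

lemma curv_vel: "curv t (vel t) = 0"
proof -
  note c = chart_at(1)[of "\<gamma> t"] and dom = chart_at(2)[of "\<gamma> t"]
  interpret M: coord_metric "coord (chart_at A (\<gamma> t)) ` dom_of (chart_at A (\<gamma> t))" "metric_in_chart A g (chart_at A (\<gamma> t))"
    by (rule coord_metric[OF c])
  show ?thesis
    using curvature_to_chart[OF c dom, of "vel t" "vel t" "vel t"]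
    by (simp add: curv_def to_chart_self M.riem_def)
qed

text \<open>Self-adjointness with respect to a nondegenerate form implies linearity.\<close>

lemma linear_curv: "linear (curv t)"
  by (rule linearI; rule g_ext[of "\<gamma> t"]) (simp_all add: curv_sym g_simps)

lemma K_g: "t \<in> {a..b} \<Longrightarrow> g (\<gamma> a) (K t y) z = g (\<gamma> t) (curv t (frame t y)) (frame t z)"
  unfolding K_def using frame_isometry[of t "coframe t (curv t (frame t y))" z] by (simp add: coframe)

text \<open>Lowering an index. Since it has a linear left inverse, a vector function is
  differentiable or continuous as soon as its products with fixed vectors are.\<close>

definition lower :: "'e \<Rightarrow> 'e" where "lower y = (\<Sum>i\<in>Basis. g (\<gamma> a) y i *\<^sub>R i)"

lemma lower_inverse: obtains h where "linear h" "\<And>y. h (lower y) = y"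
proof -
  have lin: "linear lower"
    by (rule linearI) (simp_all add: lower_def g_simps scaleR_add_left sum.distrib scaleR_sum_right)
  have "y = 0" if "lower y = 0" for y
  proof (rule g_ext[of "\<gamma> a"])
    fix w
    have b: "g (\<gamma> a) y i = 0" if "i \<in> Basis" for i
      using that arg_cong[OF \<open>lower y = 0\<close>, of "\<lambda>v. v \<bullet> i"]
      by (simp add: lower_def inner_sum_left inner_Basis if_distrib cong: if_cong)
    have "linear (g (\<gamma> a) y)" using bilinear_g by (auto simp: bilinear_def)
    from linear_expand[OF this, of w] show "g (\<gamma> a) y w = g (\<gamma> a) 0 w" by (simp add: b g_simps)
  qed
  then have "inj lower" using linear_injective_0[OF lin] by blast
  from linear_injective_left_inverse[OF lin this] obtain h where "linear h" "h \<circ> lower = id" by blast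
  then show ?thesis using that[of h] by (metis comp_apply id_apply)
qed

lemma frame_vector_derivative:
  assumes "\<And>z. ((\<lambda>t. g (\<gamma> a) (y t) z) has_vector_derivative g (\<gamma> a) y' z) F"
  shows "(y has_vector_derivative y') F"
proof -
  obtain h where h: "linear h" "\<And>y. h (lower y) = y" using lower_inverse by blast
  have "((\<lambda>t. g (\<gamma> a) (y t) i *\<^sub>R i) has_vector_derivative g (\<gamma> a) y' i *\<^sub>R i) F" for i
    by (rule linear_has_vector_derivative[where L="\<lambda>r. r *\<^sub>R i", OF _ assms]) (auto intro!: linearI simp: scaleR_add_left)
  then have "((\<lambda>t. lower (y t)) has_vector_derivative lower y') F"
    unfolding lower_def by (intro has_vector_derivative_sum)
  from linear_has_vector_derivative[OF h(1) this] show ?thesis by (simp add: h)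
qed

text \<open>Continuity is local, so near each parameter one chart suffices, in which all ingredients
  are continuous coordinate expressions.\<close>

lemma continuous_curv:
  assumes V: "\<And>t. t \<in> {a..b} \<Longrightarrow> has_cov_deriv A g a b \<gamma> V (V' t) t"
    and W: "\<And>t. t \<in> {a..b} \<Longrightarrow> has_cov_deriv A g a b \<gamma> W (W' t) t"
  shows "continuous_on {a..b} (\<lambda>t. g (\<gamma> t) (curv t (V t)) (W t))"
  unfolding continuous_on_def
proof
  fix x assume x: "x \<in> {a..b}"
  define c where "c = chart_at A (\<gamma> x)"
  have c: "c \<in> A" by (simp add: c_def chart_at)
  obtain d where d: "d > 0" "\<And>s. s \<in> {a..b} \<Longrightarrow> dist s x < d \<Longrightarrow> \<gamma> s \<in> dom_of c"
    using chart_interval[OF x] unfolding c_def by blast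
  define I where "I = {a..b} \<inter> ball x d"
  have I: "I \<subseteq> {a..b}" "\<gamma> ` I \<subseteq> dom_of c" using d by (auto simp: I_def dist_commute)
  interpret M: coord_metric "coord c ` dom_of c" "metric_in_chart A g c" by (rule coord_metric[OF c])
  note cc = continuous_in_chart[OF c I]
  have cV: "continuous_on I (\<lambda>t. to\<gamma> c t (Z t))"
    if Z: "\<And>t. t \<in> {a..b} \<Longrightarrow> has_cov_deriv A g a b \<gamma> Z (Z' t) t" for Z Z'
  proof (rule continuous_on_vector_derivative)
    fix t assume "t \<in> I"
    then have t: "t \<in> {a..b}" "\<gamma> t \<in> dom_of c" using I by auto
    show "((\<lambda>t. to\<gamma> c t (Z t)) has_vector_derivative
      (to\<gamma> c t (Z' t) - chr c (coord c (\<gamma> t)) (to\<gamma> c t (vel t)) (to\<gamma> c t (Z t)))) (at t within I)"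
      using Z[OF t(1)] unfolding has_cov_deriv_iff[OF c t] cov_def
      by (rule has_vector_derivative_within_subset) (rule I(1))
  qed
  have sub: "(\<lambda>s. coord c (\<gamma> s)) ` I \<subseteq> coord c ` dom_of c" using I by auto
  have "continuous_on I (\<lambda>t. metric_in_chart A g c (coord c (\<gamma> t))
    (riem c (coord c (\<gamma> t)) (to\<gamma> c t (vel t)) (to\<gamma> c t (V t)) (to\<gamma> c t (vel t))) (to\<gamma> c t (W t)))"
    by (intro M.continuous_riem M.continuous_metric cc sub cV[OF V] cV[OF W])
  then have "continuous_on I (\<lambda>t. g (\<gamma> t) (curv t (V t)) (W t))"
    by (rule continuous_on_eq) (use I curv_chart[OF c] in auto)
  moreover have "x \<in> I" using x d by (simp add: I_def)
  ultimately have "((\<lambda>t. g (\<gamma> t) (curv t (V t)) (W t)) \<longlongrightarrow> g (\<gamma> x) (curv x (V x)) (W x)) (at x within I)"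
    unfolding continuous_on_def by blast
  moreover have "at x within I = at x within {a..b}"
    by (rule at_within_nhd[of _ "ball x d"]) (use d in \<open>auto simp: I_def\<close>)
  ultimately show "((\<lambda>t. g (\<gamma> t) (curv t (V t)) (W t)) \<longlongrightarrow> g (\<gamma> x) (curv x (V x)) (W x)) (at x within {a..b})"
    by simp
qed

lemma continuous_K: "continuous_on {a..b} (\<lambda>t. K t x)"
proof -
  obtain h where h: "linear h" "\<And>y. h (lower y) = y" using lower_inverse by blast
  have "continuous_on {a..b} (\<lambda>t. g (\<gamma> a) (K t x) z)" for z
    by (rule continuous_on_eq[OF continuous_curv[OF frame_parallel[of _ x] frame_parallel[of _ z]]]) (simp_all add: K_g)
  then have "continuous_on {a..b} (\<lambda>t. lower (K t x))"
    unfolding lower_def by (intro continuous_intros)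
  then have "continuous_on {a..b} (\<lambda>t. h (lower (K t x)))"
    using h(1) linear_continuous_on_compose by blast
  then show ?thesis by (simp add: h)
qed

sublocale jacobi_equation "g (\<gamma> a)" K a b
proof
  have "linear (K t)" if t: "t \<in> {a..b}" for t
    by (rule linearI; rule g_ext[of "\<gamma> a"])
      (simp_all add: K_g[OF t] g_simps linear_add[OF linear_curv] linear_add[OF linear_frame]
        linear_cmul[OF linear_curv] linear_cmul[OF linear_frame])
  then show "K t (y + z) = K t y + K t z" "K t (r *\<^sub>R y) = r *\<^sub>R K t y" if "t \<in> {a..b}" for t r y z
    using that linear_add linear_cmul by blast+
  show "g (\<gamma> a) (K t x) y = g (\<gamma> a) x (K t y)" if "t \<in> {a..b}" for t x y
    using curv_sym[of t "frame t y" "frame t x"]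
    by (simp add: sym_g[of "\<gamma> a" x] K_g[OF that] sym_g[of "\<gamma> t" "frame t y"])
qed (use ab bilinear_g sym_g continuous_K in auto)

lemma K_vel: "t \<in> {a..b} \<Longrightarrow> K t (vel a) = 0"
  using coframe(1)[of t 0] by (simp add: K_def vel_frame[symmetric] curv_vel linear_0[OF linear_frame])

lemma sol_jacobi:
  assumes "sol y y'"
  shows "jacobi_field A g a b \<gamma> (\<lambda>t. frame t (y t)) (\<lambda>t. frame t (y' t))"
  unfolding jacobi_field_def
proof (intro ballI conjI)
  fix t assume t: "t \<in> {a..b}"
  note d = assms[unfolded sol_def, rule_format, OF t]
  show "has_cov_deriv A g a b \<gamma> (\<lambda>t. frame t (y t)) (frame t (y' t)) t" using d by (intro frame_cov t) auto
  have "frame t (K t (y t)) = curvature A g (\<gamma> t) (vel t) (frame t (y t)) (vel t)"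
    by (simp add: K_def coframe[OF t] curv_def)
  then show "has_cov_deriv A g a b \<gamma> (\<lambda>t. frame t (y' t)) (curvature A g (\<gamma> t) (vel t) (frame t (y t)) (vel t)) t"
    using frame_cov[OF t, of y' "K t (y t)"] d by simp
qed

text \<open>Since \<open>frame\<close> is isometric, pairing \<open>coframe s (V s)\<close> with
  \<open>z\<close> amounts to pairing \<open>V s\<close> with the parallel field
  \<open>frame s z\<close>; \<open>metric_deriv\<close> then gives its derivative.\<close>

lemma jacobi_sol:
  assumes "jacobi_field A g a b \<gamma> J J'"
  shows "sol (\<lambda>t. coframe t (J t)) (\<lambda>t. coframe t (J' t))"
proof -
  have co: "((\<lambda>s. coframe s (V s)) has_vector_derivative coframe t w) (at t within {a..b})"
    if t: "t \<in> {a..b}" and V: "has_cov_deriv A g a b \<gamma> V w t" for V w t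
  proof (rule frame_vector_derivative)
    fix z
    have e: "g (\<gamma> a) (coframe s u) z = g (\<gamma> s) u (frame s z)" if "s \<in> {a..b}" for s u
      using frame_isometry[OF that, of "coframe s u" z] by (simp add: coframe[OF that])
    show "((\<lambda>s. g (\<gamma> a) (coframe s (V s)) z) has_vector_derivative g (\<gamma> a) (coframe t w) z) (at t within {a..b})"
      unfolding e[OF t]
      by (rule has_vector_derivative_transform[OF t e])
        (use metric_deriv[OF V frame_parallel[OF t] t, of z] in \<open>simp_all add: g_simps\<close>)
  qed
  show ?thesis unfolding sol_def
  proof (intro ballI conjI)
    fix t assume t: "t \<in> {a..b}"
    note d = assms[unfolded jacobi_field_def, rule_format, OF t]
    show "((\<lambda>t. coframe t (J t)) has_vector_derivative coframe t (J' t)) (at t within {a..b})"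
      using d by (intro co t) auto
    have "K t (coframe t (J t)) = coframe t (curvature A g (\<gamma> t) (vel t) (J t) (vel t))"
      by (simp add: K_def coframe[OF t] curv_def)
    then show "((\<lambda>t. coframe t (J' t)) has_vector_derivative K t (coframe t (J t))) (at t within {a..b})"
      using co[OF t] d by simp
  qed
qed

text \<open>Transport gives existence of a Jacobi field with the given data, so the choice in
  \<open>jacobi_from\<close> is a genuine one; uniqueness of solutions then fixes its value on
  \<open>{a..b}\<close>.\<close>

lemma ell_iff:
  assumes t: "t \<in> {a..b}"
  shows "(v, w) \<in> ell A g a b \<gamma> t \<longleftrightarrow> fst (flow (v, w)) t = 0"
proof -
  let ?J = "jacobi_from A g a b \<gamma> v w"
  have "\<exists>J. \<exists>J'. jacobi_field A g a b \<gamma> J J' \<and> J a = v \<and> J' a = w"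
    using sol_jacobi[OF flow(1)[of "(v, w)"]]
    by (intro exI[of _ "\<lambda>t. frame t (fst (flow (v, w)) t)"] exI[of _ "\<lambda>t. frame t (snd (flow (v, w)) t)"])
      (simp add: frame_a flow)
  from someI_ex[OF this] obtain J' where J: "jacobi_field A g a b \<gamma> ?J J'" "?J a = v" "J' a = w"
    unfolding jacobi_from_def by blast
  have "coframe a u = u" for u using coframe(1)[of a u] ab by (simp add: frame_a)
  then have "coframe t (?J t) = fst (flow (v, w)) t"
    using sol_unique(1)[OF jacobi_sol[OF J(1)] flow(1)[of "(v, w)"] _ _ t] J(2,3) by (simp add: flow)
  then have "?J t = frame t (fst (flow (v, w)) t)" using coframe(2)[OF t, of "?J t"] by simp
  then show ?thesis
    using linear_injective_0[OF linear_frame] frame_inj[OF t] linear_0[OF linear_frame]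
    by (auto simp: ell_def)
qed

end

subsection \<open>Tangent spaces of submanifolds\<close>

lemma Ck_on_cong_open:
  assumes "open X" "\<And>x. x \<in> X \<Longrightarrow> f x = g x" "Ck_on k X f"
  shows "Ck_on k X g"
  using assms(2,3)
proof (induction k arbitrary: f g)
  case 0 then show ?case by (simp cong: continuous_on_cong)
next
  case (Suc k)
  have "g differentiable (at x)" if "x \<in> X" for x
  proof -
    have "(f has_derivative fd f x) (at x)" using Suc.prems(2) that by (simp add: fd_works)
    from has_derivative_transform_within_open[OF this assms(1) that Suc.prems(1)]
    show ?thesis by (rule differentiableI)
  qed
  moreover have "Ck_on k X (\<lambda>x. fd g x v)" for v
    by (rule Suc.IH[of "\<lambda>x. fd f x v"])
      (use Suc.prems in \<open>auto simp: fd_cong_open[OF assms(1) _ Suc.prems(1)]\<close>)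
  ultimately show ?case by simp
qed

text \<open>The factor \<open>r\<close> closes the induction: differentiating in the direction
  \<open>h\<close> gives the same shape for the derivative of \<open>f\<close>, with factor
  \<open>r * h\<close>.\<close>

lemma Ck_on_affine:
  fixes f :: "'a::euclidean_space \<Rightarrow> 'b::real_normed_vector"
  assumes T: "open T" and "Ck_on k X f" and "(\<lambda>t::real. x + t *\<^sub>R w) ` T \<subseteq> X"
  shows "Ck_on k T (\<lambda>t. r *\<^sub>R f (x + t *\<^sub>R w))"
  using assms(2)
proof (induction k arbitrary: f r)
  case 0
  then have "continuous_on T (\<lambda>t. f (x + t *\<^sub>R w))"
    by (intro continuous_on_compose2[of X f T] continuous_intros) (use assms(3) in auto)
  then show ?case by (auto intro: continuous_intros)
next
  case (Suc k)
  have d: "((\<lambda>t. r *\<^sub>R f (x + t *\<^sub>R w)) has_derivative (\<lambda>h. (r * h) *\<^sub>R fd f (x + t *\<^sub>R w) w)) (at t)"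
    if "x + t *\<^sub>R w \<in> X" for t r
  proof -
    have f: "(f has_derivative fd f (x + t *\<^sub>R w)) (at (x + t *\<^sub>R w))"
      using Suc.prems that by (simp add: fd_works)
    have "((\<lambda>t. x + t *\<^sub>R w) has_derivative (\<lambda>h. h *\<^sub>R w)) (at t)" by (auto intro!: derivative_eq_intros)
    from has_derivative_scaleR_right[OF has_derivative_compose[OF this f]] show ?thesis
      by (simp add: linear_cmul[OF has_derivative_linear[OF f]])
  qed
  have dom: "x + t *\<^sub>R w \<in> X" if "t \<in> T" for t using assms(3) that by auto
  show ?case unfolding Ck_on.simps
  proof (intro conjI ballI allI)
    show "(\<lambda>t. r *\<^sub>R f (x + t *\<^sub>R w)) differentiable (at t)" if "t \<in> T" for t
      using d[OF dom[OF that]] by (rule differentiableI)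
    fix h :: real
    show "Ck_on k T (\<lambda>t. fd (\<lambda>t. r *\<^sub>R f (x + t *\<^sub>R w)) t h)"
    proof (rule Ck_on_cong_open[OF T])
      show "Ck_on k T (\<lambda>t. (r * h) *\<^sub>R fd f (x + t *\<^sub>R w) w)"
        using Suc.prems by (intro Suc.IH) simp
    qed (simp add: fd_eqI[OF d] dom)
  qed
qed

lemma compatible_sym: "compatible c d \<Longrightarrow> compatible d c"
  unfolding compatible_def by (simp add: Int_commute)

text \<open>Tangent vectors are velocities of curves, for which addition has no direct meaning. A
  slice chart identifies them with the image of the linear subspace \<open>W\<close> under the
  differential \<open>L\<close> of a transition map.\<close>

lemma (in semi_riemannian_manifold) subspace_tangent_space:
  assumes P: "submanifold A P" and p: "p \<in> P"
  shows "subspace (tangent_space A P p)"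
proof -
  define c0 where "c0 = chart_at A p"
  have c0: "c0 \<in> A" "p \<in> dom_of c0" by (simp_all add: c0_def chart_at)
  obtain c W where c: "c \<in> maximal_atlas A" "p \<in> dom_of c" and W: "subspace W"
    and slice: "coord c ` (dom_of c \<inter> P) = coord c ` dom_of c \<inter> W"
    using P p unfolding submanifold_def by metis
  have "is_chart c \<and> (\<forall>d\<in>A. compatible c d)"
    using c(1) unfolding maximal_atlas_def by (rule CollectD)
  then have ch: "is_chart c" and comp: "\<And>d. d \<in> A \<Longrightarrow> compatible c d" "\<And>d. d \<in> A \<Longrightarrow> compatible d c"
    by (blast intro: compatible_sym)+
  have ch0: "is_chart c0" by (rule chart[OF c0(1)])
  define x0 where "x0 = coord c p"
  define L where "L = fd (transition c c0) x0"
  define L' where "L' = fd (transition c0 c) (coord c0 p)"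
  have L: "(transition c c0 has_derivative L) (at x0)"
    unfolding L_def x0_def by (rule transition_has_derivative[OF comp(1)[OF c0(1)] c(2) c0(2)])
  have L': "(transition c0 c has_derivative L') (at (coord c0 p))"
    unfolding L'_def by (rule transition_has_derivative[OF comp(2)[OF c0(1)] c0(2) c(2)])
  have LL': "L (L' v) = v" for v
    unfolding L_def L'_def x0_def by (rule fd_transition_inverse[OF ch0 ch comp(2,1)[OF c0(1)] c0(2) c(2)])
  have x0W: "x0 \<in> W" using slice c(2) p unfolding x0_def by blast
  have "tangent_space A P p \<subseteq> L ` W"
  proof
    fix v assume "v \<in> tangent_space A P p"
    then obtain \<sigma> \<epsilon> where \<epsilon>: "\<epsilon> > 0" and sm: "smooth_curve_on A {-\<epsilon><..<\<epsilon>} \<sigma>" and \<sigma>P: "\<sigma> ` {-\<epsilon><..<\<epsilon>} \<subseteq> P"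
      and \<sigma>0: "\<sigma> 0 = p" and d: "((coord c0 \<circ> \<sigma>) has_vector_derivative v) (at 0)"
      unfolding tangent_space_def c0_def by blast
    have "isCont \<sigma> 0"
      using sm \<epsilon> by (simp add: smooth_curve_on_def continuous_on_eq_continuous_at)
    then have lim: "(\<sigma> \<longlongrightarrow> p) (at 0)" by (simp add: isCont_def \<sigma>0)
    have ev: "\<forall>\<^sub>F t in at 0. t \<in> {-\<epsilon><..<\<epsilon>}"
      using \<epsilon> by (intro eventually_at_in_open') auto
    have "open (dom_of c)" using ch by (simp add: is_chart_def)
    from topological_tendstoD[OF lim this c(2)] have ev1: "\<forall>\<^sub>F t in at 0. \<sigma> t \<in> dom_of c" .
    from topological_tendstoD[OF lim open_dom[OF c0(1)] c0(2)] have ev2: "\<forall>\<^sub>F t in at 0. \<sigma> t \<in> dom_of c0" .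
    have "((\<lambda>t. coord c0 (\<sigma> t)) has_derivative (\<lambda>h. h *\<^sub>R v)) (at 0)"
      using d by (simp add: has_vector_derivative_def o_def)
    from has_derivative_compose[OF this L'[folded \<sigma>0]]
    have "((\<lambda>t. transition c0 c (coord c0 (\<sigma> t))) has_derivative (\<lambda>h. h *\<^sub>R L' v)) (at 0)"
      by (simp add: linear_cmul[OF has_derivative_linear[OF L']])
    then have "((\<lambda>t. coord c (\<sigma> t)) has_derivative (\<lambda>h. h *\<^sub>R L' v)) (at 0)"
      by (rule has_derivative_transform_eventually)
        (use ev2 in \<open>eventually_elim, simp add: transition_coord[OF ch0]\<close>,
         simp_all add: transition_coord[OF ch0] \<sigma>0 c0)
    \<comment> \<open>In the slice chart the difference quotients lie in \<open>W\<close>, and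
      \<open>W\<close> is closed, so the derivative lies in it too.\<close>
    then have "((\<lambda>t. (coord c (\<sigma> t) - coord c (\<sigma> 0)) /\<^sub>R (t - 0)) \<longlongrightarrow> L' v) (at 0)"
      by (intro has_vector_derivative_quotient) (simp add: has_vector_derivative_def)
    moreover have "\<forall>\<^sub>F t in at 0. (coord c (\<sigma> t) - coord c (\<sigma> 0)) /\<^sub>R (t - 0) \<in> W"
      using ev ev1
    proof eventually_elim
      case (elim t)
      then have "coord c (\<sigma> t) \<in> W" using slice \<sigma>P by blast
      then show ?case using x0W by (intro subspace_scale subspace_diff W) (simp_all add: \<sigma>0 x0_def)
    qed
    ultimately have "L' v \<in> W"
      by (intro Lim_in_closed_set[OF closed_subspace[OF W]]) auto
    then show "v \<in> L ` W" by (metis LL' imageI)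
  qed
  moreover have "L ` W \<subseteq> tangent_space A P p"
  proof
    fix v assume "v \<in> L ` W"
    then obtain w where w: "w \<in> W" "v = L w" by blast
    \<comment> \<open>Conversely, a straight line in the slice through \<open>x0\<close> lifts to a
      curve in \<open>P\<close> with the prescribed velocity; as \<open>W\<close> is linear and
      contains \<open>x0\<close>, the line stays in it.\<close>
    define l where "l t = x0 + t *\<^sub>R w" for t :: real
    define \<sigma> where "\<sigma> t = chart_inv c (l t)" for t
    have lc: "continuous_on X l" for X unfolding l_def by (intro continuous_intros)
    have opc: "open (coord c ` dom_of c)" using ch by (simp add: is_chart_def)
    have "open (l -` (coord c ` dom_of c))" using opc by (rule open_vimage) (rule lc)
    moreover have "0 \<in> l -` (coord c ` dom_of c)" using c(2) by (simp add: l_def x0_def)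
    ultimately obtain \<epsilon> where \<epsilon>: "\<epsilon> > 0" "ball 0 \<epsilon> \<subseteq> l -` (coord c ` dom_of c)"
      unfolding open_contains_ball by blast
    let ?I = "{-\<epsilon><..<\<epsilon>}"
    have lI: "l t \<in> coord c ` dom_of c" if "t \<in> ?I" for t
      using \<epsilon>(2) that by (auto simp: subset_iff dist_real_def)
    have "continuous_on (coord c ` dom_of c) (chart_inv c)"
      using ch by (simp add: is_chart_def homeomorphism_def)
    then have cont: "continuous_on ?I \<sigma>"
      unfolding \<sigma>_def by (rule continuous_on_compose2[OF _ lc]) (use lI in auto)
    have tr: "coord d \<circ> \<sigma> = (\<lambda>t. transition c d (l t))" for d
      by (auto simp: transition_def \<sigma>_def)
    have "C_infinity_on {t \<in> ?I. \<sigma> t \<in> dom_of d} (coord d \<circ> \<sigma>)" if d: "d \<in> A" for d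
    proof -
      let ?X = "coord c ` (dom_of c \<inter> dom_of d)"
      have "{t \<in> ?I. \<sigma> t \<in> dom_of d} = ?I \<inter> \<sigma> -` dom_of d" by auto
      then have op: "open {t \<in> ?I. \<sigma> t \<in> dom_of d}"
        using continuous_open_preimage[OF cont _ open_dom[OF d]] by simp
      have "l t \<in> ?X" if "t \<in> ?I" "\<sigma> t \<in> dom_of d" for t
      proof -
        have "l t = coord c (\<sigma> t)" "\<sigma> t \<in> dom_of c"
          using chart_inv_right[OF ch lI[OF that(1)]] by (simp_all add: \<sigma>_def)
        then show ?thesis using that(2) by blast
      qed
      then have "(\<lambda>t. x0 + t *\<^sub>R w) ` {t \<in> ?I. \<sigma> t \<in> dom_of d} \<subseteq> ?X"
        by (auto simp: l_def)
      from Ck_on_affine[OF op _ this, of _ "transition c d" 1] compatible_smooth[OF comp(1)[OF d]]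
      show ?thesis unfolding tr C_infinity_on_def by (simp add: l_def)
    qed
    then have "smooth_curve_on A ?I \<sigma>" using cont by (simp add: smooth_curve_on_def)
    moreover have "\<sigma> ` ?I \<subseteq> P"
    proof
      fix q assume "q \<in> \<sigma> ` ?I"
      then obtain t where t: "t \<in> ?I" "q = \<sigma> t" by blast
      have "l t \<in> W" unfolding l_def by (intro subspace_add subspace_scale W x0W w)
      then have "l t \<in> coord c ` (dom_of c \<inter> P)" using slice lI[OF t(1)] by blast
      then show "q \<in> P" using chart_inv_left[OF ch] by (auto simp: t \<sigma>_def)
    qed
    moreover have "\<sigma> 0 = p" by (simp add: \<sigma>_def l_def x0_def chart_inv_left ch c)
    moreover have "((coord c0 \<circ> \<sigma>) has_vector_derivative v) (at 0)"
    proof -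
      have "(l has_derivative (\<lambda>h. h *\<^sub>R w)) (at 0)" unfolding l_def by (auto intro!: derivative_eq_intros)
      moreover have "(transition c c0 has_derivative L) (at (l 0))" using L by (simp add: l_def)
      ultimately have "((\<lambda>t. transition c c0 (l t)) has_derivative (\<lambda>h. L (h *\<^sub>R w))) (at 0)"
        by (rule has_derivative_compose)
      then show ?thesis unfolding tr has_vector_derivative_def
        by (simp add: w linear_cmul[OF has_derivative_linear[OF L]])
    qed
    ultimately show "v \<in> tangent_space A P p"
      unfolding tangent_space_def using \<epsilon>(1) by (auto simp: c0_def)
  qed
  ultimately have "tangent_space A P p = L ` W" by blast
  then show ?thesis using linear_subspace_image[OF has_derivative_linear[OF L] W] by simp
qed

subsection \<open>Focal and conjugate instants\<close>

text \<open>Two orthogonal vectors on which the form is negative span a negative definite plane, too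
  large for index one.\<close>

lemma index_one_nonneg:
  assumes bil: "bilinear B" and sym: "\<And>u v. B u v = B v u" and ind: "form_index B = 1"
    and n: "B n n < 0" and x: "B x n = 0"
  shows "0 \<le> B x x"
proof (rule ccontr)
  assume neg: "\<not> 0 \<le> B x x"
  let ?W = "span {n, x}"
  note bl = bilinear_ladd[OF bil] bilinear_radd[OF bil] bilinear_lmul[OF bil] bilinear_rmul[OF bil]
  have "B w w < 0" if "w \<in> ?W" "w \<noteq> 0" for w
  proof -
    from that(1) obtain r where "w - r *\<^sub>R n \<in> span {x}" by (auto simp: span_insert)
    then obtain s where "w - r *\<^sub>R n = s *\<^sub>R x" by (auto simp: span_singleton)
    then have w: "w = r *\<^sub>R n + s *\<^sub>R x" by (simp add: algebra_simps)
    have "B w w = r\<^sup>2 * B n n + s\<^sup>2 * B x x"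
      by (simp add: w bl x sym[of n x] power2_eq_square algebra_simps)
    moreover have "r \<noteq> 0 \<or> s \<noteq> 0" using that(2) w by auto
    moreover have "r\<^sup>2 * B n n \<le> 0" "s\<^sup>2 * B x x \<le> 0"
      using n neg by (auto simp: mult_le_0_iff)
    moreover have "r \<noteq> 0 \<Longrightarrow> r\<^sup>2 * B n n < 0" "s \<noteq> 0 \<Longrightarrow> s\<^sup>2 * B x x < 0"
      using n neg by (auto simp: mult_less_0_iff)
    ultimately show ?thesis by linarith
  qed
  \<comment> \<open>Finiteness makes \<open>Max\<close> in \<open>form_index\<close> an upper bound
    for these dimensions.\<close>
  moreover have fin: "finite {dim W |W. subspace W \<and> (\<forall>w\<in>W. w \<noteq> 0 \<longrightarrow> B w w < 0)}"
    by (rule finite_subset[of _ "{..DIM('a)}"]) (auto intro: dim_subset_UNIV)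
  ultimately have "dim ?W \<le> 1"
    unfolding ind[symmetric] form_index_def by (intro Max_ge[OF fin] CollectI exI[of _ ?W]) auto
  moreover have "dim ?W = 2"
  proof -
    have "n \<noteq> 0" using n bilinear_lzero[OF bil] by auto
    have "x \<notin> span {n}"
    proof
      assume "x \<in> span {n}"
      then obtain k where k: "x = k *\<^sub>R n" by (auto simp: span_singleton)
      with x n have "k = 0" by (simp add: bl)
      with k neg show False by (simp add: bilinear_lzero[OF bil])
    qed
    then have "independent {x, n}" "x \<noteq> n"
      using \<open>n \<noteq> 0\<close> span_base[of n "{n}"] by (auto simp: independent_insert)
    then show ?thesis by (simp add: dim_eq_card_independent insert_commute)
  qed
  ultimately show False by simp
qed

theorem corollary4p6:
  fixes A :: "('m::{t2_space, second_countable_topology}, 'e::euclidean_space) chart set"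
    and g :: "'m \<Rightarrow> 'e \<Rightarrow> 'e \<Rightarrow> real"
    and a b :: real and \<gamma> :: "real \<Rightarrow> 'm"
    and P :: "'m set" and S :: "'e \<Rightarrow> 'e"
  assumes "semi_riemannian A g"
    and "a < b"
    and "geodesic A g a b \<gamma>"
    and "submanifold A P" and "connected P"
    and "\<gamma> a \<in> P"
    and "velocity A a b \<gamma> a \<in> orth (g (\<gamma> a)) (tangent_space A P (\<gamma> a))"
    and "nondegenerate_on (g (\<gamma> a)) (tangent_space A P (\<gamma> a))"
    and "riemannian g \<or>
         (lorentzian g \<and>
          (\<forall>t\<in>{a..b}. g (\<gamma> t) (velocity A a b \<gamma> t) (velocity A a b \<gamma> t) < 0))"
    and "second_fundamental_operator A g P (\<gamma> a) (velocity A a b \<gamma> a) S"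
  shows "first_focal A g a b \<gamma> P S \<le> first_conjugate A g a b \<gamma> \<and>
         (first_focal A g a b \<gamma> P S = first_conjugate A g a b \<gamma> \<longrightarrow>
            focal_multiplicity A g a b \<gamma> P S (first_focal A g a b \<gamma> P S)
              \<ge> conjugate_multiplicity A g a b \<gamma> (first_focal A g a b \<gamma> P S))"
proof -
  interpret geodesic_segment A g a b \<gamma>
    using assms(1-3) by unfold_locales
  let ?T = "tangent_space A P (\<gamma> a)"
  \<comment> \<open>With \<open>n = 0\<close> the orthogonality conditions are void and the form is
    positive on the whole space; otherwise \<open>index_one_nonneg\<close> gives nonnegativity
    orthogonally to the timelike velocity.\<close>
  define n where "n = (if riemannian g then 0 else vel a)"
  interpret focal_problem "g (\<gamma> a)" K a b n ?T S
  proof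
    show "K t n = 0" if "t \<in> {a..b}" for t
      using K_vel[OF that] linear_0[OF linK[OF that]] by (simp add: n_def)
    show "0 \<le> g (\<gamma> a) x x" if "g (\<gamma> a) x n = 0" for x
    proof (cases "riemannian g")
      case True
      then show ?thesis by (cases "x = 0") (auto simp: riemannian_def g_simps less_imp_le)
    next
      case False
      then have "form_index (g (\<gamma> a)) = 1" "g (\<gamma> a) n n < 0"
        using assms(9) ab by (auto simp: lorentzian_def n_def)
      from index_one_nonneg[OF bilinear_g sym_g this that] show ?thesis .
    qed
    show "subspace ?T" by (rule subspace_tangent_space[OF assms(4,6)])
    show "g (\<gamma> a) u n = 0" if "u \<in> ?T" for u
      using assms(7) that sym_g[of "\<gamma> a" u] by (auto simp: n_def orth_def g_simps)
    show "nondegenerate_on (g (\<gamma> a)) ?T" by (rule assms(8))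
    note S = assms(10)[unfolded second_fundamental_operator_def Let_def]
    show "S u \<in> ?T" if "u \<in> ?T" for u using S that by blast
    show "S (u + v) = S u + S v" if "u \<in> ?T" "v \<in> ?T" for u v using S that by blast
    show "S (r *\<^sub>R u) = r *\<^sub>R S u" if "u \<in> ?T" for r u using S that by blast
    show "g (\<gamma> a) (S u) v = g (\<gamma> a) u (S v)" if "u \<in> ?T" "v \<in> ?T" for u v using S that by blast
  qed
  let ?LP = "LP A g P (\<gamma> a) S"
  have focal: "focal_instant A g a b \<gamma> P S t \<longleftrightarrow> \<not> focal_free t" if t: "t \<in> {a<..b}" for t
  proof -
    let ?X = "ell A g a b \<gamma> t \<inter> ?LP"
    have mem: "(v, w) \<in> ?X \<longleftrightarrow>
        v \<in> ?T \<and> (\<forall>u\<in>?T. g (\<gamma> a) (w + S v) u = 0) \<and> fst (flow (v, w)) t = 0" for v w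
      using ell_iff[of t v w] t by (auto simp: LP_def orth_def)
    \<comment> \<open>The definition compares with \<open>{0}\<close>, so an intersection different
      from it contains a nonzero vector only once zero is known to belong to it.\<close>
    have "0 \<in> ?X"
      using mem[of 0 0] t linear_0[OF linear_flow(1)[of t]] subspace_0[OF T]
      by (auto simp: S0 g_simps zero_prod_def)
    then have "?X \<noteq> {0} \<longleftrightarrow> (\<exists>p\<in>?X. p \<noteq> 0)" by blast
    also have "\<dots> \<longleftrightarrow> (\<exists>v w. (v, w) \<in> ?X \<and> \<not> (v = 0 \<and> w = 0))" by (force simp: zero_prod_def)
    also have "\<dots> \<longleftrightarrow> \<not> focal_free t" unfolding mem focal_free_def by blast
    finally show ?thesis using t by (simp add: focal_instant_def)
  qed
  \<comment> \<open>For \<open>v = 0\<close> membership in \<open>LP\<close> says that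
    \<open>w\<close> is orthogonal to the tangent space, which is the conclusion of
    \<open>conjugate_orth\<close>.\<close>
  have sub: "ell A g a b \<gamma> t \<inter> L0 \<subseteq> ell A g a b \<gamma> t \<inter> ?LP"
    if t: "t \<in> {a<..b}" and ff: "\<And>s. s \<in> {a<..<t} \<Longrightarrow> \<not> focal_instant A g a b \<gamma> P S s" for t
  proof
    fix p assume p: "p \<in> ell A g a b \<gamma> t \<inter> L0"
    obtain v w where vw: "p = (v, w)" by (rule prod.exhaust)
    have l: "(v, w) \<in> ell A g a b \<gamma> t" and v: "v = 0" using p by (auto simp: vw L0_def)
    have "g (\<gamma> a) (snd (flow (v, w)) a) u = 0" if "u \<in> ?T" for u
    proof (rule conjugate_orth[OF t _ flow(1) _ _ that])
      show "focal_free s" if "s \<in> {a<..<t}" for s using ff[OF that] focal[of s] that t by auto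
      show "fst (flow (v, w)) a = 0" by (simp add: flow v)
      show "fst (flow (v, w)) t = 0" using l ell_iff[of t v w] t by simp
    qed
    then have "(v, w) \<in> ?LP"
      using subspace_0[OF T] by (simp add: LP_def orth_def v S0 flow(3))
    then show "p \<in> ell A g a b \<gamma> t \<inter> ?LP" using l by (simp add: vw)
  qed
  have conj_focal: "focal_instant A g a b \<gamma> P S t"
    if ff: "\<And>s. s \<in> {a<..<t} \<Longrightarrow> \<not> focal_instant A g a b \<gamma> P S s" and c: "conjugate_instant A g a b \<gamma> t" for t
  proof -
    have t: "t \<in> {a<..b}" using c by (simp add: conjugate_instant_def)
    have "0 \<in> ell A g a b \<gamma> t \<inter> L0"
      using ell_iff[of t 0 0] t linear_0[OF linear_flow(1)[of t]] by (auto simp: L0_def zero_prod_def)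
    then obtain p where "p \<in> ell A g a b \<gamma> t \<inter> L0" "p \<noteq> 0"
      using c unfolding conjugate_instant_def by blast
    then have "p \<in> ell A g a b \<gamma> t \<inter> ?LP" "p \<noteq> 0" using sub[OF t ff] by auto
    then show ?thesis using t unfolding focal_instant_def by blast
  qed
  let ?F = "{t \<in> {a<..b}. \<forall>s\<in>{a<..t}. \<not> focal_instant A g a b \<gamma> P S s}"
  let ?C = "{t \<in> {a<..b}. \<forall>s\<in>{a<..t}. \<not> conjugate_instant A g a b \<gamma> s}"
  obtain s where s: "s \<in> {a<..b}" "\<And>t. t \<in> {a<..s} \<Longrightarrow> focal_free t" using focal_free_near by blast
  then have ne: "?F \<noteq> {}" using focal by fastforce
  have bdd: "bdd_above ?F" "bdd_above ?C" by (auto intro!: bdd_aboveI[of _ b])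
  \<comment> \<open>If all of \<open>{a<..t}\<close> is free of focal instants, a conjugate instant
    \<open>s\<close> in it would have no focal instant before it, hence be focal itself.\<close>
  have "?F \<subseteq> ?C"
  proof
    fix t assume t: "t \<in> ?F"
    have "\<not> conjugate_instant A g a b \<gamma> s" if "s \<in> {a<..t}" for s
      using conj_focal[of s] t that by auto
    then show "t \<in> ?C" using t by blast
  qed
  then have le: "first_focal A g a b \<gamma> P S \<le> first_conjugate A g a b \<gamma>"
    unfolding first_focal_def first_conjugate_def using ne bdd by (intro cSup_subset_mono)
  define \<tau> where "\<tau> = first_focal A g a b \<gamma> P S"
  \<comment> \<open>An instant below the supremum lies below some member of \<open>?F\<close>. The
    supremum \<open>\<tau>\<close> itself may be focal, and this is why \<open>sub\<close> looks
    only at earlier instants.\<close>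
  have ff: "\<not> focal_instant A g a b \<gamma> P S s" if "s \<in> {a<..<\<tau>}" for s
  proof -
    have "s < Sup ?F" using that by (simp add: \<tau>_def first_focal_def)
    then obtain t where "t \<in> ?F" "s < t" using less_cSup_iff[OF ne bdd(1)] by blast
    then show ?thesis using that by auto
  qed
  have "conjugate_multiplicity A g a b \<gamma> \<tau> \<le> focal_multiplicity A g a b \<gamma> P S \<tau>"
  proof (cases "conjugate_instant A g a b \<gamma> \<tau>")
    case True
    then have "\<tau> \<in> {a<..b}" by (simp add: conjugate_instant_def)
    from dim_subset[OF sub[OF this ff]] conj_focal[OF ff True] True show ?thesis
      by (simp add: conjugate_multiplicity_def focal_multiplicity_def)
  qed (simp add: conjugate_multiplicity_def)
  with le show ?thesis unfolding \<tau>_def by blast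
qed

end
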